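(* For every $n$-dimensional locally finite simplicial complex $K$ and every $0\leq p\leq n$, the measure $q_{D(\sigma)}(T)\,d\gamma^d_{p,K}(\sigma)$ weakly converges to $$\sum_{l=0}^{n-p}\left(\sum_{h=l}^{n-p}q_{p+h,n}\,f_p(\Delta_{p+h})\,\lambda_{h,l}\right)T^l\,d\mathrm{vol}_K$$ as $d$ grows to $+\infty$.
   Context: $\mathrm{Sd}(K)$ is the barycentric subdivision of $K$, whose simplices are $[\hat\sigma_0,\ldots,\hat\sigma_p]$ with $\sigma_0<\cdots<\sigma_p$ simplices of $K$ ($<$ meaning proper face, $\hat\sigma$ the barycenter of $\sigma$); $\mathrm{Sd}^d(K)$ is the $d$-th iterate. $K^{[p]}$ is the set of $p$-dimensional simplices of $K$, and $f_p(K)=\#K^{[p]}$ for a finite complex. $\Delta_m$ is the standard $m$-simplex, so $f_p(\Delta_m)=\binom{m+1}{p+1}$. The block dual to a simplex $\sigma$ of a complex $L$ is $D(\sigma)=\{[\hat\sigma_0,\ldots,\hat\sigma_k]\in\mathrm{Sd}(L)\mid k\ge 0,\ \sigma_0=\sigma\}$, and $q_{D(\sigma)}(T)=\sum_{l\geq0}f_l(D(\sigma))T^l$, where $f_l(D(\sigma))$ is the number of $l$-dimensional simplices in the set $D(\sigma)$. For $\sigma\in \mathrm{Sd}^d(K)$, $D(\sigma)$ is taken with $L=\mathrm{Sd}^d(K)$. For $d\geq0$, $\gamma^d_{p,K}=\frac{1}{(n+1)!^d}\sum_{\sigma\in \mathrm{Sd}^d(K)^{[p]}}\delta_{\hat\sigma}$,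 where $\delta_{\hat\sigma}$ is the Dirac measure at $\hat\sigma$. Thus the measure $q_{D(\sigma)}(T)\,d\gamma^d_{p,K}(\sigma)$ is the polynomial-valued measure $\frac{1}{(n+1)!^d}\sum_{\sigma\in \mathrm{Sd}^d(K)^{[p]}}q_{D(\sigma)}(T)\,\delta_{\hat\sigma}$ on $|K|$. Let $d\mathrm{vol}_{\Delta_n}$ be Lebesgue measure on $\Delta_n$ normalized to total mass $1$; then $d\mathrm{vol}_K=\sum_{\sigma\in K^{[n]}}(f_\sigma)_*(d\mathrm{vol}_{\Delta_n})$, where $f_\sigma:\Delta_n\to\sigma$ is a simplicial isomorphism. For $i,j\geq1$, $\lambda_{i,j}$ is the number of $(j-1)$-dimensional simplices of $\mathrm{Sd}(\Delta_{i-1})$ that are interior, i.e. not contained in $\partial\Delta_{i-1}$; moreover $\lambda_{0,0}=1$ and $\lambda_{l,0}=0$ for $l>0$. For $0\le p\le n$, $q_{p,n}>0$ is defined by $q_{p,n}=\lim_{d\to+\infty}\frac{f_p(\mathrm{Sd}^d(L))}{(n+1)!^d f_n(L)}$, where $L$ is any $n$-dimensional finite simplicial complex; it is a known theorem (Brenti–Welker, Delucchi–Pixton–Sabalka) that this limit exists, is positive and does not depend on $L$. Weak convergence of measures on $|K|$ means convergence of the integrals of every continuous function with compact support in $|K|$. *)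

theory Defs
  imports "HOL-Analysis.Analysis" "HOL-Analysis.Finite_Function_Topology"
    "HOL-Computational_Algebra.Polynomial"
begin

text \<open>
  The library predicate \<^const>\<open>simplicial_complex\<close> is restricted to finite complexes in Euclidean
  spaces. Here a complex is a set of simplices, each given by its finite vertex set, in an arbitrary
  normed space. An abstract complex with vertex type 'v is realised in
  \<open>'v \<Rightarrow>\<^sub>0 real\<close>, so no embeddability or countability restriction is involved.
  With this encoding \<open>\<sigma>\<close> is a proper face of \<open>\<tau>\<close> iff \<open>\<sigma> \<subset> \<tau>\<close>.
\<close>

definition geometric_complex :: "'a::real_normed_vector set set \<Rightarrow> bool" where
  "geometric_complex K \<longleftrightarrow>
     (\<forall>s\<in>K. finite s \<and> s \<noteq> {} \<and> \<not> affine_dependent s) \<and>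
     (\<forall>s\<in>K. \<forall>t. t \<subseteq> s \<and> t \<noteq> {} \<longrightarrow> t \<in> K) \<and>
     (\<forall>s\<in>K. \<forall>t\<in>K. convex hull s \<inter> convex hull t = convex hull (s \<inter> t))"

definition locally_finite_complex :: "'a set set \<Rightarrow> bool" where
  "locally_finite_complex K \<longleftrightarrow> (\<forall>v. finite {s \<in> K. v \<in> s})"

definition has_dimension :: "'a set set \<Rightarrow> nat \<Rightarrow> bool" where
  "has_dimension K n \<longleftrightarrow> (\<forall>s\<in>K. card s \<le> n + 1) \<and> (\<exists>s\<in>K. card s = n + 1)"

definition simplices :: "nat \<Rightarrow> 'a set set \<Rightarrow> 'a set set" where
  "simplices p K = {s \<in> K. card s = p + 1}"

definition face_number :: "nat \<Rightarrow> 'a set set \<Rightarrow> nat" where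
  "face_number p K = card (simplices p K)"

definition realization :: "'a::real_normed_vector set set \<Rightarrow> 'a set" where
  "realization K = (\<Union>s\<in>K. convex hull s)"

text \<open>
  The usual (coherent) topology on the realization. It may be finer than the subspace topology
  inherited from the ambient space.
\<close>

definition complex_topology :: "'a::real_normed_vector set set \<Rightarrow> 'a topology" where
  "complex_topology K = topology (\<lambda>U. U \<subseteq> realization K \<and>
     (\<forall>s\<in>K. openin (top_of_set (convex hull s)) (U \<inter> convex hull s)))"

definition barycenter :: "'a::real_normed_vector set \<Rightarrow> 'a" where
  "barycenter s = (1 / real (card s)) *\<^sub>R (\<Sum>v\<in>s. v)"

definition sd :: "'a::real_normed_vector set set \<Rightarrow> 'a set set" where
  "sd K = {barycenter ` set xs | xs. xs \<noteq> [] \<and> set xs \<subseteq> K \<and> sorted_wrt (\<subset>) xs}"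

definition dual_block :: "'a::real_normed_vector set set \<Rightarrow> 'a set \<Rightarrow> 'a set set" where
  "dual_block L \<sigma> =
     {barycenter ` set xs | xs. xs \<noteq> [] \<and> set xs \<subseteq> L \<and> sorted_wrt (\<subset>) xs \<and> hd xs = \<sigma>}"

text \<open>\<^const>\<open>Sum_any\<close> is the sum of a finitely supported family, here over all \<open>l \<ge> 0\<close>.\<close>

definition block_poly :: "'a::real_normed_vector set set \<Rightarrow> 'a set \<Rightarrow> real poly" where
  "block_poly L \<sigma> = Sum_any (\<lambda>l. monom (real (face_number l (dual_block L \<sigma>))) l)"

definition std_vertices :: "nat \<Rightarrow> (nat \<Rightarrow>\<^sub>0 real) set" where
  "std_vertices m = (\<lambda>i. Poly_Mapping.single i 1) ` {..m}"

definition std_simplex :: "nat \<Rightarrow> (nat \<Rightarrow>\<^sub>0 real) set set" where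
  "std_simplex m = {s. s \<noteq> {} \<and> s \<subseteq> std_vertices m}"

definition boundary_std_simplex :: "nat \<Rightarrow> (nat \<Rightarrow>\<^sub>0 real) set set" where
  "boundary_std_simplex m = std_simplex m - {std_vertices m}"

text \<open>The value at \<open>i = 0\<close>, \<open>j > 0\<close> is a dummy.\<close>

definition interior_number :: "nat \<Rightarrow> nat \<Rightarrow> nat" where
  "interior_number i j =
     (if j = 0 then (if i = 0 then 1 else 0)
      else if i = 0 then 0
      else card {\<tau> \<in> simplices (j - 1) (sd (std_simplex (i - 1))).
                   \<not> convex hull \<tau> \<subseteq> realization (boundary_std_simplex (i - 1))})"

text \<open>
  The common limit for all finite \<open>n\<close>-dimensional complexes. Every finite complex is
  simplicially isomorphic to one in \<open>nat \<Rightarrow>\<^sub>0 real\<close>, and face numbers of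
  iterated subdivisions only depend on the isomorphism type.
\<close>

definition limit_face_density :: "nat \<Rightarrow> nat \<Rightarrow> real" where
  "limit_face_density p n = (THE c. \<forall>L :: (nat \<Rightarrow>\<^sub>0 real) set set.
     geometric_complex L \<and> finite L \<and> has_dimension L n \<longrightarrow>
     (\<lambda>d. real (face_number p ((sd ^^ d) L)) / (fact (n + 1) ^ d * real (face_number n L)))
       \<longlonglongrightarrow> c)"

definition borel_of :: "'a topology \<Rightarrow> 'a measure" where
  "borel_of X = sigma (topspace X) {U. openin X U}"

text \<open>
  Normalised Lebesgue measure on the standard \<open>n\<close>-simplex in \<open>\<real>\<^sup>n\<^sup>+\<^sup>1\<close>, obtained by
  parametrising it by its first \<open>n\<close> barycentric coordinates. The parametrisation is affine, so it only
  rescales Lebesgue measure, which the normalisation cancels. For \<open>n = 0\<close> this is a Dirac measure.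
\<close>

definition corner :: "nat \<Rightarrow> (nat \<Rightarrow> real) set" where
  "corner n = {x \<in> {..<n} \<rightarrow>\<^sub>E UNIV. (\<forall>i<n. 0 \<le> x i) \<and> (\<Sum>i<n. x i) \<le> 1}"

definition corner_chart :: "nat \<Rightarrow> (nat \<Rightarrow> real) \<Rightarrow> (nat \<Rightarrow>\<^sub>0 real)" where
  "corner_chart n x = (\<Sum>i<n. Poly_Mapping.single i (x i)) + Poly_Mapping.single n (1 - (\<Sum>i<n. x i))"

definition std_volume :: "nat \<Rightarrow> (nat \<Rightarrow>\<^sub>0 real) measure" where
  "std_volume n =
     distr (restrict_space (uniform_measure (Pi\<^sub>M {..<n} (\<lambda>_. lborel)) (corner n)) (corner n))
       (restrict_space borel (convex hull (std_vertices n))) (corner_chart n)"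

text \<open>
  A simplicial isomorphism from the standard simplex onto the simplex with vertex set \<open>s\<close>, for
  some numbering of \<open>s\<close>. The push-forward of \<^const>\<open>std_volume\<close> is independent of the numbering.
\<close>

definition simplex_iso :: "nat \<Rightarrow> 'a::real_normed_vector set \<Rightarrow> (nat \<Rightarrow>\<^sub>0 real) \<Rightarrow> 'a" where
  "simplex_iso n s =
     (let v = SOME v. bij_betw v {..n} s in (\<lambda>x. \<Sum>i\<le>n. Poly_Mapping.lookup x i *\<^sub>R v i))"

text \<open>The sum of the push-forwards over the possibly uncountable set of \<open>n\<close>-simplices.\<close>

definition complex_volume :: "nat \<Rightarrow> 'a::real_normed_vector set set \<Rightarrow> 'a measure" where
  "complex_volume n K =
     measure_of (realization K) (sets (borel_of (complex_topology K)))
       (\<lambda>A. \<integral>\<^sup>+ s. emeasure (distr (std_volume n) (borel_of (complex_topology K)) (simplex_iso n s)) A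
              \<partial>count_space (simplices n K))"

text \<open>
  The measure \<open>w(\<sigma>) d\<gamma>\<close>, that is \<open>1/(n+1)!\<^sup>d\<close> times the sum of \<open>w(\<sigma>)\<close> times the Dirac
  measure at the barycenter of \<open>\<sigma>\<close>, over the \<open>p\<close>-simplices of the \<open>d\<close>-th subdivision; the sum of
  Dirac measures is written as the push-forward of the counting measure on simplices. The case
  \<open>w = 1\<close> is \<open>\<gamma>\<close> itself.
\<close>

definition weighted_gamma ::
    "nat \<Rightarrow> nat \<Rightarrow> nat \<Rightarrow> 'a::real_normed_vector set set \<Rightarrow> ('a set \<Rightarrow> real) \<Rightarrow> 'a measure" where
  "weighted_gamma n d p K w =
     distr (density (scale_measure (ennreal (1 / fact (n + 1) ^ d))
                       (count_space (simplices p ((sd ^^ d) K))))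
                    (\<lambda>\<sigma>. ennreal (w \<sigma>)))
       (borel_of (complex_topology K)) barycenter"

text \<open>
  A measure with values in polynomials with non-negative coefficients is represented by its
  sequence of coefficient measures: the measure at index \<open>l\<close> is the coefficient of \<open>T\<^sup>l\<close>.
\<close>

type_synonym 'a poly_measure = "nat \<Rightarrow> 'a measure"

definition dual_block_measure ::
    "nat \<Rightarrow> nat \<Rightarrow> nat \<Rightarrow> 'a::real_normed_vector set set \<Rightarrow> 'a poly_measure" where
  "dual_block_measure n d p K =
     (\<lambda>l. weighted_gamma n d p K (\<lambda>\<sigma>. coeff (block_poly ((sd ^^ d) K) \<sigma>) l))"

definition poly_times_measure :: "real poly \<Rightarrow> 'a measure \<Rightarrow> 'a poly_measure" where
  "poly_times_measure P \<mu> = (\<lambda>l. scale_measure (ennreal (coeff P l)) \<mu>)"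

text \<open>The integrals are polynomials, and their convergence is that of all coefficients.\<close>

definition weakly_converges ::
    "'a topology \<Rightarrow> (nat \<Rightarrow> 'a poly_measure) \<Rightarrow> 'a poly_measure \<Rightarrow> bool" where
  "weakly_converges X M N \<longleftrightarrow>
     (\<forall>f. continuous_map X euclideanreal f \<and>
          compactin X (X closure_of {x \<in> topspace X. f x \<noteq> 0}) \<longrightarrow>
          (\<forall>l. (\<lambda>d. \<integral>x. f x \<partial>(M d l)) \<longlonglongrightarrow> (\<integral>x. f x \<partial>(N l))))"

end

theory Submission
  imports Defs
begin

text \<open>
  A flag is a finite nonempty chain of simplices; simplices of \<open>Sd(K)\<close> correspond to flags of \<open>K\<close>, and the
  top of the flag is the carrier of the simplex. Counting flags by their top gives a triangular linear
  recursion for the face numbers of \<open>Sd\<^sup>d\<close> carried by a fixed simplex, with diagonal entries \<open>k!\<close>; after division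
  by \<open>(n+1)!\<^sup>d\<close> it is a contraction in every dimension below \<open>n\<close>. Hence the limits \<open>q\<^sub>p\<^sub>,\<^sub>n\<close> exist, and the
  lower-dimensional simplices are negligible.

  Normalised Lebesgue measure on a simplex is the average of its copies on the \<open>(n+1)!\<close> pieces of the
  subdivision: sorting the barycentric coordinates identifies a piece with the whole simplex through a
  triangular linear map. Since the mesh tends to \<open>0\<close> and a compactly supported function lives on finitely many
  simplices, the equidistribution of the flags among the pieces at a fixed level \<open>m\<close>, with \<open>d - m\<close> tending to
  infinity, gives the convergence on each simplex.
\<close>

subsection \<open>Flags and barycentric coordinates\<close>

text \<open>Dual blocks index flags by their bottom, whereas carriers and face counts index them by
  their top. The coefficient of T^l integrates f over all flags with l+1 members, evaluated at the
  barycenter of a p-dimensional bottom; these flags are regrouped by tops. A top of dimension p+h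
  carries f_p(Delta_{p+h}) lambda_{h,l} of them: choose the bottom face, then remove its vertices
  from the other members, which leaves a chain of l nonempty subsets of the h remaining vertices
  ending in all of them. This is the origin of the product in the limit, and q_{p+h,n} is the
  density of the tops. The contraction ratio for simplices with j vertices is j!/(n+1)!, smaller
  than 1 exactly below the top dimension. Instead of the hull condition of
  \<open>geometric_complex\<close>, uniqueness of positive barycentric coordinates is carried along,
  because it passes to \<open>sd K\<close> by linear algebra on chains. The realization may be
  uncountable in cells and finer than the ambient topology, so measure theory takes place on one
  simplex at a time, pulled back to functions \<open>nat => real\<close>, on which permutations of
  the vertices act.\<close>

lemma chain_subset_subset: "chain_subset D \<Longrightarrow> C \<subseteq> D \<Longrightarrow> chain_subset C"
  unfolding chain_subset_def by blast

lemma sorted_psubset_chain: "sorted_wrt (\<subset>) xs \<Longrightarrow> chain_subset (set xs)"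
  by (induction xs) (auto simp: chain_subset_def)

lemma sorted_psubset_hd: "sorted_wrt (\<subset>) xs \<Longrightarrow> xs \<noteq> [] \<Longrightarrow> hd xs = \<Inter>(set xs)"
  by (cases xs) auto

lemma chain_Union_mem: "finite C \<Longrightarrow> C \<noteq> {} \<Longrightarrow> chain_subset C \<Longrightarrow> \<Union>C \<in> C"
  by (rule Union_in_chain) (auto simp: chain_subset_def subset.chain_def)

lemma chain_Inter_mem: "finite C \<Longrightarrow> C \<noteq> {} \<Longrightarrow> chain_subset C \<Longrightarrow> \<Inter>C \<in> C"
  by (rule Inter_in_chain) (auto simp: chain_subset_def subset.chain_def)

text \<open>Induction on the size: the union of a nonempty finite chain is its largest member, which
  is split off and appended at the end.\<close>

lemma sorted_psubset_list_exists:
  assumes "finite C" "chain_subset C"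
  obtains xs where "set xs = C" "sorted_wrt (\<subset>) xs"
proof -
  have "\<exists>xs. set xs = C \<and> sorted_wrt (\<subset>) xs" using assms
  proof (induction "card C" arbitrary: C rule: less_induct)
    case less
    show ?case
    proof (cases "C = {}")
      case False
      have U: "\<Union>C \<in> C" using chain_Union_mem less.prems False by blast
      have "card (C - {\<Union>C}) < card C" using U less.prems by (meson card_Diff1_less)
      then obtain xs where "set xs = C - {\<Union>C}" "sorted_wrt (\<subset>) xs"
        using less.hyps[of "C - {\<Union>C}"] less.prems chain_subset_subset[of C] by blast
      then have "set (xs @ [\<Union>C]) = C \<and> sorted_wrt (\<subset>) (xs @ [\<Union>C])"
        using U by (auto simp: sorted_wrt_append)
      then show ?thesis by blast
    qed auto
  qed
  then show ?thesis using that by blast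
qed

definition flags :: "'a set set \<Rightarrow> 'a set set set" where
  "flags K = {C. finite C \<and> C \<noteq> {} \<and> C \<subseteq> K \<and> chain_subset C}"

text \<open>Every finite chain can be listed in increasing order, so the lists in \<open>sd\<close>
  and \<open>dual_block\<close> can be replaced by sets, which are easier to count.\<close>

lemma flags_eq_lists: "flags K = {set xs | xs. xs \<noteq> [] \<and> set xs \<subseteq> K \<and> sorted_wrt (\<subset>) xs}"
proof (rule set_eqI)
  fix C
  show "C \<in> flags K \<longleftrightarrow> C \<in> {set xs | xs. xs \<noteq> [] \<and> set xs \<subseteq> K \<and> sorted_wrt (\<subset>) xs}"
  proof
    assume C: "C \<in> flags K"
    then obtain xs where "set xs = C" "sorted_wrt (\<subset>) xs"
      using sorted_psubset_list_exists unfolding flags_def by blast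
    then show "C \<in> {set xs | xs. xs \<noteq> [] \<and> set xs \<subseteq> K \<and> sorted_wrt (\<subset>) xs}"
      using C by (force simp: flags_def)
  qed (auto simp: flags_def sorted_psubset_chain)
qed

lemma sd_eq_flags: "sd K = (`) barycenter ` flags K"
  unfolding sd_def flags_eq_lists by blast

lemma dual_block_eq_flags: "dual_block K \<sigma> = (`) barycenter ` {C \<in> flags K. \<Inter>C = \<sigma>}"
proof -
  have "{C \<in> flags K. \<Inter>C = \<sigma>} = {set xs | xs. (xs \<noteq> [] \<and> set xs \<subseteq> K \<and> sorted_wrt (\<subset>) xs) \<and> hd xs = \<sigma>}"
    unfolding flags_eq_lists using sorted_psubset_hd by blast
  then show ?thesis unfolding dual_block_def by auto
qed

lemma flags_Union_mem: "C \<in> flags K \<Longrightarrow> \<Union>C \<in> C"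
  and flags_Inter_mem: "C \<in> flags K \<Longrightarrow> \<Inter>C \<in> C"
  by (auto simp: flags_def intro: chain_Union_mem chain_Inter_mem)

text \<open>The last clause says that every point of the realization has unique barycentric coordinates,
  which subsumes affine independence and the intersection property.\<close>

definition bary_complex :: "'a::real_normed_vector set set \<Rightarrow> bool" where
  "bary_complex K \<longleftrightarrow>
     (\<forall>s\<in>K. finite s \<and> s \<noteq> {}) \<and>
     (\<forall>s\<in>K. \<forall>t. t \<subseteq> s \<and> t \<noteq> {} \<longrightarrow> t \<in> K) \<and>
     (\<forall>s\<in>K. \<forall>t\<in>K. \<forall>a b. (\<forall>v\<in>s. 0 < a v) \<and> (\<forall>v\<in>t. 0 < b v) \<and> sum a s = 1 \<and> sum b t = 1 \<and>
        (\<Sum>v\<in>s. a v *\<^sub>R v) = (\<Sum>v\<in>t. b v *\<^sub>R v) \<longrightarrow> s = t \<and> (\<forall>v\<in>s. a v = b v))"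

lemma bary_complexI:
  assumes "\<And>s. s \<in> K \<Longrightarrow> finite s \<and> s \<noteq> {}" "\<And>s t. s \<in> K \<Longrightarrow> t \<subseteq> s \<Longrightarrow> t \<noteq> {} \<Longrightarrow> t \<in> K"
    "\<And>s t a b. s \<in> K \<Longrightarrow> t \<in> K \<Longrightarrow> \<forall>v\<in>s. 0 < a v \<Longrightarrow> \<forall>v\<in>t. 0 < b v \<Longrightarrow> sum a s = 1 \<Longrightarrow>
      sum b t = 1 \<Longrightarrow> (\<Sum>v\<in>s. a v *\<^sub>R v) = (\<Sum>v\<in>t. b v *\<^sub>R v) \<Longrightarrow> s = t \<and> (\<forall>v\<in>s. a v = b v)"
  shows "bary_complex K"
  unfolding bary_complex_def
proof (rule conjI, use assms(1) in blast, rule conjI, use assms(2) in blast, intro ballI allI impI)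
  fix s t a b
  assume "s \<in> K" "t \<in> K"
    and "(\<forall>v\<in>s. 0 < a v) \<and> (\<forall>v\<in>t. 0 < b v) \<and> sum a s = 1 \<and> sum b t = 1 \<and>
      (\<Sum>v\<in>s. a v *\<^sub>R v) = (\<Sum>v\<in>t. b v *\<^sub>R v)"
  then show "s = t \<and> (\<forall>v\<in>s. a v = b v)" by (elim conjE) (rule assms(3))
qed

lemma bary_complexD:
  assumes "bary_complex K"
  shows "s \<in> K \<Longrightarrow> finite s" "s \<in> K \<Longrightarrow> s \<noteq> {}" "s \<in> K \<Longrightarrow> t \<subseteq> s \<Longrightarrow> t \<noteq> {} \<Longrightarrow> t \<in> K"
proof -
  have *: "\<forall>s\<in>K. finite s \<and> s \<noteq> {}" "\<forall>s\<in>K. \<forall>t. t \<subseteq> s \<and> t \<noteq> {} \<longrightarrow> t \<in> K"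
    using assms[unfolded bary_complex_def] by - (elim conjE, assumption)+
  show "s \<in> K \<Longrightarrow> finite s" "s \<in> K \<Longrightarrow> s \<noteq> {}" "s \<in> K \<Longrightarrow> t \<subseteq> s \<Longrightarrow> t \<noteq> {} \<Longrightarrow> t \<in> K"
    using * by blast+
qed

lemma bary_complex_unique:
  assumes "bary_complex K" "s \<in> K" "t \<in> K" "\<And>v. v \<in> s \<Longrightarrow> 0 < a v" "\<And>v. v \<in> t \<Longrightarrow> 0 < b v"
    "sum a s = 1" "sum b t = 1" "(\<Sum>v\<in>s. a v *\<^sub>R v) = (\<Sum>v\<in>t. b v *\<^sub>R v)"
  shows "s = t" "v \<in> s \<Longrightarrow> a v = b v"
proof -
  have "s = t \<and> (\<forall>v\<in>s. a v = b v)"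
    by (rule assms(1)[unfolded bary_complex_def, THEN conjunct2, THEN conjunct2, rule_format,
          OF assms(2,3)]) (use assms(4-) in simp)
  then show "s = t" "v \<in> s \<Longrightarrow> a v = b v" by auto
qed

lemma affine_independent_unique:
  fixes s :: "'a::real_vector set"
  assumes "finite s" "\<not> affine_dependent s" "sum a s = sum b s"
    "(\<Sum>v\<in>s. a v *\<^sub>R v) = (\<Sum>v\<in>s. b v *\<^sub>R v)" "v \<in> s"
  shows "a v = b v"
proof -
  have "sum (\<lambda>v. a v - b v) s = 0" "(\<Sum>v\<in>s. (a v - b v) *\<^sub>R v) = 0"
    using assms by (auto simp: sum_subtractf scaleR_left_diff_distrib)
  then show ?thesis using assms affine_dependent_explicit_finite[OF assms(1)] by force
qed

text \<open>A common point lies in the hull of \<open>s \<inter> t\<close>. Its coordinates there,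
  extended by zero, must agree with those in \<open>s\<close> and with those in \<open>t\<close> by
  affine independence; positivity then gives one inclusion, and exchanging the roles gives the
  other.\<close>

lemma geometric_bary_complex:
  assumes "geometric_complex K" shows "bary_complex K"
proof -
  have *: "s \<subseteq> t \<and> (\<forall>v\<in>s. a v = b v)"
    if st: "s \<in> K" "t \<in> K" and pos: "\<forall>v\<in>s. 0 < a v" "\<forall>v\<in>t. 0 < b v" and one: "sum a s = 1" "sum b t = 1"
      and eq: "(\<Sum>v\<in>s. a v *\<^sub>R v) = (\<Sum>v\<in>t. b v *\<^sub>R v)" for s t a b
  proof -
    have fin: "finite s" "finite t" and ind: "\<not> affine_dependent s" "\<not> affine_dependent t"
      using assms st unfolding geometric_complex_def by blast+
    have "(\<Sum>v\<in>s. a v *\<^sub>R v) \<in> convex hull s"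
      using pos one by (intro convex_sum) (auto simp: fin less_imp_le hull_inc)
    moreover have "(\<Sum>v\<in>s. a v *\<^sub>R v) \<in> convex hull t"
      unfolding eq using pos one by (intro convex_sum) (auto simp: fin less_imp_le hull_inc)
    ultimately have "(\<Sum>v\<in>s. a v *\<^sub>R v) \<in> convex hull s \<inter> convex hull t" by blast
    then have "(\<Sum>v\<in>s. a v *\<^sub>R v) \<in> convex hull (s \<inter> t)"
      using assms st unfolding geometric_complex_def by blast
    then obtain c where c: "\<forall>v\<in>s \<inter> t. 0 \<le> c v" "sum c (s \<inter> t) = 1"
      "(\<Sum>v\<in>s \<inter> t. c v *\<^sub>R v) = (\<Sum>v\<in>s. a v *\<^sub>R v)"
      using fin by (auto simp: convex_hull_finite)
    define d where "d v = (if v \<in> s \<inter> t then c v else 0)" for v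
    have d: "sum d r = 1 \<and> (\<Sum>v\<in>r. d v *\<^sub>R v) = (\<Sum>v\<in>s. a v *\<^sub>R v)" if "finite r" "s \<inter> t \<subseteq> r" for r
    proof -
      have "sum d r = sum c (s \<inter> t)"
        using that by (intro sum.mono_neutral_cong_right) (auto simp: d_def)
      moreover have "(\<Sum>v\<in>r. d v *\<^sub>R v) = (\<Sum>v\<in>s \<inter> t. c v *\<^sub>R v)"
        using that by (intro sum.mono_neutral_cong_right) (auto simp: d_def)
      ultimately show ?thesis using c by simp
    qed
    have ad: "a v = d v" if "v \<in> s" for v
      using affine_independent_unique[OF fin(1) ind(1), of a d] d[of s] one that fin by simp
    have bd: "b v = d v" if "v \<in> t" for v
      using affine_independent_unique[OF fin(2) ind(2), of b d] d[of t] one that fin eq by simp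
    have "s \<subseteq> t"
    proof
      fix v assume "v \<in> s"
      then show "v \<in> t" using ad[of v] pos by (auto simp: d_def split: if_splits)
    qed
    then show ?thesis using ad bd by auto
  qed
  have "s = t \<and> (\<forall>v\<in>s. a v = b v)"
    if "s \<in> K" "t \<in> K" "\<forall>v\<in>s. 0 < a v" "\<forall>v\<in>t. 0 < b v" "sum a s = 1" "sum b t = 1"
      "(\<Sum>v\<in>s. a v *\<^sub>R v) = (\<Sum>v\<in>t. b v *\<^sub>R v)" for s t a b
    using *[OF that] *[OF that(2,1,4,3,6,5) that(7)[symmetric]] by blast
  moreover have "finite s \<and> s \<noteq> {}" "t \<subseteq> s \<Longrightarrow> t \<noteq> {} \<Longrightarrow> t \<in> K" if "s \<in> K" for s t
    using assms that unfolding geometric_complex_def by blast+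
  ultimately show ?thesis by (intro bary_complexI)
qed

section \<open>Barycentric coordinates in the subdivision\<close>

lemma barycenter_eq_sum: "barycenter s = (\<Sum>v\<in>s. (1 / real (card s)) *\<^sub>R v)"
  by (simp add: barycenter_def scaleR_sum_right)

lemma barycenter_in_hull: "finite s \<Longrightarrow> s \<noteq> {} \<Longrightarrow> barycenter s \<in> convex hull s"
  unfolding barycenter_eq_sum by (intro convex_sum) (auto simp: hull_inc)

lemma barycenter_inj_on:
  assumes "bary_complex K" shows "inj_on barycenter K"
proof (rule inj_onI)
  fix s t assume st: "s \<in> K" "t \<in> K" "barycenter s = barycenter t"
  have "finite s" "finite t" "s \<noteq> {}" "t \<noteq> {}" using st bary_complexD(1,2)[OF assms] by auto
  then show "s = t"
    by (intro bary_complex_unique(1)[OF assms st(1,2), of "\<lambda>_. 1 / card s" "\<lambda>_. 1 / card t"])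
      (use st(3) in \<open>auto simp: barycenter_eq_sum card_gt_0_iff\<close>)
qed

lemma flags_image_inj_on:
  assumes "bary_complex K" shows "inj_on ((`) barycenter) (flags K)"
  using inj_on_image_eq_iff[OF barycenter_inj_on[OF assms]] by (auto simp: inj_on_def flags_def)

text \<open>For \<open>v\<close> outside \<open>s\<close>, the members containing \<open>v\<close>
  are all strictly larger than \<open>s\<close>, so their total weight misses at least the positive
  term \<open>c s\<close>. Thus the weights alone determine each member as a level set.\<close>

lemma chain_member_superlevel:
  fixes c :: "'a set \<Rightarrow> real"
  assumes C: "finite C" "chain_subset C" "\<And>s. s \<in> C \<Longrightarrow> 0 < c s" and s: "s \<in> C"
  shows "s = {v. sum c {t \<in> C. s \<subseteq> t} \<le> sum c {t \<in> C. v \<in> t}}"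
proof (intro set_eqI iffI)
  fix v assume "v \<in> s"
  then show "v \<in> {v. sum c {t \<in> C. s \<subseteq> t} \<le> sum c {t \<in> C. v \<in> t}}"
    using C by (auto intro!: sum_mono2 simp: less_imp_le)
next
  fix v assume v: "v \<in> {v. sum c {t \<in> C. s \<subseteq> t} \<le> sum c {t \<in> C. v \<in> t}}"
  show "v \<in> s"
  proof (rule ccontr)
    assume "v \<notin> s"
    then have "sum c {t \<in> C. v \<in> t} \<le> sum c ({t \<in> C. s \<subseteq> t} - {s})"
      using C s by (intro sum_mono2) (auto simp: less_imp_le chain_subset_def)
    also have "\<dots> < sum c {t \<in> C. s \<subseteq> t}"
      using C s by (subst sum.remove[of "{t \<in> C. s \<subseteq> t}" s c]) auto
    finally show False using v by simp
  qed
qed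

lemma superlevel_chain: 
  fixes f :: "'a \<Rightarrow> real"
  assumes "\<And>s. s \<in> C \<Longrightarrow> \<exists>m. s = {v. m \<le> f v}" shows "chain_subset C"
  unfolding chain_subset_def
proof (intro ballI)
  fix s t assume "s \<in> C" "t \<in> C"
  then obtain m m' where "s = {v. m \<le> f v}" "t = {v. m' \<le> f v}" using assms by blast
  then show "s \<subseteq> t \<or> t \<subseteq> s" by (cases "m \<le> m'") auto
qed

text \<open>The largest member with nonzero coefficient contains a vertex missing from all smaller
  members; at this vertex only its own term survives.\<close>

lemma chain_indicators_independent:
  fixes d :: "'a set \<Rightarrow> real"
  assumes C: "finite C" "chain_subset C" "{} \<notin> C" "\<And>s. s \<in> C \<Longrightarrow> finite s"
    and zero: "\<And>v. sum d {t \<in> C. v \<in> t} = 0" and s: "s \<in> C"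
  shows "d s = 0"
proof (rule ccontr)
  assume ds: "d s \<noteq> 0"
  let ?B = "{t \<in> C. d t \<noteq> 0}"
  have B: "finite ?B" "?B \<noteq> {}" "chain_subset ?B"
    using C s ds by (auto intro: chain_subset_subset)
  let ?m = "\<Union>?B"
  have m: "?m \<in> ?B" using chain_Union_mem[OF B] .
  \<comment> \<open>The members strictly below \<open>?m\<close> have a largest one, if any, so
    their union does not exhaust \<open>?m\<close> and the vertex \<open>v\<close> exists.\<close>
  let ?L = "{t \<in> C. t \<subset> ?m}"
  obtain v where v: "v \<in> ?m" "v \<notin> \<Union>?L"
  proof (cases "?L = {}")
    case True
    have "?m \<noteq> {}" using m C(3) by (metis (no_types, lifting) mem_Collect_eq)
    then show ?thesis using True that by blast
  next
    case False
    have "\<Union>?L \<in> ?L" using False C by (intro chain_Union_mem) (auto intro: chain_subset_subset)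
    then show ?thesis using that by blast
  qed
  have "sum d {t \<in> C. v \<in> t} = sum d {?m}"
  proof (rule sum.mono_neutral_right)
    show "finite {t \<in> C. v \<in> t}" using C by simp
    show "{?m} \<subseteq> {t \<in> C. v \<in> t}" using m v(1) by blast
    show "\<forall>t\<in>{t \<in> C. v \<in> t} - {?m}. d t = 0"
    proof (intro ballI, rule ccontr)
      fix t assume t: "t \<in> {t \<in> C. v \<in> t} - {?m}" and "d t \<noteq> 0"
      then have "t \<subseteq> ?m" by blast
      then show False using t v by blast
    qed
  qed
  then show False using m zero[of v] by simp
qed

text \<open>A barycenter spreads its weight evenly over the vertices of its simplex, so each vertex
  collects a share \<open>c t\<close> from every member \<open>t\<close> containing it; the rest is
  an exchange of sums.\<close>

lemma flag_point_coords:
  fixes b :: "'a::real_normed_vector \<Rightarrow> real"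
  assumes K: "bary_complex K" and C: "C \<in> flags K"
  defines "c \<equiv> \<lambda>s. b (barycenter s) / real (card s)"
  shows "(\<Sum>x\<in>barycenter ` C. b x *\<^sub>R x) = (\<Sum>v\<in>\<Union>C. sum c {t \<in> C. v \<in> t} *\<^sub>R v)"
    and "sum b (barycenter ` C) = (\<Sum>v\<in>\<Union>C. sum c {t \<in> C. v \<in> t})"
proof -
  have fC: "finite C" "C \<subseteq> K" using C by (auto simp: flags_def)
  have fs: "finite s" "s \<noteq> {}" if "s \<in> C" for s using that fC bary_complexD(1,2)[OF K] by auto
  have fU: "finite (\<Union>C)" using fC fs by blast
  have inj: "inj_on barycenter C" using barycenter_inj_on[OF K] fC inj_on_subset by blast
  have "(\<Sum>x\<in>barycenter ` C. b x *\<^sub>R x) = (\<Sum>s\<in>C. \<Sum>v\<in>s. c s *\<^sub>R v)"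
    by (simp add: sum.reindex[OF inj] c_def scaleR_sum_right[symmetric])
      (simp add: barycenter_def)
  also have "\<dots> = (\<Sum>s\<in>C. \<Sum>v | v \<in> \<Union>C \<and> v \<in> s. c s *\<^sub>R v)"
    by (intro sum.cong) auto
  also have "\<dots> = (\<Sum>v\<in>\<Union>C. \<Sum>s | s \<in> C \<and> v \<in> s. c s *\<^sub>R v)"
    using fC fU by (intro sum.swap_restrict) auto
  finally show "(\<Sum>x\<in>barycenter ` C. b x *\<^sub>R x) = (\<Sum>v\<in>\<Union>C. sum c {t \<in> C. v \<in> t} *\<^sub>R v)"
    by (simp add: scaleR_sum_left)
  have "sum b (barycenter ` C) = (\<Sum>s\<in>C. \<Sum>v\<in>s. c s)"
    using fs by (auto simp: sum.reindex[OF inj] c_def card_gt_0_iff intro!: sum.cong)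
  also have "\<dots> = (\<Sum>s\<in>C. \<Sum>v | v \<in> \<Union>C \<and> v \<in> s. c s)"
    by (intro sum.cong) auto
  also have "\<dots> = (\<Sum>v\<in>\<Union>C. \<Sum>s | s \<in> C \<and> v \<in> s. c s)"
    using fC fU by (intro sum.swap_restrict) auto
  finally show "sum b (barycenter ` C) = (\<Sum>v\<in>\<Union>C. sum c {t \<in> C. v \<in> t})" .
qed

text \<open>The coordinates of a point in \<open>sd K\<close> determine those in \<open>K\<close>, and the superlevel sets of the latter
  recover the flag.\<close>

lemma sd_bary_complex:
  assumes K: "bary_complex K" shows "bary_complex (sd K)"
proof -
  have faces: "t \<in> sd K" if s: "s \<in> sd K" and t: "t \<subseteq> s" "t \<noteq> {}" for s t
  proof -
    obtain C where C: "C \<in> flags K" "s = barycenter ` C" using s by (auto simp: sd_eq_flags)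
    then obtain D where "D \<subseteq> C" "t = barycenter ` D" using t by (meson subset_imageE)
    moreover from this have "D \<in> flags K"
      using C t chain_subset_subset[of C D] by (auto simp: flags_def intro: finite_subset)
    ultimately show ?thesis by (auto simp: sd_eq_flags)
  qed
  have unique: "s = t \<and> (\<forall>x\<in>s. a x = b x)"
    if st: "s \<in> sd K" "t \<in> sd K" and pos: "\<forall>v\<in>s. 0 < a v" "\<forall>v\<in>t. 0 < b v"
      and one: "sum a s = 1" "sum b t = 1" and eq: "(\<Sum>v\<in>s. a v *\<^sub>R v) = (\<Sum>v\<in>t. b v *\<^sub>R v)" for s t a b
  proof -
    obtain C D where C: "C \<in> flags K" "s = barycenter ` C" and D: "D \<in> flags K" "t = barycenter ` D"
      using st by (auto simp: sd_eq_flags)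
    have fin: "finite C" "finite D" "C \<subseteq> K" "D \<subseteq> K" "chain_subset C" "chain_subset D"
      using C D by (auto simp: flags_def)
    have fs: "finite s" "s \<noteq> {}" if "s \<in> K" for s using that bary_complexD(1,2)[OF K] by auto
    define c where "c s = a (barycenter s) / real (card s)" for s
    define d where "d s = b (barycenter s) / real (card s)" for s
    have cpos: "0 < c r" if "r \<in> C" for r using that pos C fin fs[of r] by (auto simp: c_def card_gt_0_iff)
    have dpos: "0 < d r" if "r \<in> D" for r using that pos D fin fs[of r] by (auto simp: d_def card_gt_0_iff)
    define \<alpha> where "\<alpha> v = sum c {t \<in> C. v \<in> t}" for v
    define \<beta> where "\<beta> v = sum d {t \<in> D. v \<in> t}" for v
    have UC: "\<Union>C \<in> K" "\<Union>D \<in> K" using C D fin flags_Union_mem by blast+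
    have \<alpha>pos: "0 < \<alpha> v" if "v \<in> \<Union>C" for v
      unfolding \<alpha>_def using that fin cpos by (intro sum_pos) auto
    have \<beta>pos: "0 < \<beta> v" if "v \<in> \<Union>D" for v
      unfolding \<beta>_def using that fin dpos by (intro sum_pos) auto
    have pc: "(\<Sum>v\<in>s. a v *\<^sub>R v) = (\<Sum>v\<in>\<Union>C. \<alpha> v *\<^sub>R v)" "sum a s = sum \<alpha> (\<Union>C)"
      using flag_point_coords[OF K C(1), of a] by (simp_all add: C(2) \<alpha>_def c_def[abs_def])
    have pd: "(\<Sum>v\<in>t. b v *\<^sub>R v) = (\<Sum>v\<in>\<Union>D. \<beta> v *\<^sub>R v)" "sum b t = sum \<beta> (\<Union>D)"
      using flag_point_coords[OF K D(1), of b] by (simp_all add: D(2) \<beta>_def d_def[abs_def])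
    note u = bary_complex_unique[OF K UC, of \<alpha> \<beta>]
    have U: "\<Union>C = \<Union>D" using u(1) \<alpha>pos \<beta>pos pc pd one eq by auto
    have \<alpha>\<beta>: "\<alpha> v = \<beta> v" for v
    proof (cases "v \<in> \<Union>C")
      case True then show ?thesis using u(2)[of v] \<alpha>pos \<beta>pos pc pd one eq by auto
    next
      case False
      then have "{t \<in> C. v \<in> t} = {}" "{t \<in> D. v \<in> t} = {}" using U by blast+
      then show ?thesis by (simp only: \<alpha>_def \<beta>_def sum.empty)
    qed
    \<comment> \<open>Both flags consist of superlevel sets of the common function
      \<open>\<alpha>\<close> = \<open>\<beta>\<close>, so their union is still a chain, and
      independence of indicators applies to the difference \<open>e\<close> of the two weights. A
      member of only one flag would then have weight zero.\<close>
    let ?E = "C \<union> D"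
    have chE: "chain_subset ?E"
    proof (rule superlevel_chain)
      fix r assume "r \<in> ?E"
      then show "\<exists>m. r = {v. m \<le> \<alpha> v}"
      proof
        assume "r \<in> C"
        show ?thesis unfolding \<alpha>_def
          by (rule exI, rule chain_member_superlevel[OF fin(1,5) cpos \<open>r \<in> C\<close>])
      next
        assume "r \<in> D"
        show ?thesis unfolding \<alpha>\<beta> \<beta>_def
          by (rule exI, rule chain_member_superlevel[OF fin(2,6) dpos \<open>r \<in> D\<close>])
      qed
    qed
    define e where "e r = (if r \<in> C then c r else 0) - (if r \<in> D then d r else 0)" for r
    have ez: "e r = 0" if "r \<in> ?E" for r
    proof (rule chain_indicators_independent[OF _ chE _ _ _ that])
      show "finite ?E" "{} \<notin> ?E" "\<And>s. s \<in> ?E \<Longrightarrow> finite s" using fin fs by auto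
      fix v
      have "sum e {t \<in> ?E. v \<in> t} = sum (\<lambda>r. if r \<in> C then c r else 0) {t \<in> ?E. v \<in> t}
         - sum (\<lambda>r. if r \<in> D then d r else 0) {t \<in> ?E. v \<in> t}"
        by (simp add: e_def sum_subtractf)
      also have "sum (\<lambda>r. if r \<in> C then c r else 0) {t \<in> ?E. v \<in> t} = \<alpha> v"
        unfolding \<alpha>_def using fin by (intro sum.mono_neutral_cong_right) auto
      also have "sum (\<lambda>r. if r \<in> D then d r else 0) {t \<in> ?E. v \<in> t} = \<beta> v"
        unfolding \<beta>_def using fin by (intro sum.mono_neutral_cong_right) auto
      finally show "sum e {t \<in> ?E. v \<in> t} = 0" using \<alpha>\<beta> by simp
    qed
    have CD: "C = D" 
    proof (intro equalityI subsetI)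
      fix r assume "r \<in> C" then show "r \<in> D" using ez[of r] cpos[of r] by (auto simp: e_def split: if_splits)
    next
      fix r assume "r \<in> D" then show "r \<in> C" using ez[of r] dpos[of r] by (auto simp: e_def split: if_splits)
    qed
    moreover have "a x = b x" if x: "x \<in> s" for x
    proof -
      obtain r where r: "r \<in> C" "x = barycenter r" using x C(2) by blast
      then show ?thesis using ez[of r] CD fs[of r] fin by (auto simp: e_def c_def d_def)
    qed
    ultimately show ?thesis using C D by auto
  qed
  have "finite s \<and> s \<noteq> {}" if "s \<in> sd K" for s using that by (auto simp: sd_eq_flags flags_def)
  with faces unique show ?thesis by (intro bary_complexI)
qed

subsection \<open>Carriers and iterated subdivisions\<close>

lemma funpow_sd_bary_complex: "bary_complex K \<Longrightarrow> bary_complex ((sd ^^ d) K)"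
  by (induction d) (auto intro: sd_bary_complex)

text \<open>Built from the faces of \<open>s\<close> alone, without an ambient complex, so that
  these flags can be transported along any bijection of vertex sets. They model the simplices of the
  subdivision of \<open>s\<close> that lie in no proper face.\<close>

definition full_flags :: "'a set \<Rightarrow> 'a set set set" where
  "full_flags s = {C \<in> flags (Pow s - {{}}). \<Union>C = s}"

lemma full_flagsD:
  assumes "C \<in> full_flags s"
  shows "finite C" "C \<noteq> {}" "C \<subseteq> Pow s" "{} \<notin> C" "chain_subset C" "\<Union>C = s" "s \<in> C"
proof -
  have C: "C \<in> flags (Pow s - {{}})" and U: "\<Union>C = s" using assms by (simp_all add: full_flags_def)
  show "\<Union>C = s" by (rule U)
  show "s \<in> C" using flags_Union_mem[OF C] U by simp
  show "finite C" "C \<noteq> {}" "C \<subseteq> Pow s" "{} \<notin> C" "chain_subset C" using C by (auto simp: flags_def)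
qed

lemma full_flagsI:
  "finite C \<Longrightarrow> C \<noteq> {} \<Longrightarrow> C \<subseteq> Pow s \<Longrightarrow> {} \<notin> C \<Longrightarrow> chain_subset C \<Longrightarrow> s \<in> C \<Longrightarrow> C \<in> full_flags s"
  by (auto simp: full_flags_def flags_def)

lemma finite_full_flags: "finite s \<Longrightarrow> finite (full_flags s)"
  by (rule finite_subset[of _ "Pow (Pow s)"]) (auto dest: full_flagsD)

text \<open>Along a chain of finite sets the cardinality is injective, and here it takes values in
  \<open>{1..card s}\<close>.\<close>

lemma full_flags_card_le:
  assumes "finite s" "C \<in> full_flags s" shows "card C \<le> card s"
proof -
  have "inj_on card C"
  proof (rule inj_onI)
    fix a b assume ab: "a \<in> C" "b \<in> C" "card a = card b"
    have "finite a" "finite b" using ab full_flagsD(3)[OF assms(2)] assms(1) by (auto intro: finite_subset)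
    then show "a = b" using ab full_flagsD(5)[OF assms(2)]
      unfolding chain_subset_def by (metis card_subset_eq)
  qed
  moreover have "card ` C \<subseteq> {1..card s}"
  proof
    fix k assume "k \<in> card ` C"
    then obtain a where a: "a \<in> C" "k = card a" by auto
    then have "a \<subseteq> s" "a \<noteq> {}" using full_flagsD(3,4)[OF assms(2)] by auto
    then show "k \<in> {1..card s}" using a assms(1) by (auto simp: card_mono Suc_le_eq card_gt_0_iff finite_subset)
  qed
  ultimately show ?thesis using card_inj_on_le[of card C "{1..card s}"] by simp
qed

lemma flags_Union_eq:
  assumes "bary_complex K" "s \<in> K"
  shows "{C \<in> flags K. \<Union>C = s} = full_flags s"
proof -
  note K = bary_complexD[OF assms(1)]
  have "Pow s - {{}} \<subseteq> K" using K(3)[OF assms(2)] by blast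
  moreover have "{} \<notin> K" using K(2) by blast
  ultimately show ?thesis unfolding full_flags_def flags_def by blast
qed

lemma full_flags_image:
  assumes "C \<in> full_flags s" shows "(`) f ` C \<in> full_flags (f ` s)"
proof (rule full_flagsI)
  note c = full_flagsD[OF assms]
  show "(`) f ` C \<subseteq> Pow (f ` s)" using c(3) by auto
  show "{} \<notin> (`) f ` C" using c(4) by auto
  show "f ` s \<in> (`) f ` C" using c(7) by auto
  show "chain_subset ((`) f ` C)" unfolding chain_subset_def
  proof (intro ballI)
    fix a b assume "a \<in> (`) f ` C" "b \<in> (`) f ` C"
    then obtain a' b' where "a' \<in> C" "b' \<in> C" "a = f ` a'" "b = f ` b'" by blast
    then show "a \<subseteq> b \<or> b \<subseteq> a" using c(5) unfolding chain_subset_def by (metis image_mono)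
  qed
qed (use full_flagsD[OF assms] in auto)

lemma full_flags_bij_betw:
  assumes f: "bij_betw f s t"
  shows "bij_betw ((`) ((`) f)) (full_flags s) (full_flags t)"
proof (rule bij_betw_byWitness[where f' = "(`) ((`) (inv_into s f))"])
  have inj: "inj_on f s" and im: "f ` s = t" using f by (auto simp: bij_betw_def)
  have im': "inv_into s f ` t = s" using inj im by force
  have "(\<lambda>x. inv_into s f ` f ` x) ` C = (\<lambda>x. x) ` C" if C: "C \<in> full_flags s" for C
  proof (rule image_cong[OF refl])
    fix x assume "x \<in> C"
    then show "inv_into s f ` f ` x = x" using full_flagsD(3)[OF C] by (intro inv_into_image_cancel[OF inj]) auto
  qed
  then show "\<forall>C\<in>full_flags s. (`) (inv_into s f) ` (`) f ` C = C" by (simp add: image_image)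
  have "(\<lambda>x. f ` inv_into s f ` x) ` C = (\<lambda>x. x) ` C" if C: "C \<in> full_flags t" for C
  proof (rule image_cong[OF refl])
    fix x assume "x \<in> C"
    then show "f ` inv_into s f ` x = x" using full_flagsD(3)[OF C] by (intro image_inv_into_cancel[OF im]) auto
  qed
  then show "\<forall>C\<in>full_flags t. (`) f ` (`) (inv_into s f) ` C = C" by (simp add: image_image)
  show "(`) ((`) f) ` full_flags s \<subseteq> full_flags t" using full_flags_image[of _ s f] im by auto
  show "(`) ((`) (inv_into s f)) ` full_flags t \<subseteq> full_flags s"
    using full_flags_image[of _ t "inv_into s f"] im' by auto
qed

text \<open>The matrix of face counts under one subdivision. It agrees with
  \<open>interior_number\<close> for positive arguments; at \<open>0 0\<close> it is 0 and not the
  conventional 1.\<close>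

definition flag_number :: "nat \<Rightarrow> nat \<Rightarrow> nat" where
  "flag_number k j = card {C \<in> full_flags {..<k}. card C = j}"

lemma full_flags_card_bij_betw:
  assumes f: "bij_betw f s t"
  shows "bij_betw ((`) ((`) f)) {C \<in> full_flags s. card C = j} {C \<in> full_flags t. card C = j}"
proof (rule bij_betw_subset[OF full_flags_bij_betw[OF f]])
  have inj: "inj_on f s" using f by (simp add: bij_betw_def)
  have im: "(`) ((`) f) ` full_flags s = full_flags t" using full_flags_bij_betw[OF f] by (simp add: bij_betw_def)
  have c: "card ((`) f ` C) = card C" if "C \<in> full_flags s" for C
    using inj_on_subset[OF inj_on_image_Pow[OF inj] full_flagsD(3)[OF that]] by (rule card_image)
  show "(`) ((`) f) ` {C \<in> full_flags s. card C = j} = {C \<in> full_flags t. card C = j}"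
  proof (intro equalityI subsetI)
    fix D assume "D \<in> {C \<in> full_flags t. card C = j}"
    then obtain C where C: "C \<in> full_flags s" "D = (`) f ` C" "card D = j"
      unfolding im[symmetric] by blast
    then have "card C = j" using c[OF C(1)] by simp
    then show "D \<in> (`) ((`) f) ` {C \<in> full_flags s. card C = j}" using C by blast
  next
    fix D assume "D \<in> (`) ((`) f) ` {C \<in> full_flags s. card C = j}"
    then obtain C where C: "C \<in> full_flags s" "D = (`) f ` C" "card C = j" by blast
    then have "card D = j" "D \<in> full_flags t" using c[OF C(1)] im by (simp, blast)
    then show "D \<in> {C \<in> full_flags t. card C = j}" by simp
  qed
qed auto

lemma card_full_flags:
  assumes "finite s" shows "card {C \<in> full_flags s. card C = j} = flag_number (card s) j"
proof -
  obtain f where "bij_betw f {..<card s} s" using assms bij_betw_from_nat_into_finite by blast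
  from bij_betw_same_card[OF full_flags_card_bij_betw[OF this]] show ?thesis
    unfolding flag_number_def by simp
qed

text \<open>Written without choosing a flag. Since barycenters are injective on the complex, the
  simplices occurring here are exactly the members of the flag of \<open>\<sigma>\<close>, and the
  union is its top.\<close>

definition carrier :: "'a::real_normed_vector set set \<Rightarrow> 'a set \<Rightarrow> 'a set" where
  "carrier K \<sigma> = \<Union>{s \<in> K. barycenter s \<in> \<sigma>}"

lemma carrier_image:
  assumes "bary_complex K" "C \<in> flags K" shows "carrier K (barycenter ` C) = \<Union>C"
proof -
  have "{s \<in> K. barycenter s \<in> barycenter ` C} = C"
    using barycenter_inj_on[OF assms(1)] assms(2) unfolding inj_on_def flags_def by blast
  then show ?thesis by (simp add: carrier_def)
qed

lemma carrier_in: "bary_complex K \<Longrightarrow> \<sigma> \<in> sd K \<Longrightarrow> carrier K \<sigma> \<in> K"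
  using carrier_image flags_Union_mem by (fastforce simp: sd_eq_flags flags_def)

text \<open>By \<open>carrier_image\<close>, fixing the carrier of a simplex means fixing the top of
  its flag.\<close>

lemma sd_carrier_bij_betw:
  assumes K: "bary_complex K" and s: "s \<in> K"
  shows "bij_betw ((`) barycenter) (full_flags s) {\<sigma> \<in> sd K. carrier K \<sigma> = s}"
proof -
  have "full_flags s = {C \<in> flags K. carrier K (barycenter ` C) = s}"
    unfolding flags_Union_eq[OF K s, symmetric] using carrier_image[OF K] by blast
  then have "(`) barycenter ` full_flags s = {\<sigma> \<in> sd K. carrier K \<sigma> = s}" "full_flags s \<subseteq> flags K"
    by (auto simp: sd_eq_flags)
  then show ?thesis using inj_on_subset[OF flags_image_inj_on[OF K]] by (simp add: bij_betw_def)
qed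

lemma full_flags_subset_flags:
  assumes "bary_complex K" "s \<in> K" shows "full_flags s \<subseteq> flags K"
  using flags_Union_eq[OF assms] by blast

lemma card_barycenter_image:
  assumes "bary_complex K" "C \<in> flags K" shows "card (barycenter ` C) = card C"
  using barycenter_inj_on[OF assms(1)] assms(2) by (intro card_image) (auto simp: flags_def intro: inj_on_subset)

lemma hull_carrier:
  assumes K: "bary_complex K" and \<sigma>: "\<sigma> \<in> sd K"
  shows "convex hull \<sigma> \<subseteq> convex hull (carrier K \<sigma>)"
proof -
  obtain C where C: "C \<in> flags K" "\<sigma> = barycenter ` C" using \<sigma> by (auto simp: sd_eq_flags)
  have "barycenter s \<in> convex hull (\<Union>C)" if "s \<in> C" for s
  proof -
    have "s \<in> K" using that C by (auto simp: flags_def)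
    then have "barycenter s \<in> convex hull s" using bary_complexD(1,2)[OF K] by (intro barycenter_in_hull) auto
    then show ?thesis using hull_mono[of s "\<Union>C"] that by blast
  qed
  then show ?thesis unfolding C(2) carrier_image[OF K C(1)]
    by (intro hull_minimal) auto
qed

text \<open>Simplices of all dimensions whose iterated carrier is exactly \<open>s\<close>. Those
  over proper faces of \<open>s\<close> are left out, so that the families for different
  \<open>s\<close> are disjoint and partition \<open>(sd ^^ d) K\<close>.\<close>

primrec pieces :: "nat \<Rightarrow> 'a::real_normed_vector set set \<Rightarrow> 'a set \<Rightarrow> 'a set set" where
  "pieces 0 K s = {s}"
| "pieces (Suc d) K s = {\<sigma> \<in> sd ((sd ^^ d) K). carrier ((sd ^^ d) K) \<sigma> \<in> pieces d K s}"

lemma pieces_subset: "s \<in> K \<Longrightarrow> pieces d K s \<subseteq> (sd ^^ d) K"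
  by (cases d) auto

lemma pieces_hull:
  assumes K: "bary_complex K" and "\<sigma> \<in> pieces d K s"
  shows "convex hull \<sigma> \<subseteq> convex hull s"
  using assms(2)
proof (induction d arbitrary: \<sigma>)
  case (Suc d)
  then have "convex hull \<sigma> \<subseteq> convex hull (carrier ((sd ^^ d) K) \<sigma>)"
    by (intro hull_carrier funpow_sd_bary_complex K) auto
  then show ?case using Suc.IH[of "carrier ((sd ^^ d) K) \<sigma>"] Suc.prems by auto
qed auto

lemma pieces_cover:
  assumes "bary_complex K" shows "(sd ^^ d) K = (\<Union>s\<in>K. pieces d K s)"
proof (induction d)
  case (Suc d)
  have "carrier ((sd ^^ d) K) \<sigma> \<in> (sd ^^ d) K" if "\<sigma> \<in> (sd ^^ Suc d) K" for \<sigma>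
    using that assms funpow_sd_bary_complex carrier_in by auto
  then show ?case using Suc by auto
qed auto

lemma pieces_disjoint: "\<sigma> \<in> pieces d K s \<Longrightarrow> \<sigma> \<in> pieces d K t \<Longrightarrow> s = t"
  by (induction d arbitrary: \<sigma>) auto

text \<open>Every new simplex has a unique carrier, and those with carrier \<open>\<tau>\<close> are
  the images of the full flags of \<open>\<tau>\<close>. Both the face counts and the integral
  identity over pieces are derived from this recursion.\<close>

lemma sum_pieces_Suc:
  assumes K: "bary_complex K" and s: "s \<in> K" and fin: "finite (pieces d K s)"
  shows "finite (pieces (Suc d) K s)"
    and "(\<Sum>\<sigma>\<in>pieces (Suc d) K s. h \<sigma>) = (\<Sum>\<tau>\<in>pieces d K s. \<Sum>C\<in>full_flags \<tau>. h (barycenter ` C))"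
proof -
  let ?K = "(sd ^^ d) K"
  let ?A = "\<lambda>\<tau>. {\<sigma> \<in> sd ?K. carrier ?K \<sigma> = \<tau>}"
  have Kd: "bary_complex ?K" using K by (rule funpow_sd_bary_complex)
  have eq: "pieces (Suc d) K s = (\<Union>\<tau>\<in>pieces d K s. ?A \<tau>)" by auto
  have bij: "bij_betw ((`) barycenter) (full_flags \<tau>) (?A \<tau>)" if "\<tau> \<in> pieces d K s" for \<tau>
    using sd_carrier_bij_betw[OF Kd] pieces_subset[OF s] that by blast
  have finA: "finite (?A \<tau>)" if "\<tau> \<in> pieces d K s" for \<tau>
  proof -
    have "finite \<tau>" using that pieces_subset[OF s] bary_complexD(1)[OF Kd] by blast
    then show ?thesis using bij[OF that] finite_full_flags bij_betw_finite by blast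
  qed
  then show "finite (pieces (Suc d) K s)" unfolding eq using fin by blast
  have "(\<Sum>\<sigma>\<in>pieces (Suc d) K s. h \<sigma>) = (\<Sum>\<tau>\<in>pieces d K s. \<Sum>\<sigma>\<in>?A \<tau>. h \<sigma>)"
    unfolding eq using fin finA by (intro sum.UNION_disjoint) auto
  also have "\<dots> = (\<Sum>\<tau>\<in>pieces d K s. \<Sum>C\<in>full_flags \<tau>. h (barycenter ` C))"
    by (intro sum.cong refl sum.reindex_bij_betw[symmetric] bij)
  finally show "(\<Sum>\<sigma>\<in>pieces (Suc d) K s. h \<sigma>) = (\<Sum>\<tau>\<in>pieces d K s. \<Sum>C\<in>full_flags \<tau>. h (barycenter ` C))" .
qed

lemma finite_pieces: "bary_complex K \<Longrightarrow> s \<in> K \<Longrightarrow> finite (pieces d K s)"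
  by (induction d) (simp, metis sum_pieces_Suc(1))

lemma pieces_card_le:
  assumes K: "bary_complex K" and s: "s \<in> K" and "\<sigma> \<in> pieces d K s"
  shows "card \<sigma> \<le> card s"
  using assms(3)
proof (induction d arbitrary: \<sigma>)
  case (Suc d)
  let ?K = "(sd ^^ d) K"
  let ?\<tau> = "carrier ?K \<sigma>"
  have Kd: "bary_complex ?K" using K by (rule funpow_sd_bary_complex)
  have \<tau>: "?\<tau> \<in> pieces d K s" "\<sigma> \<in> sd ?K" using Suc.prems by auto
  then have \<tau>K: "?\<tau> \<in> ?K" using pieces_subset[OF s] by blast
  then obtain C where C: "C \<in> full_flags ?\<tau>" "\<sigma> = barycenter ` C"
    using sd_carrier_bij_betw[OF Kd \<tau>K] \<tau> unfolding bij_betw_def by blast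
  have "card \<sigma> \<le> card ?\<tau>"
    using full_flags_card_le[OF _ C(1)] C card_barycenter_image[OF Kd, of C] full_flags_subset_flags[OF Kd \<tau>K]
      bary_complexD(1)[OF Kd \<tau>K] by auto
  then show ?case using Suc.IH[OF \<tau>(1)] by simp
qed auto

text \<open>The recursion of \<open>pieces\<close> peels off the last subdivision, so induction on
  \<open>e\<close> with \<open>m\<close> fixed matches carriers level by level.\<close>

lemma pieces_add:
  assumes K: "bary_complex K" and s: "s \<in> K"
  shows "pieces (e + m) K s = (\<Union>\<tau>\<in>pieces m K s. pieces e ((sd ^^ m) K) \<tau>)"
  by (induction e) (auto simp: funpow_add)

lemma sum_pieces_add:
  assumes K: "bary_complex K" and s: "s \<in> K"
  shows "(\<Sum>\<sigma>\<in>pieces (e + m) K s. h \<sigma>) = (\<Sum>\<tau>\<in>pieces m K s. \<Sum>\<sigma>\<in>pieces e ((sd ^^ m) K) \<tau>. h \<sigma>)"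
  unfolding pieces_add[OF K s]
proof (rule sum.UNION_disjoint)
  show "\<forall>\<tau>\<in>pieces m K s. finite (pieces e ((sd ^^ m) K) \<tau>)"
    using pieces_subset[OF s] finite_pieces[OF funpow_sd_bary_complex[OF K]] by blast
  show "\<forall>\<tau>\<in>pieces m K s. \<forall>\<tau>'\<in>pieces m K s. \<tau> \<noteq> \<tau>' \<longrightarrow>
      pieces e ((sd ^^ m) K) \<tau> \<inter> pieces e ((sd ^^ m) K) \<tau>' = {}"
    using pieces_disjoint by blast
qed (rule finite_pieces[OF K s])

text \<open>Row \<open>k\<close> of the \<open>d\<close>-th power of the triangular matrix
  \<open>flag_number\<close>: the number of pieces with \<open>j\<close> vertices in a simplex with
  \<open>k\<close> vertices. The range stops at \<open>k\<close> because subdivision never produces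
  larger pieces.\<close>

primrec piece_number :: "nat \<Rightarrow> nat \<Rightarrow> nat \<Rightarrow> nat" where
  "piece_number 0 k j = (if j = k then 1 else 0)"
| "piece_number (Suc d) k j = (\<Sum>i\<le>k. piece_number d k i * flag_number i j)"

lemma sum_by_card:
  fixes g :: "nat \<Rightarrow> 'b::semiring_1"
  assumes "finite A" "\<And>a. a \<in> A \<Longrightarrow> f a \<le> k"
  shows "(\<Sum>a\<in>A. g (f a)) = (\<Sum>i\<le>k. of_nat (card {a \<in> A. f a = i}) * g i)"
proof -
  have "(\<Sum>a\<in>A. g (f a)) = (\<Sum>i\<le>k. \<Sum>a\<in>{a \<in> A. f a = i}. g (f a))"
    using assms by (intro sum.group[symmetric]) auto
  also have "\<dots> = (\<Sum>i\<le>k. of_nat (card {a \<in> A. f a = i}) * g i)"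
    by (intro sum.cong refl) simp
  finally show ?thesis .
qed

lemma card_full_flags_image:
  assumes "bary_complex K" "s \<in> K"
  shows "(\<Sum>C\<in>full_flags s. if card (barycenter ` C) = j then 1 else 0) = flag_number (card s) j"
proof -
  have "(\<Sum>C\<in>full_flags s. if card (barycenter ` C) = j then 1 else 0) = (\<Sum>C\<in>full_flags s. if card C = j then 1 else 0)"
    using card_barycenter_image[OF assms(1)] full_flags_subset_flags[OF assms] by (intro sum.cong) auto
  also have "\<dots> = card {C \<in> full_flags s. card C = j}"
    using finite_full_flags bary_complexD(1)[OF assms] by (subst sum.inter_filter[symmetric]) auto
  finally show ?thesis using card_full_flags bary_complexD(1)[OF assms] by simp
qed

lemma card_pieces:
  assumes K: "bary_complex K" and s: "s \<in> K"
  shows "card {\<sigma> \<in> pieces d K s. card \<sigma> = j} = piece_number d (card s) j"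
proof (induction d arbitrary: j)
  case (Suc d)
  let ?K = "(sd ^^ d) K"
  have Kd: "bary_complex ?K" using K by (rule funpow_sd_bary_complex)
  have fin: "finite (pieces d K s)" "finite (pieces (Suc d) K s)" by (intro finite_pieces K s)+
  have "card {\<sigma> \<in> pieces (Suc d) K s. card \<sigma> = j} = (\<Sum>\<sigma>\<in>pieces (Suc d) K s. if card \<sigma> = j then 1 else 0)"
    using fin(2) by (subst sum.inter_filter[symmetric]) auto
  also have "\<dots> = (\<Sum>\<tau>\<in>pieces d K s. \<Sum>C\<in>full_flags \<tau>. if card (barycenter ` C) = j then 1 else 0)"
    by (rule sum_pieces_Suc(2)[OF K s fin(1)])
  also have "\<dots> = (\<Sum>\<tau>\<in>pieces d K s. flag_number (card \<tau>) j)"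
    using pieces_subset[OF s] by (intro sum.cong refl card_full_flags_image[OF Kd]) auto
  also have "\<dots> = (\<Sum>i\<le>card s. card {\<tau> \<in> pieces d K s. card \<tau> = i} * flag_number i j)"
    using sum_by_card[OF fin(1), of card "card s" "\<lambda>i. flag_number i j"] pieces_card_le[OF K s] by simp
  finally show ?case by (simp add: Suc del: pieces.simps)
qed (auto simp: Collect_conv_if)

subsection \<open>The standard simplex and interior flags\<close>

lemma lookup_scaleR [simp]: "Poly_Mapping.lookup (r *\<^sub>R x) i = r *\<^sub>R Poly_Mapping.lookup x i"
proof -
  have "finite {i. r *\<^sub>R Poly_Mapping.lookup x i \<noteq> 0}"
    by (rule finite_subset[OF _ finite_lookup[of x]]) auto
  then show ?thesis by (simp add: scaleR_poly_mapping_def)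
qed

lemma finite_std_vertices [simp]: "finite (std_vertices m)"
  by (simp add: std_vertices_def)

lemma inj_single_one: "inj (\<lambda>i. Poly_Mapping.single i (1::real))"
  by (rule injI) (metis lookup_single_eq lookup_single_not_eq zero_neq_one)

lemma card_std_vertices [simp]: "card (std_vertices m) = Suc m"
  unfolding std_vertices_def using inj_on_subset[OF inj_single_one] by (subst card_image) auto

lemma lookup_std_sum:
  fixes U :: "(nat \<Rightarrow>\<^sub>0 real) \<Rightarrow> real"
  assumes "i \<le> m"
  shows "Poly_Mapping.lookup (\<Sum>v\<in>std_vertices m. U v *\<^sub>R v) i = U (Poly_Mapping.single i 1)"
proof -
  have "(\<Sum>v\<in>std_vertices m. U v *\<^sub>R v) = (\<Sum>i\<le>m. U (Poly_Mapping.single i 1) *\<^sub>R Poly_Mapping.single i 1)"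
    unfolding std_vertices_def using inj_on_subset[OF inj_single_one] by (subst sum.reindex) auto
  then show ?thesis using assms by (simp add: lookup_sum lookup_single when_def if_distrib cong: if_cong)
qed

lemma std_vertices_independent: "\<not> affine_dependent (std_vertices m)"
proof
  assume "affine_dependent (std_vertices m)"
  then obtain U v where U: "v \<in> std_vertices m" "U v \<noteq> 0" "(\<Sum>v\<in>std_vertices m. U v *\<^sub>R v) = 0"
    by (auto simp: affine_dependent_explicit_finite)
  then obtain i where i: "i \<le> m" "v = Poly_Mapping.single i 1" by (auto simp: std_vertices_def)
  then show False using lookup_std_sum[of i m U] U by simp
qed

text \<open>Coordinates relative to all of \<open>V\<close> are unique, so the extensions by zero
  from \<open>s\<close> and from \<open>t\<close> coincide and vanish off
  \<open>s \<inter> t\<close>.\<close>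

lemma convex_hull_Int_independent:
  fixes V :: "'a::real_vector set"
  assumes "finite V" "\<not> affine_dependent V" "s \<subseteq> V" "t \<subseteq> V"
  shows "convex hull s \<inter> convex hull t = convex hull (s \<inter> t)"
proof
  show "convex hull (s \<inter> t) \<subseteq> convex hull s \<inter> convex hull t" by (simp add: hull_mono)
  show "convex hull s \<inter> convex hull t \<subseteq> convex hull (s \<inter> t)"
  proof
    fix x assume x: "x \<in> convex hull s \<inter> convex hull t"
    have fin: "finite s" "finite t" using assms finite_subset by blast+
    obtain a where a: "\<forall>v\<in>s. 0 \<le> a v" "sum a s = 1" "(\<Sum>v\<in>s. a v *\<^sub>R v) = x"
      using x fin by (auto simp: convex_hull_finite)
    obtain b where b: "\<forall>v\<in>t. 0 \<le> b v" "sum b t = 1" "(\<Sum>v\<in>t. b v *\<^sub>R v) = x"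
      using x fin by (auto simp: convex_hull_finite)
    define a' where "a' v = (if v \<in> s then a v else 0)" for v
    define b' where "b' v = (if v \<in> t then b v else 0)" for v
    have "sum a' V = sum a s" "(\<Sum>v\<in>V. a' v *\<^sub>R v) = (\<Sum>v\<in>s. a v *\<^sub>R v)"
      using assms by (auto simp: a'_def intro!: sum.mono_neutral_cong_right)
    moreover have "sum b' V = sum b t" "(\<Sum>v\<in>V. b' v *\<^sub>R v) = (\<Sum>v\<in>t. b v *\<^sub>R v)"
      using assms by (auto simp: b'_def intro!: sum.mono_neutral_cong_right)
    ultimately have eq: "a' v = b' v" if "v \<in> V" for v
      using affine_independent_unique[OF assms(1,2), of a' b' v] a b that by simp
    have zero: "a v = 0" if "v \<in> s - t" for v
      using eq[of v] that assms by (auto simp: a'_def b'_def)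
    have "sum a (s \<inter> t) = sum a s" "(\<Sum>v\<in>s \<inter> t. a v *\<^sub>R v) = (\<Sum>v\<in>s. a v *\<^sub>R v)"
      by (intro sum.mono_neutral_left; use fin zero in force)+
    then show "x \<in> convex hull (s \<inter> t)" using fin a by (auto simp: convex_hull_finite)
  qed
qed

lemma geometric_std_simplex: "geometric_complex (std_simplex m)"
proof -
  have *: "finite s \<and> s \<noteq> {} \<and> \<not> affine_dependent s" if "s \<in> std_simplex m" for s
    using that affine_dependent_subset[of s "std_vertices m"] std_vertices_independent[of m]
    by (auto simp: std_simplex_def intro: finite_subset)
  have **: "convex hull s \<inter> convex hull t = convex hull (s \<inter> t)" if "s \<in> std_simplex m" "t \<in> std_simplex m" for s t
    using that by (intro convex_hull_Int_independent[OF finite_std_vertices std_vertices_independent[of m]])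
      (auto simp: std_simplex_def)
  have "t \<in> std_simplex m" if "s \<in> std_simplex m" "t \<subseteq> s" "t \<noteq> {}" for s t
    using that by (auto simp: std_simplex_def)
  with * ** show ?thesis unfolding geometric_complex_def by (intro conjI ballI allI impI) auto
qed

lemma finite_std_simplex: "finite (std_simplex m)"
  by (rule finite_subset[of _ "Pow (std_vertices m)"]) (auto simp: std_simplex_def)

lemma std_vertices_in_std_simplex: "std_vertices m \<in> std_simplex m"
  by (auto simp: std_simplex_def std_vertices_def)

lemma dimension_std_simplex: "has_dimension (std_simplex m) m"
  unfolding has_dimension_def
proof
  show "\<forall>s\<in>std_simplex m. card s \<le> m + 1"
    using card_mono[OF finite_std_vertices[of m]] by (auto simp: std_simplex_def)
  show "\<exists>s\<in>std_simplex m. card s = m + 1"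
    using std_vertices_in_std_simplex[of m] by (intro bexI[of _ "std_vertices m"]) auto
qed

lemma face_number_std_simplex: "face_number p (std_simplex m) = (m + 1) choose (p + 1)"
proof -
  have "simplices p (std_simplex m) = {s. s \<subseteq> std_vertices m \<and> card s = p + 1}"
    by (auto simp: simplices_def std_simplex_def)
  then show ?thesis by (simp add: face_number_def n_subsets)
qed

section \<open>Relative interiors and the interior simplices of a subdivision\<close>

lemma hull_support:
  assumes "finite s" "x \<in> convex hull s"
  obtains t a where "t \<subseteq> s" "t \<noteq> {}" "\<And>v. v \<in> t \<Longrightarrow> 0 < a v" "sum a t = 1" "(\<Sum>v\<in>t. a v *\<^sub>R v) = x"
proof -
  obtain a where a: "\<forall>v\<in>s. 0 \<le> a v" "sum a s = 1" "(\<Sum>v\<in>s. a v *\<^sub>R v) = x"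
    using assms by (auto simp: convex_hull_finite)
  let ?t = "{v \<in> s. a v \<noteq> 0}"
  have "sum a ?t = sum a s" "(\<Sum>v\<in>?t. a v *\<^sub>R v) = (\<Sum>v\<in>s. a v *\<^sub>R v)"
    using assms(1) by (auto intro!: sum.mono_neutral_left)
  moreover from this have "?t \<noteq> {}" using a by (metis sum.empty zero_neq_one)
  ultimately show ?thesis using a by (intro that[of ?t a]) (simp_all add: less_le)
qed

text \<open>The support of the point in \<open>t\<close> is a face of \<open>t\<close> in which the
  point has positive coordinates; by uniqueness this face is \<open>s\<close>.\<close>

lemma bary_complex_hull_support:
  assumes K: "bary_complex K" and s: "s \<in> K" "\<And>v. v \<in> s \<Longrightarrow> 0 < a v" "sum a s = 1" 
    and t: "t \<in> K" "(\<Sum>v\<in>s. a v *\<^sub>R v) \<in> convex hull t"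
  shows "s \<subseteq> t"
proof -
  obtain r b where r: "r \<subseteq> t" "r \<noteq> {}" "\<And>v. v \<in> r \<Longrightarrow> 0 < b v" "sum b r = 1"
      "(\<Sum>v\<in>r. b v *\<^sub>R v) = (\<Sum>v\<in>s. a v *\<^sub>R v)"
    using hull_support[OF bary_complexD(1)[OF K t(1)] t(2)] by metis
  have "r \<in> K" using bary_complexD(3)[OF K t(1) r(1,2)] .
  then have "s = r" using bary_complex_unique(1)[OF K s(1), of r a b] s r by auto
  then show ?thesis using r by simp
qed

lemma barycenter_hull_subset:
  assumes "bary_complex K" "s \<in> K" "t \<in> K" "barycenter s \<in> convex hull t"
  shows "s \<subseteq> t"
  using assms bary_complexD(1,2)[OF assms(1,2)]
  by (intro bary_complex_hull_support[OF assms(1,2), of "\<lambda>_. 1 / card s"])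
    (auto simp: barycenter_eq_sum card_gt_0_iff)

text \<open>Interior means that the carrier is the whole simplex: in that case the barycenter of the
  whole simplex is a vertex of \<open>\<tau>\<close>, and it lies in no proper face. Otherwise the
  hull lies in the carrier, hence in the boundary.\<close>

lemma interior_number_eq_flag_number:
  assumes "0 < k" "0 < j" shows "interior_number k j = flag_number k j"
proof -
  obtain m where m: "k = Suc m" using assms by (cases k) auto
  let ?K = "std_simplex m" and ?s = "std_vertices m"
  have K: "bary_complex ?K" and s: "?s \<in> ?K"
    using geometric_bary_complex geometric_std_simplex std_vertices_in_std_simplex by auto
  have "convex hull \<tau> \<subseteq> realization (boundary_std_simplex m) \<longleftrightarrow> carrier ?K \<tau> \<noteq> ?s" if \<tau>: "\<tau> \<in> sd ?K" for \<tau>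
  proof
    assume "carrier ?K \<tau> \<noteq> ?s"
    then show "convex hull \<tau> \<subseteq> realization (boundary_std_simplex m)"
      using hull_carrier[OF K \<tau>] carrier_in[OF K \<tau>] by (auto simp: realization_def boundary_std_simplex_def)
  next
    assume sub: "convex hull \<tau> \<subseteq> realization (boundary_std_simplex m)"
    show "carrier ?K \<tau> \<noteq> ?s"
    proof
      assume "carrier ?K \<tau> = ?s"
      then obtain C where C: "C \<in> full_flags ?s" "\<tau> = barycenter ` C"
        using sd_carrier_bij_betw[OF K s] \<tau> unfolding bij_betw_def by blast
      then have "barycenter ?s \<in> convex hull \<tau>" using full_flagsD(7) by (auto intro: hull_inc)
      then obtain t where t: "t \<in> ?K" "t \<noteq> ?s" "barycenter ?s \<in> convex hull t"
        using sub by (auto simp: realization_def boundary_std_simplex_def)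
      then have "?s \<subseteq> t" using barycenter_hull_subset[OF K s] by blast
      then show False using t by (auto simp: std_simplex_def)
    qed
  qed
  then have "{\<tau> \<in> simplices (j - 1) (sd ?K). \<not> convex hull \<tau> \<subseteq> realization (boundary_std_simplex m)}
     = {\<tau> \<in> pieces 1 ?K ?s. card \<tau> = j}"
    using assms by (auto simp: simplices_def)
  then have "interior_number k j = card {\<tau> \<in> pieces 1 ?K ?s. card \<tau> = j}"
    using assms m by (simp add: interior_number_def)
  also have "\<dots> = flag_number k j"
    unfolding card_pieces[OF K s] by (simp add: m if_distrib cong: if_cong)
  finally show ?thesis .
qed

lemma flag_number_eq_0: "k < j \<Longrightarrow> flag_number k j = 0"
  using full_flags_card_le[of "{..<k}"] unfolding flag_number_def
  by (subst card_eq_0_iff) (fastforce simp: finite_full_flags)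

text \<open>For \<open>a\<close> different from \<open>s\<close>, removing the bottom
  \<open>a\<close> and subtracting it from the other members is a bijection onto the full flags of
  \<open>s - a\<close> with \<open>l\<close> members; the inverse adds \<open>a\<close> to every
  member and restores the bottom.\<close>

lemma full_flags_dual_card:
  assumes s: "finite s" and a: "a \<subseteq> s" "a \<noteq> {}"
  shows "card {C \<in> full_flags s. card C = Suc l \<and> \<Inter>C = a} = interior_number (card (s - a)) l"
proof (cases "a = s")
  \<comment> \<open>Only the flag \<open>{s}\<close> has bottom \<open>s\<close>. It has one member,
    in accordance with \<open>interior_number 0 0 = 1\<close>.\<close>
  case True
  have "C = {s}" if "C \<in> full_flags s" "\<Inter>C = s" for C
  proof -
    have "t = s" if "t \<in> C" for t using full_flagsD(3)[OF \<open>C \<in> full_flags s\<close>] \<open>\<Inter>C = s\<close> that by blast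
    then show ?thesis using full_flagsD(2)[OF that(1)] by blast
  qed
  moreover have "{s} \<in> full_flags s" using True a s by (intro full_flagsI) (auto simp: chain_subset_def)
  ultimately have sub: "{C \<in> full_flags s. card C = Suc l \<and> \<Inter>C = a} \<subseteq> {{s}}" and mem: "{s} \<in> full_flags s"
    using True by blast+
  have "{C \<in> full_flags s. card C = Suc l \<and> \<Inter>C = a} = (if l = 0 then {{s}} else {})"
  proof (cases "l = 0")
    case l: True
    then have "{s} \<in> {C \<in> full_flags s. card C = Suc l \<and> \<Inter>C = a}" using mem True by simp
    moreover have "A = {{s}}" if "{s} \<in> A" "A \<subseteq> {{s}}" for A using that by blast
    from this[OF calculation sub] show ?thesis using l by simp
  next
    case False
    then have "{s} \<notin> {C \<in> full_flags s. card C = Suc l \<and> \<Inter>C = a}" by simp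
    moreover have "A = {}" if "{s} \<notin> A" "A \<subseteq> {{s}}" for A using that by blast
    from this[OF calculation sub] show ?thesis using False by simp
  qed
  then show ?thesis by (simp add: True interior_number_def)
next
  case False
  have sa: "s - a \<noteq> {}" "finite (s - a)" using False a s by auto
  then have pos: "0 < card (s - a)" by (simp add: card_gt_0_iff)
  let ?A = "{C \<in> full_flags s. card C = Suc l \<and> \<Inter>C = a}"
  show ?thesis
  proof (cases "l = 0")
    case True
    \<comment> \<open>In a flag with one member top and bottom coincide, so there is none; this
      matches the value 0 of \<open>interior_number h 0\<close> for positive
      \<open>h\<close>.\<close>
    have "\<Inter>C \<noteq> a" if "C \<in> full_flags s" "card C = Suc 0" for C
      using full_flagsD(7)[OF that(1)] that(2) False by (auto simp: card_Suc_eq)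
    then have "card ?A = 0" using True by (intro card_eq_0_iff[THEN iffD2] disjI1) auto
    then show ?thesis using pos True by (simp only:) (simp add: interior_number_def)
  next
    case l: False
    let ?B = "{D \<in> full_flags (s - a). card D = l}"
    let ?f = "\<lambda>C. (\<lambda>t. t - a) ` (C - {a})" and ?g = "\<lambda>D. insert a ((\<lambda>t. t \<union> a) ` D)"
    have ainC: "a \<in> C" "\<And>t. t \<in> C \<Longrightarrow> a \<subseteq> t" if "C \<in> ?A" for C
    proof -
      have "C \<in> flags (Pow s - {{}})" using that by (auto simp: full_flags_def)
      then show "a \<in> C" using flags_Inter_mem[of C] that by auto
      show "a \<subseteq> t" if "t \<in> C" for t using that \<open>C \<in> ?A\<close> by auto
    qed
    have injf: "inj_on (\<lambda>t. t - a) (C - {a})" if "C \<in> ?A" for C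
      using ainC(2)[OF that] by (intro inj_onI) (metis DiffD1 Diff_partition)
    have injg: "inj_on (\<lambda>t. t \<union> a) D" if "D \<subseteq> Pow (s - a)" for D
      using that by (intro inj_onI) blast
    have fB: "?f C \<in> ?B" if C: "C \<in> ?A" for C
    proof -
      have CF: "C \<in> full_flags s" and cC: "card C = Suc l" using C by auto
      note c = full_flagsD[OF CF]
      have "?f C \<in> full_flags (s - a)"
      proof (rule full_flagsI)
        show "finite (?f C)" using c by simp
        show "s - a \<in> ?f C" using c False by auto
        then show "?f C \<noteq> {}" by blast
        show "?f C \<subseteq> Pow (s - a)" using c(3) by auto
        show "{} \<notin> ?f C" using ainC(2)[OF C] by auto
        show "chain_subset (?f C)" using c(5) unfolding chain_subset_def by blast
      qed
      moreover have "card (?f C) = l"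
        using card_image[OF injf[OF C]] cC ainC(1)[OF C] c(1) by simp
      ultimately show ?thesis by simp
    qed
    have gA: "?g D \<in> ?A" if D: "D \<in> ?B" for D
    proof -
      have DF: "D \<in> full_flags (s - a)" and cD: "card D = l" using D by auto
      note d = full_flagsD[OF DF]
      have "?g D \<in> full_flags s"
      proof (rule full_flagsI)
        show "finite (?g D)" using d by simp
        show "?g D \<noteq> {}" by blast
        show "?g D \<subseteq> Pow s" using d(3) a by auto
        show "{} \<notin> ?g D" using a by auto
        show "s \<in> ?g D" using d(7) a by (auto simp: image_iff intro!: bexI[of _ "s - a"])
        show "chain_subset (?g D)" using d(5) unfolding chain_subset_def by blast
      qed
      moreover have "a \<notin> (\<lambda>t. t \<union> a) ` D"
      proof
        assume "a \<in> (\<lambda>t. t \<union> a) ` D"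
        then obtain t where "t \<in> D" "a = t \<union> a" by blast
        then have "t \<subseteq> a" "t \<subseteq> s - a" using d(3) by blast+
        then have "t = {}" by blast
        then show False using d(4) \<open>t \<in> D\<close> by simp
      qed
      then have "card (?g D) = Suc l" using card_image[OF injg[OF d(3)]] cD d(1) by simp
      moreover have "\<Inter>(?g D) = a" by auto
      ultimately show ?thesis by blast
    qed
    have gf: "?g (?f C) = C" if C: "C \<in> ?A" for C
    proof -
      have "(\<lambda>t. t \<union> a) ` ?f C = (\<lambda>t. t) ` (C - {a})"
        unfolding image_image using ainC(2)[OF C] by (intro image_cong) auto
      then show ?thesis using ainC(1)[OF C] by (simp add: insert_absorb)
    qed
    have fg: "?f (?g D) = D" if D: "D \<in> ?B" for D
    proof -
      have DF: "D \<in> full_flags (s - a)" using D by auto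
      note d = full_flagsD[OF DF]
      have "t \<union> a \<noteq> a" if "t \<in> D" for t 
      proof
        assume "t \<union> a = a"
        then have "t = {}" using d(3) that by blast
        then show False using d(4) that by simp
      qed
      then have "?g D - {a} = (\<lambda>t. t \<union> a) ` D" by auto
      moreover have "(\<lambda>t. t - a) ` (\<lambda>t. t \<union> a) ` D = (\<lambda>t. t) ` D"
        unfolding image_image using d(3) by (intro image_cong) auto
      ultimately show ?thesis by simp
    qed
    have "bij_betw ?f ?A ?B"
    proof (rule bij_betw_byWitness[where f' = ?g])
      show "\<forall>C\<in>?A. ?g (?f C) = C" by (rule ballI) (rule gf)
      show "\<forall>D\<in>?B. ?f (?g D) = D" by (rule ballI) (rule fg)
      show "?f ` ?A \<subseteq> ?B" by (rule image_subsetI) (rule fB)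
      show "?g ` ?B \<subseteq> ?A" by (rule image_subsetI) (rule gA)
    qed
    then have "card ?A = card ?B" by (rule bij_betw_same_card)
    also have "\<dots> = interior_number (card (s - a)) l"
      using card_full_flags[OF sa(2)] interior_number_eq_flag_number[OF pos, of l] l by simp
    finally show ?thesis .
  qed
qed

text \<open>Grouping by the bottom face gives one summand for each choice of \<open>Suc p\<close>
  vertices, and each summand depends only on the number of vertices left over.\<close>

lemma card_full_flags_bottom:
  assumes s: "finite s"
  shows "card {C \<in> full_flags s. card C = Suc l \<and> card (\<Inter>C) = Suc p} =
    (card s choose Suc p) * interior_number (card s - Suc p) l"
proof -
  let ?S = "{a. a \<subseteq> s \<and> card a = Suc p}"
  let ?A = "\<lambda>a. {C \<in> full_flags s. card C = Suc l \<and> \<Inter>C = a}"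
  have sub: "\<Inter>C \<subseteq> s" if "C \<in> full_flags s" for C using full_flagsD(7)[OF that] by blast
  then have "{C \<in> full_flags s. card C = Suc l \<and> card (\<Inter>C) = Suc p} = (\<Union>a\<in>?S. ?A a)"
    by auto
  then have "card {C \<in> full_flags s. card C = Suc l \<and> card (\<Inter>C) = Suc p} = (\<Sum>a\<in>?S. card (?A a))"
    using s finite_full_flags[OF s] by (simp only:) (rule card_UN_disjoint, auto)
  also have "\<dots> = (\<Sum>a\<in>?S. interior_number (card s - Suc p) l)"
  proof (rule sum.cong[OF refl])
    fix a assume "a \<in> ?S"
    then have a: "a \<subseteq> s" "card a = Suc p" "a \<noteq> {}" by auto
    then have "card (s - a) = card s - Suc p" using s by (simp add: card_Diff_subset finite_subset)
    then show "card (?A a) = interior_number (card s - Suc p) l" using full_flags_dual_card[OF s a(1,3)] by simp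
  qed
  finally show ?thesis using n_subsets[OF s] by simp
qed

subsection \<open>Maximal flags and limit densities\<close>

text \<open>Here \<open>\<pi>\<close> ranks the vertices, and index \<open>k\<close> keeps those of
  rank at least \<open>k\<close>. With this descending indexing, index \<open>k\<close> carries
  \<open>n + 1 - k\<close> vertices, the denominators of \<open>subdiv_coords\<close>.\<close>

definition perm_flag :: "nat \<Rightarrow> (nat \<Rightarrow> nat) \<Rightarrow> nat set set" where
  "perm_flag n \<pi> = (\<lambda>k. {i. i \<le> n \<and> k \<le> \<pi> i}) ` {..n}"

lemma card_superlevel_perm:
  assumes "\<pi> permutes {..n}" "k \<le> n"
  shows "card {i. i \<le> n \<and> k \<le> \<pi> i} = Suc n - k"
proof -
  have "\<pi> ` {i. i \<le> n \<and> k \<le> \<pi> i} = {k..n}"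
  proof (intro equalityI subsetI)
    fix j assume "j \<in> {k..n}"
    then have "j \<in> \<pi> ` {..n}" using permutes_image[OF assms(1)] by auto
    then show "j \<in> \<pi> ` {i. i \<le> n \<and> k \<le> \<pi> i}" using \<open>j \<in> {k..n}\<close> by auto
  qed (use permutes_in_image[OF assms(1)] in auto)
  moreover have "inj_on \<pi> {i. i \<le> n \<and> k \<le> \<pi> i}" using permutes_inj_on[OF assms(1)] .
  ultimately show ?thesis by (metis card_image card_atLeastAtMost)
qed

lemma card_perm_flag:
  assumes "\<pi> permutes {..n}" shows "card (perm_flag n \<pi>) = Suc n"
proof -
  have "inj_on (\<lambda>k. {i. i \<le> n \<and> k \<le> \<pi> i}) {..n}"
  proof (rule inj_onI)
    fix k l assume kl: "k \<in> {..n}" "l \<in> {..n}" "{i. i \<le> n \<and> k \<le> \<pi> i} = {i. i \<le> n \<and> l \<le> \<pi> i}"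
    then have "Suc n - k = Suc n - l" using card_superlevel_perm[OF assms, of k] card_superlevel_perm[OF assms, of l] by simp
    then show "k = l" using kl by auto
  qed
  then show ?thesis by (simp add: perm_flag_def card_image)
qed

text \<open>The size of a member determines its index, so a flag determines all superlevel sets of
  the ranking. Conversely, a flag with \<open>n + 1\<close> members has one of each size, and the
  vertices lost from one member to the next are listed in order of rank.\<close>

lemma perm_flag_bij_betw:
  "bij_betw (perm_flag n) {\<pi>. \<pi> permutes {..n}} {C \<in> full_flags {..n}. card C = Suc n}"
  unfolding bij_betw_def
proof (intro conjI equalityI subsetI)
  show "inj_on (perm_flag n) {\<pi>. \<pi> permutes {..n}}"
  proof (rule inj_onI, clarify)
    fix \<pi> \<rho> assume p: "\<pi> permutes {..n}" "\<rho> permutes {..n}" and eq: "perm_flag n \<pi> = perm_flag n \<rho>"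
    have sub: "{i. i \<le> n \<and> k \<le> \<pi> i} = {i. i \<le> n \<and> k \<le> \<rho> i}" if k: "k \<le> n" for k
    proof -
      have "{i. i \<le> n \<and> k \<le> \<pi> i} \<in> perm_flag n \<rho>" using k eq by (auto simp: perm_flag_def)
      then obtain l where l: "l \<le> n" "{i. i \<le> n \<and> k \<le> \<pi> i} = {i. i \<le> n \<and> l \<le> \<rho> i}" by (auto simp: perm_flag_def)
      then have "Suc n - k = Suc n - l"
        using card_superlevel_perm[OF p(1) k] card_superlevel_perm[OF p(2) l(1)] by simp
      then have "k = l" using l k by (simp add: Suc_diff_le)
      then show ?thesis using l by simp
    qed
    show "\<pi> = \<rho>"
    proof
      fix i show "\<pi> i = \<rho> i"
      proof (cases "i \<le> n")
        case True
        then have "\<pi> i \<le> n" "\<rho> i \<le> n" using p permutes_in_image[of _ "{..n}" i] by auto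
        then have "\<pi> i \<le> \<rho> i" "\<rho> i \<le> \<pi> i" using sub[of "\<pi> i"] sub[of "\<rho> i"] True by (auto simp: set_eq_iff)
        then show ?thesis by simp
      next
        case False
        then show ?thesis using p by (auto simp: permutes_def)
      qed
    qed
  qed
next
  fix C assume "C \<in> perm_flag n ` {\<pi>. \<pi> permutes {..n}}"
  then obtain \<pi> where \<pi>: "\<pi> permutes {..n}" "C = perm_flag n \<pi>" by auto
  have "perm_flag n \<pi> \<in> full_flags {..n}"
  proof (rule full_flagsI)
    show "{} \<notin> perm_flag n \<pi>"
    proof
      assume "{} \<in> perm_flag n \<pi>"
      then obtain k where "k \<le> n" "{} = {i. i \<le> n \<and> k \<le> \<pi> i}" by (auto simp: perm_flag_def)
      then show False using card_superlevel_perm[OF \<pi>(1), of k] by (metis card.empty diff_is_0_eq not_less_eq_eq)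
    qed
    show "chain_subset (perm_flag n \<pi>)"
      unfolding chain_subset_def
    proof (intro ballI)
      fix a b assume "a \<in> perm_flag n \<pi>" "b \<in> perm_flag n \<pi>"
      then obtain k l where "a = {i. i \<le> n \<and> k \<le> \<pi> i}" "b = {i. i \<le> n \<and> l \<le> \<pi> i}" by (auto simp: perm_flag_def)
      then show "a \<subseteq> b \<or> b \<subseteq> a" by (cases "k \<le> l") auto
    qed
    show "{..n} \<in> perm_flag n \<pi>" by (auto simp: perm_flag_def image_iff intro!: bexI[of _ 0])
  qed (auto simp: perm_flag_def)
  then show "C \<in> {C \<in> full_flags {..n}. card C = Suc n}" using card_perm_flag \<pi> by simp
next
  fix C assume "C \<in> {C \<in> full_flags {..n}. card C = Suc n}"
  then have C: "C \<in> full_flags {..n}" "card C = Suc n" by auto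
  note c = full_flagsD[OF C(1)]
  have fin: "finite a" if "a \<in> C" for a using that c(3) by (auto intro: finite_subset)
  have injc: "inj_on card C"
    using c(5) fin unfolding chain_subset_def by (intro inj_onI) (metis card_subset_eq)
  have "card ` C \<subseteq> {1..Suc n}"
  proof
    fix k assume "k \<in> card ` C"
    then obtain a where a: "a \<in> C" "k = card a" by auto
    then have "a \<noteq> {}" "a \<subseteq> {..n}" using c by auto
    then show "k \<in> {1..Suc n}" using a fin[OF a(1)] card_mono[of "{..n}" a] by (auto simp: Suc_le_eq card_gt_0_iff)
  qed
  moreover have "card (card ` C) = Suc n" using injc C(2) by (simp add: card_image)
  ultimately have cards: "card ` C = {1..Suc n}" by (intro card_subset_eq) auto
  have "\<exists>a. a \<in> C \<and> card a = Suc n - k" if "k \<le> n" for k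
  proof -
    have "Suc n - k \<in> card ` C" unfolding cards using that by auto
    then show ?thesis by (auto simp: image_iff) 
  qed
  then obtain t where t: "\<And>k. k \<le> n \<Longrightarrow> t k \<in> C \<and> card (t k) = Suc n - k" by metis
  \<comment> \<open>The empty set is added after the last member, so that the final step from one
    vertex to none also loses a vertex.\<close>
  define t' where "t' k = (if k \<le> n then t k else {})" for k
  have anti: "t' l \<subseteq> t' k" if "k \<le> l" for k l
  proof (cases "l \<le> n")
    case True
    then have kl: "t k \<in> C" "t l \<in> C" "card (t l) \<le> card (t k)" using t[of k] t[of l] that by auto
    then have "t l \<subseteq> t k" using c(5) fin card_seteq[of "t l" "t k"] unfolding chain_subset_def by blast
    then show ?thesis using True that by (simp add: t'_def)
  qed (auto simp: t'_def)
  have "\<exists>x. x \<in> t' k - t' (Suc k)" if "k \<le> n" for k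
  proof -
    have "card (t' (Suc k)) < card (t' k)" using t[of k] t[of "Suc k"] that by (auto simp: t'_def)
    then have "t' (Suc k) \<noteq> t' k" by auto
    then show ?thesis using anti[of k "Suc k"] by auto
  qed
  \<comment> \<open>The vertex \<open>w k\<close> is the one lost in step \<open>k\<close>;
    \<open>w\<close> enumerates \<open>{..n}\<close> by increasing rank.\<close>
  then obtain w where w: "\<And>k. k \<le> n \<Longrightarrow> w k \<in> t' k - t' (Suc k)" by metis
  have w_in: "w l \<in> t' k" if "k \<le> l" "l \<le> n" for k l
    using w[OF that(2)] anti[OF that(1)] by auto
  have injw: "inj_on w {..n}"
  proof (rule linorder_inj_onI)
    fix k l assume "k < l" "k \<in> {..n}" "l \<in> {..n}"
    then show "w k \<noteq> w l" using w[of k] w_in[of "Suc k" l] by auto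
  qed auto
  have wn: "w k \<le> n" if "k \<le> n" for k
  proof -
    have "t k \<subseteq> {..n}" using t[OF that] c(3) by blast
    then show ?thesis using w[OF that] that by (auto simp: t'_def)
  qed
  have imw: "w ` {..n} = {..n}" using injw wn by (intro endo_inj_surj) auto
  have tk: "t k = w ` {k..n}" if "k \<le> n" for k
  proof (rule sym, rule card_subset_eq)
    show "finite (t k)" using t[OF that] fin by blast
    show "w ` {k..n} \<subseteq> t k" using w_in that by (auto simp: t'_def)
    have "inj_on w {k..n}" using injw by (rule inj_on_subset) auto
    then show "card (w ` {k..n}) = card (t k)" using t[OF that] by (simp add: card_image)
  qed
  \<comment> \<open>The ranking is the inverse of the enumeration \<open>w\<close>, continued by the
    identity as \<open>permutes\<close> demands.\<close>
  define \<pi> where "\<pi> i = (if i \<le> n then inv_into {..n} w i else i)" for i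
  have bw: "bij_betw w {..n} {..n}" using injw imw by (simp add: bij_betw_def)
  have "bij_betw \<pi> {..n} {..n} \<longleftrightarrow> bij_betw (inv_into {..n} w) {..n} {..n}"
    by (rule bij_betw_cong) (simp add: \<pi>_def)
  then have "\<pi> permutes {..n}"
    using bij_betw_inv_into[OF bw] by (intro bij_imp_permutes) (auto simp: \<pi>_def)
  have sup: "{i. i \<le> n \<and> k \<le> \<pi> i} = t k" if k: "k \<le> n" for k
  proof (intro equalityI subsetI)
    fix i assume i: "i \<in> {i. i \<le> n \<and> k \<le> \<pi> i}"
    then have "w (\<pi> i) = i" "\<pi> i \<le> n"
      using bij_betw_inv_into_right[OF bw, of i] bij_betw_apply[OF bij_betw_inv_into[OF bw], of i] by (auto simp: \<pi>_def)
    then show "i \<in> t k" unfolding tk[OF that] using i by (metis CollectD atLeastAtMost_iff imageI)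
  next
    fix i assume "i \<in> t k"
    then obtain j where j: "k \<le> j" "j \<le> n" "i = w j" unfolding tk[OF k] by auto
    then show "i \<in> {i. i \<le> n \<and> k \<le> \<pi> i}" using wn bij_betw_inv_into_left[OF bw, of j] by (auto simp: \<pi>_def)
  qed
  have "perm_flag n \<pi> = t ` {..n}" unfolding perm_flag_def using sup by (intro image_cong) auto
  then have "perm_flag n \<pi> \<subseteq> C" using t by auto
  then have "perm_flag n \<pi> = C"
    using c(1) C(2) card_perm_flag[OF \<open>\<pi> permutes {..n}\<close>] by (intro card_subset_eq) auto
  then show "C \<in> perm_flag n ` {\<pi>. \<pi> permutes {..n}}" using \<open>\<pi> permutes {..n}\<close> by blast
qed

lemma flag_number_diag: "0 < k \<Longrightarrow> flag_number k k = fact k"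
proof -
  assume "0 < k"
  then obtain n where n: "k = Suc n" by (cases k) auto
  have "{..<k} = {..n}" using n by auto
  then have "flag_number k k = card {C \<in> full_flags {..n}. card C = Suc n}" by (simp add: flag_number_def n)
  also have "\<dots> = card {\<pi>. \<pi> permutes {..n}}"
    using bij_betw_same_card[OF perm_flag_bij_betw[of n]] by simp
  also have "\<dots> = fact k" by (simp add: card_permutations[of "{..n}" "Suc n"] n)
  finally show ?thesis .
qed

section \<open>The triangular recursion and the limit densities\<close>

lemma piece_number_eq_0: "k < j \<Longrightarrow> piece_number d k j = 0"
proof (induction d arbitrary: j)
  case (Suc d)
  then show ?case using flag_number_eq_0 by (auto simp: intro!: sum.neutral) 
qed auto

lemma piece_number_diag: "0 < k \<Longrightarrow> piece_number d k k = fact k ^ d"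
proof (induction d)
  case (Suc d)
  have "piece_number (Suc d) k k = (\<Sum>i\<in>{k}. piece_number d k i * flag_number i k)"
    unfolding piece_number.simps using flag_number_eq_0 by (intro sum.mono_neutral_right) (auto simp: less_le)
  then show ?case using Suc flag_number_diag by simp
qed auto

text \<open>Subtracting the fixed point \<open>B / (1 - r)\<close> of the limiting recursion leaves
  an error that shrinks by the factor \<open>r\<close> up to a perturbation tending to zero.\<close>

lemma linear_recursion_limit:
  fixes x b :: "nat \<Rightarrow> real"
  assumes rec: "\<And>d. x (Suc d) = r * x d + b d" and b: "b \<longlonglongrightarrow> B" and r: "0 \<le> r" "r < 1"
  shows "x \<longlonglongrightarrow> B / (1 - r)"
proof -
  define L where "L = B / (1 - r)"
  have L: "L = r * L + B" using r by (simp add: L_def field_simps)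
  define y where "y d = \<bar>x d - L\<bar>" for d
  have y: "y (Suc d) \<le> r * y d + \<bar>b d - B\<bar>" for d
  proof -
    have "x (Suc d) - L = r * (x d - L) + (b d - B)" using rec[of d] L by (simp add: algebra_simps)
    then have "y (Suc d) \<le> \<bar>r * (x d - L)\<bar> + \<bar>b d - B\<bar>" unfolding y_def by (simp only: abs_triangle_ineq)
    then show ?thesis using r by (simp add: y_def abs_mult)
  qed
  have "y \<longlonglongrightarrow> 0"
  proof (rule LIMSEQ_I)
    fix e :: real assume e: "0 < e"
    \<comment> \<open>With this threshold \<open>e / 2\<close> is the fixed point of the perturbed
      bound, so the accumulated perturbation never exceeds it.\<close>
    have "0 < e / 2 * (1 - r)" using e r by simp
    then obtain M where M: "\<And>d. d \<ge> M \<Longrightarrow> \<bar>b d - B\<bar> < e / 2 * (1 - r)" using LIMSEQ_D[OF b] by (metis real_norm_def)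
    have bound: "y (M + k) \<le> r ^ k * y M + e / 2" for k
    proof (induction k)
      case (Suc k)
      have "y (M + Suc k) \<le> r * y (M + k) + e / 2 * (1 - r)" using y[of "M + k"] M[of "M + k"] by simp
      also have "\<dots> \<le> r * (r ^ k * y M + e / 2) + e / 2 * (1 - r)" using Suc r by (intro add_right_mono mult_left_mono)
      also have "\<dots> = r ^ Suc k * y M + e / 2" by (simp add: field_simps)
      finally show ?case .
    qed (use e in simp)
    have "(\<lambda>k. r ^ k * y M) \<longlonglongrightarrow> 0 * y M" using r by (intro tendsto_mult LIMSEQ_power_zero) auto
    then obtain N where N: "\<And>k. k \<ge> N \<Longrightarrow> \<bar>r ^ k * y M\<bar> < e / 2" using LIMSEQ_D[of _ 0 "e / 2"] e by fastforce
    show "\<exists>no. \<forall>n\<ge>no. norm (y n - 0) < e"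
    proof (intro exI allI impI)
      fix n assume n: "M + N \<le> n"
      have "y n \<le> r ^ (n - M) * y M + e / 2" using bound[of "n - M"] n by simp
      moreover have "\<bar>r ^ (n - M) * y M\<bar> < e / 2" using N[of "n - M"] n by simp
      moreover have "0 \<le> y n" by (simp add: y_def)
      ultimately show "norm (y n - 0) < e" by simp
    qed
  qed
  then have "(\<lambda>d. x d - L) \<longlonglongrightarrow> 0" unfolding y_def by (rule tendsto_rabs_zero_cancel)
  then show ?thesis unfolding L_def[symmetric] by (simp add: LIM_zero_iff)
qed

text \<open>Descending induction on \<open>j\<close>: the recursion for column \<open>j\<close>
  involves only itself, with ratio j!/(n+1)! smaller than 1, and the columns \<open>i > j\<close>,
  which already converge and act as a forcing term. For \<open>k\<close> at most \<open>n\<close>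
  the forcing tends to zero, hence so does the column.\<close>

lemma piece_density_exists:
  assumes j: "1 \<le> j" "j \<le> Suc n"
  shows "\<exists>q. \<forall>k\<le>Suc n. (\<lambda>d. real (piece_number d k j) / fact (Suc n) ^ d) \<longlonglongrightarrow> (if k = Suc n then q else 0)"
  using j
proof (induction "Suc n - j" arbitrary: j rule: less_induct)
  case less
  let ?N = "fact (Suc n) :: real"
  let ?a = "\<lambda>d k j. real (piece_number d k j) / ?N ^ d"
  show ?case
  proof (cases "j = Suc n")
    case True
    have "?a d k j = (if k = Suc n then 1 else 0)" if "k \<le> Suc n" for d k
      using that piece_number_diag[of k d] piece_number_eq_0[of k j d] True by (auto simp del: fact_Suc)
    then show ?thesis by (intro exI[of _ 1] allI impI) (simp del: fact_Suc)
  next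
    case False
    then have jn: "j < Suc n" using less.prems by simp
    have "\<exists>q. \<forall>k\<le>Suc n. (\<lambda>d. ?a d k i) \<longlonglongrightarrow> (if k = Suc n then q else 0)" if "j < i" "i \<le> Suc n" for i
      using less.hyps[of i] that less.prems by auto
    then obtain q where q: "\<And>i k. j < i \<Longrightarrow> i \<le> Suc n \<Longrightarrow> k \<le> Suc n \<Longrightarrow> (\<lambda>d. ?a d k i) \<longlonglongrightarrow> (if k = Suc n then q i else 0)"
      by metis
    define r where "r = real (flag_number j j) / ?N"
    define B where "B = (\<Sum>i\<in>{j<..Suc n}. q i * real (flag_number i j)) / ?N"
    have r: "0 \<le> r" "r < 1"
    proof -
      have "(fact j :: real) < ?N" using jn less.prems by (intro fact_less_mono) auto
      then show "r < 1" "0 \<le> r" using less.prems by (auto simp: r_def flag_number_diag simp del: fact_Suc)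
    qed
    have "(\<lambda>d. ?a d k j) \<longlonglongrightarrow> (if k = Suc n then B / (1 - r) else 0)" if k: "k \<le> Suc n" for k
    proof -
      define b where "b d = (\<Sum>i\<in>{j<..Suc n}. ?a d k i * real (flag_number i j)) / ?N" for d
      have "b \<longlonglongrightarrow> (\<Sum>i\<in>{j<..Suc n}. (if k = Suc n then q i else 0) * real (flag_number i j)) / ?N"
        unfolding b_def by (intro tendsto_intros q) (use k in auto)
      also have "(\<Sum>i\<in>{j<..Suc n}. (if k = Suc n then q i else 0) * real (flag_number i j)) / ?N = (if k = Suc n then B else 0)"
        by (simp add: B_def)
      finally have b: "b \<longlonglongrightarrow> (if k = Suc n then B else 0)" .
      have rec: "?a (Suc d) k j = r * ?a d k j + b d" for d
      proof -
        have "piece_number (Suc d) k j = (\<Sum>i\<le>Suc n. piece_number d k i * flag_number i j)"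
          unfolding piece_number.simps using k piece_number_eq_0 by (intro sum.mono_neutral_left) auto
        also have "\<dots> = (\<Sum>i\<in>insert j {j<..Suc n}. piece_number d k i * flag_number i j)"
          using less.prems flag_number_eq_0 by (intro sum.mono_neutral_right) auto
        also have "\<dots> = piece_number d k j * flag_number j j + (\<Sum>i\<in>{j<..Suc n}. piece_number d k i * flag_number i j)"
          by simp
        finally have "real (piece_number (Suc d) k j) = real (piece_number d k j) * real (flag_number j j)
            + (\<Sum>i\<in>{j<..Suc n}. real (piece_number d k i) * real (flag_number i j))" by simp
        then show ?thesis
          by (simp add: r_def b_def add_divide_distrib sum_divide_distrib mult.commute del: fact_Suc piece_number.simps)
      qed
      show ?thesis using linear_recursion_limit[OF rec b r] by (simp split: if_splits)
    qed
    then show ?thesis by blast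
  qed
qed

text \<open>Each simplex of the subdivision is a piece of exactly one simplex of
  \<open>K\<close>.\<close>

lemma face_number_funpow_sd:
  assumes K: "bary_complex K" and fin: "finite K"
  shows "face_number p ((sd ^^ d) K) = (\<Sum>s\<in>K. piece_number d (card s) (Suc p))"
proof -
  have "simplices p ((sd ^^ d) K) = (\<Union>s\<in>K. {\<sigma> \<in> pieces d K s. card \<sigma> = Suc p})"
    unfolding simplices_def pieces_cover[OF K] by auto
  then have "face_number p ((sd ^^ d) K) = (\<Sum>s\<in>K. card {\<sigma> \<in> pieces d K s. card \<sigma> = Suc p})"
    unfolding face_number_def using fin finite_pieces[OF K] pieces_disjoint
    by (simp only:) (rule card_UN_disjoint, simp, simp, blast)
  then show ?thesis by (simp add: card_pieces[OF K])
qed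

text \<open>In a finite complex of dimension \<open>n\<close> only the simplices with
  \<open>n + 1\<close> vertices contribute in the limit, each with \<open>q\<close>; division by
  their number gives \<open>q\<close> for every complex. This identifies \<open>q\<close> with the
  value described by \<open>limit_face_density\<close>.\<close>

lemma limit_piece_density:
  assumes "p \<le> n" "k \<le> Suc n"
  shows "(\<lambda>d. real (piece_number d k (Suc p)) / fact (Suc n) ^ d) \<longlonglongrightarrow> (if k = Suc n then limit_face_density p n else 0)"
proof -
  let ?N = "fact (Suc n) :: real"
  obtain q where q: "\<And>k. k \<le> Suc n \<Longrightarrow>
      (\<lambda>d. real (piece_number d k (Suc p)) / ?N ^ d) \<longlonglongrightarrow> (if k = Suc n then q else 0)"
    using piece_density_exists[of "Suc p" n] assms by auto
  have lim: "(\<lambda>d. real (face_number p ((sd ^^ d) L)) / (?N ^ d * real (face_number n L))) \<longlonglongrightarrow> q"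
    if L: "geometric_complex L" "finite L" "has_dimension L n" for L :: "(nat \<Rightarrow>\<^sub>0 real) set set"
  proof -
    have dim: "card s \<le> Suc n" if "s \<in> L" for s using L(3) that by (auto simp: has_dimension_def)
    obtain s0 where "s0 \<in> simplices n L" using L(3) by (auto simp: has_dimension_def simplices_def)
    moreover have "finite (simplices n L)" using L(2) by (simp add: simplices_def)
    ultimately have pos: "0 < face_number n L" by (auto simp: face_number_def card_gt_0_iff)
    have "(\<lambda>d. (\<Sum>s\<in>L. real (piece_number d (card s) (Suc p)) / ?N ^ d) / real (face_number n L))
        \<longlonglongrightarrow> (\<Sum>s\<in>L. if card s = Suc n then q else 0) / real (face_number n L)"
      using pos by (intro tendsto_intros q dim) auto
    moreover have "(\<Sum>s\<in>L. if card s = Suc n then q else 0) = real (face_number n L) * q"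
      using L(2) by (subst sum.inter_filter[symmetric]) (auto simp: face_number_def simplices_def)
    ultimately show ?thesis
      using pos face_number_funpow_sd[OF geometric_bary_complex[OF L(1)] L(2)]
      by (simp add: sum_divide_distrib del: fact_Suc)
  qed
  have "limit_face_density p n = q" unfolding limit_face_density_def
  proof (rule the_equality)
    show "\<forall>L::(nat \<Rightarrow>\<^sub>0 real) set set. geometric_complex L \<and> finite L \<and> has_dimension L n \<longrightarrow>
      (\<lambda>d. real (face_number p ((sd ^^ d) L)) / (fact (n + 1) ^ d * real (face_number n L))) \<longlonglongrightarrow> q"
      using lim by (simp only: Suc_eq_plus1[symmetric]) blast
    fix c assume "\<forall>L::(nat \<Rightarrow>\<^sub>0 real) set set. geometric_complex L \<and> finite L \<and> has_dimension L n \<longrightarrow>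
      (\<lambda>d. real (face_number p ((sd ^^ d) L)) / (fact (n + 1) ^ d * real (face_number n L))) \<longlonglongrightarrow> c"
    \<comment> \<open>Uniqueness requires at least one admissible complex; the standard simplex
      serves as one.\<close>
    from this[THEN spec, of "std_simplex n"]
    have "(\<lambda>d. real (face_number p ((sd ^^ d) (std_simplex n))) / (?N ^ d * real (face_number n (std_simplex n)))) \<longlonglongrightarrow> c"
      using geometric_std_simplex finite_std_simplex dimension_std_simplex by (simp only: Suc_eq_plus1[symmetric])
    then show "c = q"
      using lim[OF geometric_std_simplex finite_std_simplex dimension_std_simplex] LIMSEQ_unique by blast
  qed
  then show ?thesis using q[OF assms(2)] by (simp only:)
qed

subsection \<open>Lebesgue measure in barycentric coordinates\<close>

text \<open>The dependent last coordinate is kept as well, so that all permutations of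
  \<open>{..n}\<close> act by precomposition on an equal footing.\<close>

definition simplex_coords :: "nat \<Rightarrow> (nat \<Rightarrow> real) \<Rightarrow> nat \<Rightarrow> real" where
  "simplex_coords n x = (\<lambda>i. if i < n then x i else if i = n then 1 - (\<Sum>j<n. x j) else 0)"

text \<open>The normalised volume lives on coordinate functions rather than on points, so that one
  measure serves every simplex through its affine parametrisation.\<close>

definition bary_measure :: "nat \<Rightarrow> (nat \<Rightarrow> real) measure" where
  "bary_measure n = distr (uniform_measure (Pi\<^sub>M {..<n} (\<lambda>_. lborel)) (corner n)) borel (simplex_coords n)"

abbreviation cube_measure :: "nat \<Rightarrow> (nat \<Rightarrow> real) measure" where
  "cube_measure n \<equiv> Pi\<^sub>M {..<n} (\<lambda>_. lborel)"

section \<open>Shears and coordinate permutations of Lebesgue measure\<close>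

lemma measurable_PiM_lborel_component:
  "i \<in> I \<Longrightarrow> (\<lambda>x. x i) \<in> borel_measurable (Pi\<^sub>M I (\<lambda>_. lborel))"
  using measurable_component_singleton[of i I "\<lambda>_. lborel"] by simp

lemma measurable_simplex_coords [measurable]: "simplex_coords n \<in> borel_measurable (cube_measure n)"
proof (rule measurable_coordinatewise_then_product)
  fix i show "(\<lambda>x. simplex_coords n x i) \<in> borel_measurable (cube_measure n)"
    by (cases "i < n"; cases "i = n") (auto simp: simplex_coords_def intro!: borel_measurable_diff borel_measurable_sum)
qed

lemma measurable_coord [measurable]: "(\<lambda>y. y i) \<in> borel_measurable (borel :: (nat \<Rightarrow> real) measure)"
  by (intro borel_measurable_continuous_onI continuous_on_product_coordinates)

lemma measurable_precomp [measurable]: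
  fixes \<pi> :: "nat \<Rightarrow> nat"
  shows "(\<lambda>y. y \<circ> \<pi>) \<in> borel_measurable (borel :: (nat \<Rightarrow> real) measure)"
  by (rule measurable_coordinatewise_then_product) (simp add: measurable_coord)

text \<open>Fubini isolates coordinate \<open>i\<close>. As \<open>h\<close> does not depend on it,
  the inner integral is a one-dimensional affine substitution with slope \<open>c\<close>.\<close>

lemma nn_integral_coordinate_shear:
  fixes g :: "('i \<Rightarrow> real) \<Rightarrow> ennreal"
  assumes I: "finite I" "i \<in> I" and c: "c \<noteq> 0"
    and g [measurable]: "g \<in> borel_measurable (Pi\<^sub>M I (\<lambda>_. lborel))"
    and h [measurable]: "h \<in> borel_measurable (Pi\<^sub>M I (\<lambda>_. lborel))" and hi: "\<And>x t. h (x(i := t)) = h x"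
  shows "(\<integral>\<^sup>+x. g (x(i := h x + c * x i)) \<partial>Pi\<^sub>M I (\<lambda>_. lborel)) = ennreal (1 / \<bar>c\<bar>) * (\<integral>\<^sup>+x. g x \<partial>Pi\<^sub>M I (\<lambda>_. lborel))"
proof -
  interpret product_sigma_finite "\<lambda>_::'i. lborel :: real measure" by standard
  define J where "J = I - {i}"
  have J: "finite J" "i \<notin> J" "I = insert i J" using I by (auto simp: J_def)
  have "(\<lambda>x. x(i := h x + c * x i)) \<in> measurable (Pi\<^sub>M I (\<lambda>_. lborel)) (Pi\<^sub>M I (\<lambda>_. lborel))"
  proof (rule measurable_fun_upd[where J = I])
    show "(\<lambda>x. h x + c * x i) \<in> measurable (Pi\<^sub>M I (\<lambda>_. lborel)) lborel"
      using borel_measurable_add[OF h borel_measurable_times[OF borel_measurable_const measurable_PiM_lborel_component[OF I(2)]]]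
      by simp
  qed (use I in auto)
  then have [measurable]: "(\<lambda>x. g (x(i := h x + c * x i))) \<in> borel_measurable (Pi\<^sub>M I (\<lambda>_. lborel))"
    by measurable
  have "(\<integral>\<^sup>+x. g (x(i := h x + c * x i)) \<partial>Pi\<^sub>M I (\<lambda>_. lborel)) =
      (\<integral>\<^sup>+x. (\<integral>\<^sup>+t. g (x(i := h x + c * t)) \<partial>lborel) \<partial>Pi\<^sub>M J (\<lambda>_. lborel))"
    unfolding J(3) by (subst product_nn_integral_insert) (use J in \<open>auto simp: hi J(3)[symmetric]\<close>)
  also have "\<dots> = (\<integral>\<^sup>+x. ennreal (1 / \<bar>c\<bar>) * (\<integral>\<^sup>+t. g (x(i := t)) \<partial>lborel) \<partial>Pi\<^sub>M J (\<lambda>_. lborel))"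
  proof (rule nn_integral_cong)
    fix x assume x: "x \<in> space (Pi\<^sub>M J (\<lambda>_. lborel :: real measure))"
    have "(\<lambda>t. g (x(i := t))) \<in> borel_measurable lborel"
      using measurable_comp[OF measurable_component_update[OF x J(2)] g[unfolded J(3)]] by (simp add: comp_def)
    then have "(\<integral>\<^sup>+t. g (x(i := t)) \<partial>lborel) = ennreal \<bar>c\<bar> * (\<integral>\<^sup>+t. g (x(i := h x + c * t)) \<partial>lborel)"
      using nn_integral_real_affine[of "\<lambda>t. g (x(i := t))" c "h x"] c by simp
    then have "ennreal (1 / \<bar>c\<bar>) * (\<integral>\<^sup>+t. g (x(i := t)) \<partial>lborel) =
        (ennreal (1 / \<bar>c\<bar>) * ennreal \<bar>c\<bar>) * (\<integral>\<^sup>+t. g (x(i := h x + c * t)) \<partial>lborel)"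
      by (simp add: mult.assoc)
    also have "ennreal (1 / \<bar>c\<bar>) * ennreal \<bar>c\<bar> = 1" using c by (simp flip: ennreal_mult)
    finally show "(\<integral>\<^sup>+t. g (x(i := h x + c * t)) \<partial>lborel) = ennreal (1 / \<bar>c\<bar>) * (\<integral>\<^sup>+t. g (x(i := t)) \<partial>lborel)"
      by (simp only: mult_1)
  qed
  also have "\<dots> = ennreal (1 / \<bar>c\<bar>) * (\<integral>\<^sup>+x. (\<integral>\<^sup>+t. g (x(i := t)) \<partial>lborel) \<partial>Pi\<^sub>M J (\<lambda>_. lborel))"
  proof (rule nn_integral_cmult)
    have "(\<lambda>(x, t). g (x(i := t))) \<in> borel_measurable (Pi\<^sub>M J (\<lambda>_. lborel) \<Otimes>\<^sub>M lborel)"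
      using measurable_comp[OF measurable_add_dim g[unfolded J(3)]] by (simp add: comp_def case_prod_beta)
    then show "(\<lambda>x. \<integral>\<^sup>+t. g (x(i := t)) \<partial>lborel) \<in> borel_measurable (Pi\<^sub>M J (\<lambda>_. lborel))"
      using lborel.borel_measurable_nn_integral_fst[of "\<lambda>(x, t). g (x(i := t))"] by simp
  qed
  also have "(\<integral>\<^sup>+x. (\<integral>\<^sup>+t. g (x(i := t)) \<partial>lborel) \<partial>Pi\<^sub>M J (\<lambda>_. lborel)) = (\<integral>\<^sup>+x. g x \<partial>Pi\<^sub>M I (\<lambda>_. lborel))"
    unfolding J(3) by (subst product_nn_integral_insert) (use J g in auto)
  finally show ?thesis .
qed

text \<open>Exchanging coordinate \<open>j\<close> with the dependent last one replaces it by 1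
  minus the sum of all independent coordinates, a shear with slope -1 and hence with factor
  1.\<close>

lemma nn_integral_coords_transpose_last:
  assumes [measurable]: "H \<in> borel_measurable borel" and j: "j < n"
  shows "(\<integral>\<^sup>+x. H (simplex_coords n x \<circ> Transposition.transpose j n) \<partial>cube_measure n) = (\<integral>\<^sup>+x. H (simplex_coords n x) \<partial>cube_measure n)"
proof -
  let ?h = "\<lambda>x. 1 - (\<Sum>i\<in>{..<n} - {j}. x i)"
  have split: "(\<Sum>i<n. x i) = x j + (\<Sum>i\<in>{..<n} - {j}. x i)" for x :: "nat \<Rightarrow> real"
    using j by (intro sum.remove) auto
  have "simplex_coords n x \<circ> Transposition.transpose j n = simplex_coords n (x(j := ?h x + (-1) * x j))" for x
    using j by (auto simp: fun_eq_iff simplex_coords_def Transposition.transpose_def split)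
  moreover have "(\<integral>\<^sup>+x. H (simplex_coords n (x(j := ?h x + (-1) * x j))) \<partial>cube_measure n) =
      ennreal (1 / \<bar>-1\<bar>) * (\<integral>\<^sup>+x. H (simplex_coords n x) \<partial>cube_measure n)"
    by (rule nn_integral_coordinate_shear)
      (use j in \<open>auto intro!: sum.cong borel_measurable_diff borel_measurable_sum measurable_PiM_lborel_component\<close>)
  ultimately show ?thesis by simp
qed

text \<open>The invariant permutations are closed under composition and contain the transpositions
  with \<open>n\<close>; any other transposition is the conjugate (a n)(b n)(a n) of these, and
  transpositions generate.\<close>

lemma nn_integral_coords_permute:
  assumes H: "H \<in> borel_measurable borel" and "\<pi> permutes {..n}"
  shows "(\<integral>\<^sup>+x. H (simplex_coords n x \<circ> \<pi>) \<partial>cube_measure n) = (\<integral>\<^sup>+x. H (simplex_coords n x) \<partial>cube_measure n)"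
proof -
  define inv where "inv \<pi> \<longleftrightarrow> (\<forall>H\<in>borel_measurable borel. (\<integral>\<^sup>+x. H (simplex_coords n x \<circ> \<pi>) \<partial>cube_measure n)
      = (\<integral>\<^sup>+x. H (simplex_coords n x) \<partial>cube_measure n))" for \<pi>
  have comp: "inv (\<pi> \<circ> \<rho>)" if "inv \<pi>" "inv \<rho>" for \<pi> \<rho>
    unfolding inv_def
  proof
    fix H :: "(nat \<Rightarrow> real) \<Rightarrow> ennreal" assume H [measurable]: "H \<in> borel_measurable borel"
    have "(\<integral>\<^sup>+x. H (simplex_coords n x \<circ> (\<pi> \<circ> \<rho>)) \<partial>cube_measure n) = (\<integral>\<^sup>+x. (\<lambda>y. H (y \<circ> \<rho>)) (simplex_coords n x \<circ> \<pi>) \<partial>cube_measure n)"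
      by (simp add: comp_assoc)
    also have "\<dots> = (\<integral>\<^sup>+x. H (simplex_coords n x \<circ> \<rho>) \<partial>cube_measure n)"
      using that(1) unfolding inv_def by (rule bspec) measurable
    also have "\<dots> = (\<integral>\<^sup>+x. H (simplex_coords n x) \<partial>cube_measure n)" using that(2) H unfolding inv_def by blast
    finally show "(\<integral>\<^sup>+x. H (simplex_coords n x \<circ> (\<pi> \<circ> \<rho>)) \<partial>cube_measure n) = (\<integral>\<^sup>+x. H (simplex_coords n x) \<partial>cube_measure n)" .
  qed
  have inv_id: "inv id" by (simp add: inv_def)
  have last: "inv (Transposition.transpose j n)" if "j \<le> n" for j
    using nn_integral_coords_transpose_last[of _ j n] that inv_id by (cases "j = n") (auto simp: inv_def)
  have swap_inv: "inv (Transposition.transpose a b)" if "a \<le> n" "b \<le> n" for a b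
  proof (cases "a = n \<or> b = n \<or> a = b")
    case True then show ?thesis using last that inv_id by (auto simp: Transposition.transpose_commute)
  next
    case False
    then have "Transposition.transpose a b = Transposition.transpose a n \<circ> (Transposition.transpose b n \<circ> Transposition.transpose a n)"
      by (auto simp: fun_eq_iff Transposition.transpose_def)
    then show ?thesis using comp last that by simp
  qed
  have "inv \<pi>" 
    using assms(2) finite_atMost
  proof (induction rule: permutes_induct)
    case (swap a b p)
    show ?case by (rule comp[OF swap_inv]) (use swap in auto)
  qed (rule inv_id)
  then show ?thesis using H unfolding inv_def by blast
qed


text \<open>By Fubini in the direction of \<open>i\<close>, the equation leaves at most one value of
  that coordinate once the others are fixed.\<close>

lemma AE_coords_distinct:
  assumes "i < n" "j \<le> n" "i \<noteq> j"
  shows "AE x in cube_measure n. simplex_coords n x i \<noteq> simplex_coords n x j"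
proof -
  interpret product_sigma_finite "\<lambda>_::nat. lborel :: real measure" by standard
  define J where "J = {..<n} - {i}"
  have J: "finite J" "i \<notin> J" "{..<n} = insert i J" using assms by (auto simp: J_def)
  let ?A = "{x \<in> space (cube_measure n). simplex_coords n x i = simplex_coords n x j}"
  have comp [measurable]: "(\<lambda>x. simplex_coords n x k) \<in> borel_measurable (cube_measure n)" for k
    using measurable_comp[OF measurable_simplex_coords measurable_coord] by (simp add: comp_def)
  have A [measurable]: "?A \<in> sets (cube_measure n)" by measurable
  have "emeasure (cube_measure n) ?A = (\<integral>\<^sup>+x. (\<integral>\<^sup>+t. indicator ?A (x(i := t)) \<partial>lborel) \<partial>Pi\<^sub>M J (\<lambda>_. lborel))"
    using A unfolding nn_integral_indicator[OF A, symmetric] unfolding J(3)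
    by (subst product_nn_integral_insert) (use J in auto)
  also have "\<dots> = (\<integral>\<^sup>+x. 0 \<partial>Pi\<^sub>M J (\<lambda>_. lborel :: real measure))"
  proof (rule nn_integral_cong)
    fix x assume "x \<in> space (Pi\<^sub>M J (\<lambda>_. lborel :: real measure))"
    \<comment> \<open>For \<open>j = n\<close> the equation reads t = 1 - t - (sum over
      \<open>J\<close>), whence the division by 2.\<close>
    define c where "c = (if j < n then x j else (1 - (\<Sum>k\<in>J. x k)) / 2)"
    have sum: "sum (x(i := t)) {..<n} = t + (\<Sum>k\<in>J. x k)" for t
      unfolding J(3) using J by (simp add: sum.insert) (intro sum.cong; auto)
    have "t = c" if "x(i := t) \<in> ?A" for t
      using that assms sum[of t] by (auto simp: simplex_coords_def c_def split: if_splits)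
    then have "(\<integral>\<^sup>+t. indicator ?A (x(i := t)) \<partial>lborel) \<le> (\<integral>\<^sup>+t. indicator {c} t \<partial>lborel)"
      by (intro nn_integral_mono) (auto simp: indicator_def)
    then show "(\<integral>\<^sup>+t. indicator ?A (x(i := t)) \<partial>lborel) = 0" by simp
  qed
  finally show ?thesis by (subst AE_iff_measurable[OF A]) auto
qed

section \<open>The sorted sector and the triangular change of coordinates\<close>

definition nonneg_coords :: "nat \<Rightarrow> (nat \<Rightarrow> real) set" where
  "nonneg_coords n = {y. \<forall>i\<le>n. 0 \<le> y i}"

text \<open>Weak inequalities make the sector closed; its permuted copies overlap only where
  coordinates coincide, a null set by \<open>AE_coords_distinct\<close>.\<close>

definition sorted_coords :: "nat \<Rightarrow> (nat \<Rightarrow> real) set" where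
  "sorted_coords n = {y. 0 \<le> y 0 \<and> (\<forall>i<n. y i \<le> y (Suc i))}"

lemma sorted_coords_mono: "y \<in> sorted_coords n \<Longrightarrow> i \<le> j \<Longrightarrow> j \<le> n \<Longrightarrow> y i \<le> y j"
proof (induction j)
  case (Suc j)
  show ?case
  proof (cases "i = Suc j")
    case False
    then have "y i \<le> y j" using Suc by simp
    also have "\<dots> \<le> y (Suc j)" using Suc.prems by (auto simp: sorted_coords_def)
    finally show ?thesis .
  qed simp
qed simp

lemma sorted_coords_nonneg: "sorted_coords n \<subseteq> nonneg_coords n"
proof
  fix y assume y: "y \<in> sorted_coords n"
  then have "0 \<le> y 0" by (simp add: sorted_coords_def)
  then show "y \<in> nonneg_coords n" using sorted_coords_mono[OF y, of 0] by (force simp: nonneg_coords_def)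
qed

lemma borel_nonneg_coords [measurable]: "nonneg_coords n \<in> sets borel"
proof -
  have "{y \<in> space borel. \<forall>i\<in>{..n}. 0 \<le> y i} \<in> sets (borel :: (nat \<Rightarrow> real) measure)" by measurable
  then show ?thesis by (simp add: nonneg_coords_def)
qed

lemma borel_sorted_coords [measurable]: "sorted_coords n \<in> sets borel"
proof -
  have "sorted_coords n = {y. 0 \<le> y 0} \<inter> (\<Inter>i\<in>{..<n}. {y. y i \<le> y (Suc i)})"
    by (auto simp: sorted_coords_def)
  moreover have "closed \<dots>"
    by (intro closed_Int closed_INT ballI closed_Collect_le continuous_on_const continuous_on_product_coordinates)
  ultimately show ?thesis by (simp add: borel_closed)
qed

text \<open>Distinct values have a single increasing listing, and their positions give the
  permutation. The cardinality form fits the later sum of indicators over all permutations.\<close>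

lemma sorting_permutation_unique:
  fixes y :: "nat \<Rightarrow> real"
  assumes inj: "inj_on y {..n}" and pos: "y \<in> nonneg_coords n"
  shows "card {\<pi>. \<pi> permutes {..n} \<and> y \<circ> \<pi> \<in> sorted_coords n} = 1"
proof -
  let ?ys = "sorted_list_of_set (y ` {..n})"
  have len: "length ?ys = Suc n" using inj by (simp add: card_image)
  have set: "set ?ys = y ` {..n}" by simp
  define \<pi> where "\<pi> i = (if i \<le> n then inv_into {..n} y (?ys ! i) else i)" for i
  have y\<pi>: "y (\<pi> i) = ?ys ! i" "\<pi> i \<le> n" if "i \<le> n" for i
  proof -
    have "?ys ! i \<in> y ` {..n}" using that len set nth_mem[of i ?ys] by simp
    then show "y (\<pi> i) = ?ys ! i" "\<pi> i \<le> n"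
      using that f_inv_into_f[of "?ys ! i" y "{..n}"] inv_into_into[of "?ys ! i" y "{..n}"] by (auto simp: \<pi>_def)
  qed
  have "inj_on \<pi> {..n}"
  proof (rule inj_onI)
    fix i j assume ij: "i \<in> {..n}" "j \<in> {..n}" "\<pi> i = \<pi> j"
    then have "?ys ! i = ?ys ! j" using y\<pi>(1)[of i] y\<pi>(1)[of j] by simp
    then show "i = j" using ij len by (simp add: nth_eq_iff_index_eq)
  qed
  moreover have "\<pi> ` {..n} \<subseteq> {..n}" using y\<pi> by auto
  ultimately have "bij_betw \<pi> {..n} {..n}" by (simp add: bij_betw_def endo_inj_surj)
  then have perm: "\<pi> permutes {..n}" by (rule bij_imp_permutes) (simp add: \<pi>_def)
  have sorted: "y \<circ> \<pi> \<in> sorted_coords n"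
  proof -
    have "0 \<le> y (\<pi> 0)" using pos y\<pi>(2)[of 0] by (simp add: nonneg_coords_def)
    moreover have "y (\<pi> i) \<le> y (\<pi> (Suc i))" if "i < n" for i
      using y\<pi>(1)[of i] y\<pi>(1)[of "Suc i"] that len sorted_nth_mono[of ?ys i "Suc i"] by simp
    ultimately show ?thesis by (simp add: sorted_coords_def)
  qed
  have unique: "\<rho> = \<pi>" if \<rho>: "\<rho> permutes {..n}" "y \<circ> \<rho> \<in> sorted_coords n" for \<rho>
  proof -
    let ?l = "map (y \<circ> \<rho>) [0..<Suc n]"
    have set\<rho>: "set ?l = y ` {..n}"
    proof -
      have "set ?l = y ` \<rho> ` {..n}"
        by (simp add: image_image atLeast0AtMost[symmetric] atLeastLessThanSuc_atLeastAtMost del: upt_Suc)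
      then show ?thesis using permutes_image[OF \<rho>(1)] by simp
    qed
    have "sorted ?l" using sorted_coords_mono[OF \<rho>(2)] by (auto simp: sorted_iff_nth_mono simp del: upt_Suc)
    moreover have "distinct ?l"
      using set\<rho> len inj by (intro card_distinct) (simp add: card_image del: upt_Suc)
    ultimately have l: "?l = ?ys" using set\<rho> by (metis sorted_list_of_set.idem_if_sorted_distinct)
    show ?thesis
    proof
      fix i show "\<rho> i = \<pi> i"
      proof (cases "i \<le> n")
        case True
        then have "y (\<rho> i) = y (\<pi> i)" using l y\<pi>(1)[OF True] by (metis (no_types, lifting) comp_apply add_0 diff_zero le_imp_less_Suc length_upt nth_map nth_upt)
        moreover have "\<rho> i \<in> {..n}" "\<pi> i \<in> {..n}" using True permutes_in_image[OF \<rho>(1), of i] y\<pi>(2) by auto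
        ultimately show ?thesis using inj by (meson inj_onD)
      next
        case False
        then show ?thesis using \<rho>(1) by (auto simp: \<pi>_def permutes_def)
      qed
    qed
  qed
  have "{\<pi>. \<pi> permutes {..n} \<and> y \<circ> \<pi> \<in> sorted_coords n} = {\<pi>}" using perm sorted unique by blast
  then show ?thesis by simp
qed

text \<open>Coordinates, with respect to the big simplex, of the point with coordinates \<open>y\<close> in the piece whose
  \<open>k\<close>-th vertex is the barycenter of the \<open>n + 1 - k\<close> vertices of index at least \<open>k\<close>. They increase with the
  index, so that this piece is the sorted part of the simplex.\<close>

definition subdiv_coords :: "nat \<Rightarrow> (nat \<Rightarrow> real) \<Rightarrow> nat \<Rightarrow> real" where
  "subdiv_coords n y = (\<lambda>j. if j \<le> n then \<Sum>k\<le>j. y k / real (Suc n - k) else 0)"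

lemma measurable_subdiv_coords [measurable]: "subdiv_coords n \<in> borel_measurable borel"
proof (rule measurable_coordinatewise_then_product)
  fix i show "(\<lambda>x. subdiv_coords n x i) \<in> borel_measurable borel"
    by (cases "i \<le> n") (auto simp: subdiv_coords_def intro!: borel_measurable_sum borel_measurable_divide)
qed

text \<open>The consecutive differences of \<open>subdiv_coords n y\<close> are positive multiples
  of the \<open>y (Suc i)\<close>, and its first entry is a positive multiple of
  \<open>y 0\<close>.\<close>

lemma subdiv_coords_sorted_coords: "subdiv_coords n y \<in> sorted_coords n \<longleftrightarrow> y \<in> nonneg_coords n"
proof -
  have "subdiv_coords n y 0 = y 0 / real (Suc n)" by (simp add: subdiv_coords_def)
  moreover have "subdiv_coords n y (Suc i) - subdiv_coords n y i = y (Suc i) / real (n - i)" if "i < n" for i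
    using that by (simp add: subdiv_coords_def)
  then have "subdiv_coords n y i \<le> subdiv_coords n y (Suc i) \<longleftrightarrow> 0 \<le> y (Suc i)" if "i < n" for i
    using that by (metis diff_ge_0_iff_ge divide_nonneg_pos of_nat_0_less_iff zero_le_divide_iff zero_less_diff not_le of_nat_0_le_iff less_le_not_le)
  ultimately have "subdiv_coords n y \<in> sorted_coords n \<longleftrightarrow> 0 \<le> y 0 \<and> (\<forall>i<n. 0 \<le> y (Suc i))"
    by (auto simp: sorted_coords_def zero_le_divide_iff)
  also have "\<dots> \<longleftrightarrow> y \<in> nonneg_coords n"
    unfolding nonneg_coords_def by (auto simp: less_Suc_eq_le) (metis Suc_le_eq not0_implies_Suc)
  finally show ?thesis .
qed

text \<open>The share \<open>y k / (n + 1 - k)\<close> is received by exactly the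
  \<open>n + 1 - k\<close> indices from \<open>k\<close> to \<open>n\<close>.\<close>

lemma sum_subdiv_coords: "(\<Sum>j\<le>n. subdiv_coords n y j) = (\<Sum>k\<le>n. y k)"
proof -
  have "(\<Sum>j\<le>n. subdiv_coords n y j) = (\<Sum>j\<le>n. \<Sum>k\<in>{k. k \<in> {..n} \<and> k \<le> j}. y k / real (Suc n - k))"
    by (intro sum.cong) (auto simp: subdiv_coords_def intro!: sum.cong)
  also have "\<dots> = (\<Sum>k\<le>n. \<Sum>j\<in>{j. j \<in> {..n} \<and> k \<le> j}. y k / real (Suc n - k))"
    by (rule sum.swap_restrict) auto
  also have "\<dots> = (\<Sum>k\<le>n. y k)"
  proof (intro sum.cong refl)
    fix k assume k: "k \<in> {..n}"
    have "{j. j \<in> {..n} \<and> k \<le> j} = {k..n}" by auto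
    then show "(\<Sum>j\<in>{j. j \<in> {..n} \<and> k \<le> j}. y k / real (Suc n - k)) = y k" using k by simp
  qed
  finally show ?thesis .
qed

lemma sum_simplex_coords: "(\<Sum>i\<le>n. simplex_coords n x i) = 1"
proof -
  have "(\<Sum>i\<le>n. simplex_coords n x i) = (\<Sum>i<n. simplex_coords n x i) + simplex_coords n x n"
    by (metis lessThan_Suc_atMost sum.lessThan_Suc)
  then show ?thesis by (simp add: simplex_coords_def)
qed

text \<open>On the \<open>n\<close> independent coordinates the map is linear and triangular with
  diagonal entries 1/(n+1-k), hence of determinant 1/(n+1)!. It is written as a product of
  \<open>n\<close> shears.\<close>

lemma nn_integral_subdiv_coords:
  assumes H [measurable]: "H \<in> borel_measurable borel"
  shows "(\<integral>\<^sup>+x. H (subdiv_coords n (simplex_coords n x)) \<partial>cube_measure n) =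
    ennreal (fact (Suc n)) * (\<integral>\<^sup>+x. H (simplex_coords n x) \<partial>cube_measure n)"
proof -
  \<comment> \<open>After \<open>m\<close> shears the top \<open>m\<close> independent coordinates
    have been replaced. Working downwards lets each shear read lower coordinates that are still the
    original ones.\<close>
  define T where "T m x = (\<lambda>i. if n - m \<le> i \<and> i < n then \<Sum>k\<le>i. x k / real (Suc n - k) else x i)"
    for m and x :: "nat \<Rightarrow> real"
  have T: "(\<integral>\<^sup>+x. g (T m x) \<partial>cube_measure n) = ennreal (fact (Suc m)) * (\<integral>\<^sup>+x. g x \<partial>cube_measure n)"
    if "m \<le> n" "g \<in> borel_measurable (cube_measure n)" for m g
    using that
  proof (induction m arbitrary: g)
    case 0
    have "T 0 x = x" for x by (auto simp: T_def)
    then show ?case by simp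
  next
    case (Suc m)
    note [measurable] = Suc.prems(2)
    \<comment> \<open>The next coordinate to replace has denominator \<open>Suc n - j\<close>, which
      is \<open>m + 2\<close>, the next factor of the factorial.\<close>
    define j where "j = n - Suc m"
    have j: "j < n" "n - m = Suc j" "Suc n - j = Suc (Suc m)" using Suc.prems by (auto simp: j_def)
    let ?h = "\<lambda>x. \<Sum>k<j. x k / real (Suc n - k)" and ?c = "1 / real (Suc n - j)"
    let ?U = "\<lambda>x. x(j := ?h x + ?c * x j)"
    have TU: "T (Suc m) x = ?U (T m x)" for x
    proof
      fix i
      have h: "?h (T m x) = ?h x" "T m x j = x j" using j by (auto simp: T_def intro!: sum.cong)
      have "(\<Sum>k\<le>j. x k / real (Suc n - k)) = ?h x + ?c * x j"
        by (metis (no_types, lifting) lessThan_Suc_atMost sum.lessThan_Suc times_divide_eq_left mult_1)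
      then have "?U (T m x) j = T (Suc m) x j" using h j by (simp add: T_def j_def)
      moreover have "?U (T m x) i = T (Suc m) x i" if "i \<noteq> j"
        using that j Suc.prems by (auto simp: T_def j_def)
      ultimately show "T (Suc m) x i = ?U (T m x) i" by (cases "i = j") auto
    qed
    have hm [measurable]: "?h \<in> borel_measurable (cube_measure n)"
      using j by (intro borel_measurable_sum borel_measurable_divide measurable_PiM_lborel_component) auto
    have "?U \<in> measurable (cube_measure n) (cube_measure n)"
    proof (rule measurable_fun_upd[where J = "{..<n}"])
      show "(\<lambda>x. ?h x + ?c * x j) \<in> measurable (cube_measure n) lborel"
        using borel_measurable_add[OF hm borel_measurable_times[OF borel_measurable_const measurable_PiM_lborel_component[of j "{..<n}"]], of ?c] j
        by simp
    qed (use j in auto)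
    then have gU: "(\<lambda>x. g (?U x)) \<in> borel_measurable (cube_measure n)" by measurable
    have "(\<integral>\<^sup>+x. g (T (Suc m) x) \<partial>cube_measure n) = (\<integral>\<^sup>+x. g (?U (T m x)) \<partial>cube_measure n)" unfolding TU ..
    also have "\<dots> = ennreal (fact (Suc m)) * (\<integral>\<^sup>+x. g (?U x) \<partial>cube_measure n)"
      by (rule Suc.IH[OF Suc_leD[OF Suc.prems(1)] gU])
    also have "(\<integral>\<^sup>+x. g (?U x) \<partial>cube_measure n) = ennreal (1 / \<bar>?c\<bar>) * (\<integral>\<^sup>+x. g x \<partial>cube_measure n)"
      by (rule nn_integral_coordinate_shear) (use j hm in \<open>auto intro!: sum.cong\<close>)
    also have "ennreal (fact (Suc m)) * (ennreal (1 / \<bar>?c\<bar>) * (\<integral>\<^sup>+x. g x \<partial>cube_measure n)) =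
        ennreal (fact (Suc m) * (1 / \<bar>?c\<bar>)) * (\<integral>\<^sup>+x. g x \<partial>cube_measure n)"
      by (simp only: mult.assoc[symmetric] ennreal_mult fact_ge_zero zero_le_divide_1_iff abs_ge_zero)
    also have "fact (Suc m) * (1 / \<bar>?c\<bar>) = (fact (Suc (Suc m)) :: real)"
      unfolding j(3) by (simp add: algebra_simps)
    finally show ?case .
  qed
  have coords: "subdiv_coords n (simplex_coords n x) = simplex_coords n (T n x)" for x
  proof
    fix i
    have lt: "subdiv_coords n (simplex_coords n x) i = T n x i" if "i < n" for i
      using that by (auto simp: subdiv_coords_def T_def simplex_coords_def intro!: sum.cong)
    \<comment> \<open>The dependent coordinate follows from the others because the total is
      preserved.\<close>
    have "(\<Sum>i\<le>n. subdiv_coords n (simplex_coords n x) i) = 1"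
      by (simp add: sum_subdiv_coords sum_simplex_coords)
    then have "subdiv_coords n (simplex_coords n x) n = 1 - (\<Sum>i<n. subdiv_coords n (simplex_coords n x) i)"
      by (metis add_diff_cancel_left' lessThan_Suc_atMost sum.lessThan_Suc)
    then have "subdiv_coords n (simplex_coords n x) n = 1 - (\<Sum>i<n. T n x i)" using lt by simp
    then show "subdiv_coords n (simplex_coords n x) i = simplex_coords n (T n x) i"
      using lt by (auto simp: simplex_coords_def subdiv_coords_def)
  qed
  show ?thesis unfolding coords by (rule T[of n "\<lambda>x. H (simplex_coords n x)"]) auto
qed

section \<open>The normalised measure on barycentric coordinates\<close>

lemma corner_eq_coords: "corner n = {x \<in> space (cube_measure n). simplex_coords n x \<in> nonneg_coords n}"
  by (auto simp: corner_def nonneg_coords_def simplex_coords_def space_PiM)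

lemma corner_measurable [measurable]: "corner n \<in> sets (cube_measure n)"
proof -
  have "simplex_coords n -` nonneg_coords n \<inter> space (cube_measure n) \<in> sets (cube_measure n)" by measurable
  moreover have "corner n = simplex_coords n -` nonneg_coords n \<inter> space (cube_measure n)" unfolding corner_eq_coords by auto
  ultimately show ?thesis by simp
qed

lemma emeasure_corner: "emeasure (cube_measure n) (corner n) = ennreal (1 / fact n)"
proof -
  have "corner n = {x. (\<forall>i\<in>{..<n}. 0 \<le> x i) \<and> sum x {..<n} \<le> 1} \<inter> space (cube_measure n)"
    by (auto simp: corner_def space_PiM)
  then show ?thesis using emeasure_std_simplex_aux[of "{..<n}" 1] by simp
qed

lemma sets_bary_measure [measurable_cong, simp]: "sets (bary_measure n) = sets borel"
  by (simp add: bary_measure_def)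

lemma space_bary_measure [simp]: "space (bary_measure n) = UNIV"
  by (simp add: bary_measure_def)

text \<open>The restriction to the corner becomes an indicator of the coordinates themselves, so
  that substitutions valid on all of \<open>cube_measure n\<close> apply to the normalised measure.
  The denominator is the volume of the corner.\<close>

lemma nn_integral_bary_measure:
  assumes [measurable]: "G \<in> borel_measurable borel"
  shows "(\<integral>\<^sup>+y. G y \<partial>bary_measure n) =
    (\<integral>\<^sup>+x. G (simplex_coords n x) * indicator (nonneg_coords n) (simplex_coords n x) \<partial>cube_measure n) / ennreal (1 / fact n)"
proof -
  have m: "simplex_coords n \<in> borel_measurable (uniform_measure (cube_measure n) (corner n))" by measurable
  have "(\<integral>\<^sup>+y. G y \<partial>bary_measure n) = (\<integral>\<^sup>+x. G (simplex_coords n x) \<partial>uniform_measure (cube_measure n) (corner n))"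
    unfolding bary_measure_def by (rule nn_integral_distr[OF m]) simp
  also have "\<dots> = (\<integral>\<^sup>+x. G (simplex_coords n x) * indicator (corner n) x \<partial>cube_measure n) / ennreal (1 / fact n)"
    by (subst nn_integral_uniform_measure) (auto simp: emeasure_corner)
  also have "(\<integral>\<^sup>+x. G (simplex_coords n x) * indicator (corner n) x \<partial>cube_measure n)
     = (\<integral>\<^sup>+x. G (simplex_coords n x) * indicator (nonneg_coords n) (simplex_coords n x) \<partial>cube_measure n)"
    by (intro nn_integral_cong) (auto simp: corner_eq_coords indicator_def)
  finally show ?thesis .
qed

lemma emeasure_bary_measure: "emeasure (bary_measure n) UNIV = 1"
proof -
  have "emeasure (bary_measure n) UNIV = emeasure (uniform_measure (cube_measure n) (corner n)) (space (cube_measure n))"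
    unfolding bary_measure_def by (subst emeasure_distr) auto
  also have "\<dots> = emeasure (cube_measure n) (corner n) / emeasure (cube_measure n) (corner n)"
    using sets.sets_into_space[OF corner_measurable[of n]] by (subst emeasure_uniform_measure) (auto simp: Int_absorb2)
  also have "\<dots> = 1" unfolding emeasure_corner by (simp add: divide_ennreal)
  finally show ?thesis .
qed

lemma finite_bary_measure: "finite_measure (bary_measure n)"
  by (rule finite_measureI) (simp add: emeasure_bary_measure)

lemma measure_bary_measure: "measure (bary_measure n) UNIV = 1"
  by (simp add: measure_def emeasure_bary_measure)

lemma AE_bary_measure: "AE y in bary_measure n. y \<in> nonneg_coords n \<and> (\<Sum>i\<le>n. y i) = 1"
proof -
  have [measurable]: "{y. y \<in> nonneg_coords n \<and> (\<Sum>i\<le>n. y i) = 1} \<in> sets borel"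
  proof -
    have "{y \<in> space borel. (\<Sum>i\<le>n. y i) = 1} \<in> sets (borel :: (nat \<Rightarrow> real) measure)" by measurable
    moreover have "{y. y \<in> nonneg_coords n \<and> (\<Sum>i\<le>n. y i) = 1} = nonneg_coords n \<inter> {y \<in> space borel. (\<Sum>i\<le>n. y i) = 1}" by auto
    ultimately show ?thesis by simp
  qed
  have "AE x in uniform_measure (cube_measure n) (corner n). x \<in> corner n"
    by (rule AE_uniform_measureI) auto
  then have "AE x in uniform_measure (cube_measure n) (corner n). simplex_coords n x \<in> nonneg_coords n \<and> (\<Sum>i\<le>n. simplex_coords n x i) = 1"
    by eventually_elim (auto simp: corner_eq_coords sum_simplex_coords)
  then show ?thesis unfolding bary_measure_def by (subst AE_distr_iff) auto
qed

lemma nonneg_coords_permute: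
  assumes "\<pi> permutes {..n}" shows "y \<circ> \<pi> \<in> nonneg_coords n \<longleftrightarrow> y \<in> nonneg_coords n"
proof -
  have "(\<forall>i\<in>{..n}. 0 \<le> y (\<pi> i)) \<longleftrightarrow> (\<forall>j\<in>\<pi> ` {..n}. 0 \<le> y j)" by simp
  then show ?thesis unfolding nonneg_coords_def permutes_image[OF assms] by (auto simp: Ball_def)
qed

lemma nn_integral_bary_permute:
  assumes [measurable]: "G \<in> borel_measurable borel" and p: "\<pi> permutes {..n}"
  shows "(\<integral>\<^sup>+y. G (y \<circ> \<pi>) \<partial>bary_measure n) = (\<integral>\<^sup>+y. G y \<partial>bary_measure n)"
proof -
  have "(\<integral>\<^sup>+x. G (simplex_coords n x \<circ> \<pi>) * indicator (nonneg_coords n) (simplex_coords n x) \<partial>cube_measure n) =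
     (\<integral>\<^sup>+x. (\<lambda>y. G y * indicator (nonneg_coords n) y) (simplex_coords n x \<circ> \<pi>) \<partial>cube_measure n)"
    by (simp add: indicator_def nonneg_coords_permute[OF p])
  also have "\<dots> = (\<integral>\<^sup>+x. (\<lambda>y. G y * indicator (nonneg_coords n) y) (simplex_coords n x) \<partial>cube_measure n)"
    by (rule nn_integral_coords_permute[OF _ p]) measurable
  finally show ?thesis by (simp add: nn_integral_bary_measure)
qed

lemma AE_bary_sorting:
  "AE y in bary_measure n. card {\<pi>. \<pi> permutes {..n} \<and> y \<circ> \<pi> \<in> sorted_coords n} = 1"
proof -
  have "AE x in cube_measure n. \<forall>i\<in>{..n}. \<forall>j\<in>{..n}. i \<noteq> j \<longrightarrow> simplex_coords n x i \<noteq> simplex_coords n x j"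
  proof (intro AE_finite_allI AE_impI finite_atMost)
    fix i j assume ij: "i \<in> {..n}" "j \<in> {..n}" "i \<noteq> j"
    then consider "i < n" | "j < n" by force
    then show "AE x in cube_measure n. simplex_coords n x i \<noteq> simplex_coords n x j"
    proof cases
      case 1 then show ?thesis using AE_coords_distinct[of i n j] ij by auto
    next
      case 2 then have "AE x in cube_measure n. simplex_coords n x j \<noteq> simplex_coords n x i"
        using AE_coords_distinct[of j n i] ij by auto
      then show ?thesis by eventually_elim auto
    qed
  qed
  then have "AE x in cube_measure n. inj_on (simplex_coords n x) {..n}"
    by eventually_elim (auto simp: inj_on_def)
  then have "AE x in cube_measure n. x \<in> corner n \<longrightarrow> inj_on (simplex_coords n x) {..n}" by eventually_elim simp
  then have "AE x in uniform_measure (cube_measure n) (corner n). inj_on (simplex_coords n x) {..n}"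
    by (intro AE_uniform_measureI) auto
  moreover have "AE x in uniform_measure (cube_measure n) (corner n). x \<in> corner n"
    by (rule AE_uniform_measureI) auto
  ultimately have *: "AE x in uniform_measure (cube_measure n) (corner n). inj_on (simplex_coords n x) {..n} \<and> simplex_coords n x \<in> nonneg_coords n"
    by eventually_elim (simp add: corner_eq_coords)
  have meas: "{y. inj_on y {..n} \<and> y \<in> nonneg_coords n} \<in> sets (borel :: (nat \<Rightarrow> real) measure)"
  proof -
    have "{y. inj_on y {..n} \<and> y \<in> nonneg_coords n} = nonneg_coords n - (\<Union>i\<in>{..n}. \<Union>j\<in>{..n} - {i}. {y. y i = y j})"
      by (auto simp: inj_on_def)
    moreover have "closed (\<Union>i\<in>{..n}. \<Union>j\<in>{..n} - {i}. {y :: nat \<Rightarrow> real. y i = y j})"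
      by (intro closed_UN finite_atMost finite_Diff ballI closed_Collect_eq continuous_on_product_coordinates)
    ultimately show ?thesis by (simp add: borel_closed sets.Diff)
  qed
  have "AE y in bary_measure n. inj_on y {..n} \<and> y \<in> nonneg_coords n"
    unfolding bary_measure_def using * meas by (subst AE_distr_iff) auto
  then show ?thesis by eventually_elim (elim conjE, rule sorting_permutation_unique)
qed

text \<open>The triangular map carries nonnegativity to sortedness at the price of a factor (n+1)!,
  and a permutation of coordinates moves the sorted sector to that of \<open>\<pi>\<close>. The
  sectors of all permutations cover almost every point exactly once, so the sum recovers the whole
  integral.\<close>

lemma nn_integral_bary_subdiv:
  assumes [measurable]: "G \<in> borel_measurable borel"
  shows "(\<Sum>\<pi> | \<pi> permutes {..n}. \<integral>\<^sup>+y. G (subdiv_coords n y \<circ> \<pi>) \<partial>bary_measure n) =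
    ennreal (fact (Suc n)) * (\<integral>\<^sup>+y. G y \<partial>bary_measure n)"
proof -
  have one: "(\<integral>\<^sup>+y. G (subdiv_coords n y \<circ> \<pi>) \<partial>bary_measure n) =
      ennreal (fact (Suc n)) * (\<integral>\<^sup>+y. G y * indicator (sorted_coords n) (y \<circ> inv \<pi>) \<partial>bary_measure n)"
    if p: "\<pi> permutes {..n}" for \<pi>
  proof -
    have pi: "y \<circ> \<pi> \<circ> inv \<pi> = y" for y :: "nat \<Rightarrow> real"
      using permutes_inv_o(1)[OF p] by (simp add: comp_assoc)
    let ?H = "\<lambda>y. G (y \<circ> \<pi>) * indicator (sorted_coords n) y"
    have "(\<integral>\<^sup>+y. G (subdiv_coords n y \<circ> \<pi>) \<partial>bary_measure n) =
        (\<integral>\<^sup>+x. ?H (subdiv_coords n (simplex_coords n x)) \<partial>cube_measure n) / ennreal (1 / fact n)"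
      by (subst nn_integral_bary_measure) (auto simp: indicator_def subdiv_coords_sorted_coords)
    also have "\<dots> = ennreal (fact (Suc n)) * (\<integral>\<^sup>+x. ?H (simplex_coords n x) \<partial>cube_measure n) / ennreal (1 / fact n)"
      by (subst nn_integral_subdiv_coords) auto
    also have "(\<integral>\<^sup>+x. ?H (simplex_coords n x) \<partial>cube_measure n) =
        (\<integral>\<^sup>+x. ?H (simplex_coords n x) * indicator (nonneg_coords n) (simplex_coords n x) \<partial>cube_measure n)"
      using sorted_coords_nonneg by (intro nn_integral_cong) (auto simp: indicator_def)
    also have "ennreal (fact (Suc n)) * \<dots> / ennreal (1 / fact n) = ennreal (fact (Suc n)) * (\<integral>\<^sup>+y. ?H y \<partial>bary_measure n)"
      by (subst nn_integral_bary_measure) (auto simp: ennreal_times_divide)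
    also have "(\<integral>\<^sup>+y. ?H y \<partial>bary_measure n) = (\<integral>\<^sup>+y. (\<lambda>z. G z * indicator (sorted_coords n) (z \<circ> inv \<pi>)) (y \<circ> \<pi>) \<partial>bary_measure n)"
      by (simp add: pi)
    also have "\<dots> = (\<integral>\<^sup>+y. G y * indicator (sorted_coords n) (y \<circ> inv \<pi>) \<partial>bary_measure n)"
      by (rule nn_integral_bary_permute[OF _ p]) measurable
    finally show ?thesis .
  qed
  have fin: "finite {\<pi>. \<pi> permutes {..n}}" by (rule finite_permutations) simp
  have "(\<Sum>\<pi> | \<pi> permutes {..n}. \<integral>\<^sup>+y. G (subdiv_coords n y \<circ> \<pi>) \<partial>bary_measure n) =
     ennreal (fact (Suc n)) * (\<Sum>\<pi> | \<pi> permutes {..n}. \<integral>\<^sup>+y. G y * indicator (sorted_coords n) (y \<circ> inv \<pi>) \<partial>bary_measure n)"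
    using one by (simp add: sum_distrib_left del: fact_Suc)
  also have "(\<Sum>\<pi> | \<pi> permutes {..n}. \<integral>\<^sup>+y. G y * indicator (sorted_coords n) (y \<circ> inv \<pi>) \<partial>bary_measure n) =
     (\<integral>\<^sup>+y. (\<Sum>\<pi> | \<pi> permutes {..n}. G y * indicator (sorted_coords n) (y \<circ> inv \<pi>)) \<partial>bary_measure n)"
    by (rule nn_integral_sum[symmetric]) measurable
  also have "\<dots> = (\<integral>\<^sup>+y. G y \<partial>bary_measure n)"
  proof (rule nn_integral_cong_AE)
    show "AE y in bary_measure n. (\<Sum>\<pi> | \<pi> permutes {..n}. G y * indicator (sorted_coords n) (y \<circ> inv \<pi>)) = G y"
      using AE_bary_sorting
    proof eventually_elim
      case (elim y)
      \<comment> \<open>Passing to inverses turns the sum into the number of permutations that sort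
        \<open>y\<close>, which is 1 for the present \<open>y\<close>.\<close>
      have "(\<Sum>\<pi> | \<pi> permutes {..n}. indicator (sorted_coords n) (y \<circ> inv \<pi>) :: ennreal) =
          (\<Sum>\<pi> | \<pi> permutes {..n}. indicator (sorted_coords n) (y \<circ> \<pi>))"
        by (rule sum.reindex_bij_witness[of _ inv inv]) (auto simp: permutes_inv permutes_inv_inv)
      also have "\<dots> = (\<Sum>\<pi> | \<pi> permutes {..n} \<and> y \<circ> \<pi> \<in> sorted_coords n. 1)"
        using fin by (intro sum.mono_neutral_cong_right) (auto simp: indicator_def)
      also have "\<dots> = 1" using elim by simp
      finally show ?case by (simp add: sum_distrib_left[symmetric])
    qed
  qed
  finally show ?thesis .
qed

lemma integrable_bary_measure:
  fixes F :: "(nat \<Rightarrow> real) \<Rightarrow> real"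
  assumes "F \<in> borel_measurable borel" "\<And>y. \<bar>F y\<bar> \<le> B"
  shows "integrable (bary_measure n) F"
  by (rule finite_measure.integrable_const_bound[OF finite_bary_measure, of _ B])
    (use assms in \<open>auto cong: measurable_cong_sets\<close>)

text \<open>Adding the bound \<open>B\<close> makes the integrand nonnegative.\<close>

lemma integral_bary_shift:
  fixes F :: "(nat \<Rightarrow> real) \<Rightarrow> real"
  assumes "F \<in> borel_measurable borel" "\<And>y. \<bar>F y\<bar> \<le> B"
  shows "ennreal ((\<integral>y. F y \<partial>bary_measure n) + B) = (\<integral>\<^sup>+y. ennreal (F y + B) \<partial>bary_measure n)"
    and "0 \<le> (\<integral>y. F y \<partial>bary_measure n) + B"
proof -
  interpret finite_measure "bary_measure n" by (rule finite_bary_measure)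
  have int: "integrable (bary_measure n) F" by (rule integrable_bary_measure[OF assms])
  have nn: "0 \<le> F y + B" for y using assms(2)[of y] by linarith
  have eq: "(\<integral>y. F y + B \<partial>bary_measure n) = (\<integral>y. F y \<partial>bary_measure n) + B"
    using int by (simp add: measure_bary_measure)
  show "ennreal ((\<integral>y. F y \<partial>bary_measure n) + B) = (\<integral>\<^sup>+y. ennreal (F y + B) \<partial>bary_measure n)"
    unfolding eq[symmetric] using int nn by (intro nn_integral_eq_integral[symmetric]) auto
  show "0 \<le> (\<integral>y. F y \<partial>bary_measure n) + B"
    unfolding eq[symmetric] using nn by (rule Bochner_Integration.integral_nonneg)
qed

lemma integral_bary_permute:
  fixes F :: "(nat \<Rightarrow> real) \<Rightarrow> real"
  assumes F [measurable]: "F \<in> borel_measurable borel" and B: "\<And>y. \<bar>F y\<bar> \<le> B" and p: "\<pi> permutes {..n}"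
  shows "(\<integral>y. F (y \<circ> \<pi>) \<partial>bary_measure n) = (\<integral>y. F y \<partial>bary_measure n)"
proof -
  have F\<pi>: "(\<lambda>y. F (y \<circ> \<pi>)) \<in> borel_measurable borel" by measurable
  have "ennreal ((\<integral>y. F (y \<circ> \<pi>) \<partial>bary_measure n) + B) = ennreal ((\<integral>y. F y \<partial>bary_measure n) + B)"
    unfolding integral_bary_shift(1)[OF F B] integral_bary_shift(1)[OF F\<pi> B]
    by (rule nn_integral_bary_permute[OF _ p]) measurable
  then show ?thesis using integral_bary_shift(2)[OF F B, of n] integral_bary_shift(2)[OF F\<pi> B, of n]
    by (simp add: ennreal_inj)
qed

text \<open>The shift by \<open>B\<close> contributes the same (n+1)! B to both sides, one
  \<open>B\<close> for each permutation on the left, and cancels.\<close>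

lemma integral_bary_subdiv:
  fixes F :: "(nat \<Rightarrow> real) \<Rightarrow> real"
  assumes F [measurable]: "F \<in> borel_measurable borel" and B: "\<And>y. \<bar>F y\<bar> \<le> B"
  shows "(\<Sum>\<pi> | \<pi> permutes {..n}. \<integral>y. F (subdiv_coords n y \<circ> \<pi>) \<partial>bary_measure n) =
    fact (Suc n) * (\<integral>y. F y \<partial>bary_measure n)"
proof -
  let ?I = "\<lambda>\<pi>. \<integral>y. F (subdiv_coords n y \<circ> \<pi>) \<partial>bary_measure n" and ?J = "\<integral>y. F y \<partial>bary_measure n"
  have F\<pi>: "(\<lambda>y. F (subdiv_coords n y \<circ> \<pi>)) \<in> borel_measurable borel" for \<pi> by measurable
  note nn = integral_bary_shift(2)[OF F B, of n] integral_bary_shift(2)[OF F\<pi> B, of n]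
  have "ennreal (\<Sum>\<pi> | \<pi> permutes {..n}. ?I \<pi> + B) = (\<Sum>\<pi> | \<pi> permutes {..n}. ennreal (?I \<pi> + B))"
    using nn by (intro sum_ennreal[symmetric]) auto
  also have "\<dots> = ennreal (fact (Suc n)) * ennreal (?J + B)"
    unfolding integral_bary_shift(1)[OF F B] integral_bary_shift(1)[OF F\<pi> B]
    by (rule nn_integral_bary_subdiv) measurable
  also have "\<dots> = ennreal (fact (Suc n) * (?J + B))" by (rule ennreal_mult'[symmetric]) simp
  finally have "(\<Sum>\<pi> | \<pi> permutes {..n}. ?I \<pi> + B) = fact (Suc n) * (?J + B)"
    using nn by (subst (asm) ennreal_inj) (auto intro!: sum_nonneg mult_nonneg_nonneg simp del: fact_Suc)
  moreover have "card {\<pi>. \<pi> permutes {..n}} = fact (Suc n)" by (intro card_permutations) auto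
  ultimately show ?thesis by (simp add: sum.distrib distrib_left del: fact_Suc)
qed

subsection \<open>Self-similarity and mesh\<close>

text \<open>Bounded functions that are measurable along every affine parametrisation of a simplex;
  measurability on the whole space would be too strong, as it need not be separable.\<close>

definition simplex_measurable :: "('a::real_normed_vector \<Rightarrow> real) \<Rightarrow> bool" where
  "simplex_measurable F \<longleftrightarrow> (\<exists>B. \<forall>x. \<bar>F x\<bar> \<le> B) \<and>
     (\<forall>(n::nat) v. (\<lambda>y. F (\<Sum>i\<le>n. y i *\<^sub>R v i)) \<in> borel_measurable borel)"

lemma simplex_measurableD:
  assumes "simplex_measurable F"
  shows "(\<lambda>y. F (\<Sum>i\<le>(n::nat). y i *\<^sub>R v i)) \<in> borel_measurable borel" and "\<exists>B. \<forall>x. \<bar>F x\<bar> \<le> B"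
  using assms by (auto simp: simplex_measurable_def)

definition param_integral :: "('a::real_normed_vector \<Rightarrow> real) \<Rightarrow> nat \<Rightarrow> (nat \<Rightarrow> 'a) \<Rightarrow> real" where
  "param_integral F n v = (\<integral>y. F (\<Sum>i\<le>n. y i *\<^sub>R v i) \<partial>bary_measure n)"

text \<open>The numbering is chosen by the same description as in \<open>simplex_iso\<close>, so
  that the integrals against the push-forward of \<open>std_volume\<close> match it
  directly.\<close>

definition simplex_integral :: "('a::real_normed_vector \<Rightarrow> real) \<Rightarrow> nat \<Rightarrow> 'a set \<Rightarrow> real" where
  "simplex_integral F n s = param_integral F n (SOME v. bij_betw v {..n} s)"

lemma simplex_numbering_exists:
  assumes "finite s" "card s = Suc n" shows "\<exists>v. bij_betw v {..n} s"
  using assms by (intro finite_same_card_bij) auto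

text \<open>Two numberings differ by a permutation of \<open>{..n}\<close>, under which
  \<open>bary_measure n\<close> is invariant.\<close>

lemma param_integral_numbering:
  assumes F: "simplex_measurable F" and v: "bij_betw v {..n} s" and w: "bij_betw w {..n} s"
  shows "param_integral F n v = param_integral F n w"
proof -
  obtain B where B: "\<And>x. \<bar>F x\<bar> \<le> B" using simplex_measurableD[OF F] by blast
  define \<pi> where "\<pi> i = (if i \<le> n then inv_into {..n} v (w i) else i)" for i
  have "bij_betw \<pi> {..n} {..n} \<longleftrightarrow> bij_betw (inv_into {..n} v \<circ> w) {..n} {..n}"
    by (rule bij_betw_cong) (simp add: \<pi>_def)
  then have p: "\<pi> permutes {..n}"
    using bij_betw_trans[OF w bij_betw_inv_into[OF v]] by (intro bij_imp_permutes) (auto simp: \<pi>_def)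
  have v\<pi>: "v (\<pi> i) = w i" if "i \<le> n" for i
    using that bij_betw_inv_into_right[OF v, of "w i"] bij_betw_apply[OF w, of i] by (simp add: \<pi>_def)
  have "(\<Sum>i\<le>n. y i *\<^sub>R v i) = (\<Sum>i\<le>n. (y \<circ> \<pi>) i *\<^sub>R w i)" for y
  proof -
    have "(\<Sum>i\<le>n. y i *\<^sub>R v i) = (\<Sum>i\<le>n. y (\<pi> i) *\<^sub>R v (\<pi> i))"
      using sum.reindex_bij_betw[OF permutes_imp_bij[OF p], of "\<lambda>i. y i *\<^sub>R v i"] by simp
    then show ?thesis using v\<pi> by simp
  qed
  then show ?thesis unfolding param_integral_def
    using integral_bary_permute[OF simplex_measurableD(1)[OF F] B p, of w] by simp
qed

lemma simplex_integral_eq: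
  assumes "simplex_measurable F" "bij_betw v {..n} s"
  shows "simplex_integral F n s = param_integral F n v"
  unfolding simplex_integral_def
  by (rule param_integral_numbering[OF assms(1) someI[of "\<lambda>v. bij_betw v {..n} s", OF assms(2)] assms(2)])

lemma AE_param_in_hull:
  assumes "bij_betw v {..n} s"
  shows "AE y in bary_measure n. (\<Sum>i\<le>n. y i *\<^sub>R v i) \<in> convex hull s"
  using AE_bary_measure
proof eventually_elim
  case (elim y)
  have "v i \<in> s" if "i \<le> n" for i using bij_betw_apply[OF assms] that by auto
  then show ?case using elim by (intro convex_sum) (auto simp: nonneg_coords_def hull_inc)
qed

text \<open>The measure has total mass 1 and almost every coordinate vector is mapped into the hull,
  so the pointwise bound integrates.\<close>

lemma simplex_integral_approx:
  assumes F: "simplex_measurable F" and s: "finite s" "card s = Suc n"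
    and approx: "\<And>x. x \<in> convex hull s \<Longrightarrow> \<bar>F x - c\<bar> \<le> e"
  shows "\<bar>simplex_integral F n s - c\<bar> \<le> e"
proof -
  interpret finite_measure "bary_measure n" by (rule finite_bary_measure)
  obtain v where v: "bij_betw v {..n} s" using simplex_numbering_exists[OF s] by blast
  obtain B where B: "\<And>x. \<bar>F x\<bar> \<le> B" using simplex_measurableD[OF F] by blast
  let ?G = "\<lambda>y. F (\<Sum>i\<le>n. y i *\<^sub>R v i)"
  have int: "integrable (bary_measure n) ?G"
    by (rule integrable_bary_measure[OF simplex_measurableD(1)[OF F] B])
  have ae: "AE y in bary_measure n. \<bar>?G y - c\<bar> \<le> e"
    using AE_param_in_hull[OF v] by eventually_elim (rule approx)
  have "(\<integral>y. ?G y \<partial>bary_measure n) \<le> (\<integral>y. c + e \<partial>bary_measure n)"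
    using ae by (intro integral_mono_AE int) (auto elim!: eventually_mono)
  moreover have "(\<integral>y. c - e \<partial>bary_measure n) \<le> (\<integral>y. ?G y \<partial>bary_measure n)"
    using ae by (intro integral_mono_AE int) (auto elim!: eventually_mono)
  ultimately show ?thesis
    unfolding simplex_integral_eq[OF F v] param_integral_def by (simp add: measure_bary_measure)
qed

lemma barycenter_image:
  assumes "inj_on v S" shows "barycenter (v ` S) = (\<Sum>i\<in>S. (1 / real (card S)) *\<^sub>R v i)"
  using assms by (simp add: barycenter_def card_image sum.reindex scaleR_sum_right)

text \<open>This is the geometric meaning of \<open>subdiv_coords\<close>: exchanging the double sum
  collects \<open>y k\<close> in front of the barycenter of the \<open>n + 1 - k\<close> vertices of
  rank at least \<open>k\<close>.\<close>

lemma subdiv_param_sum: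
  assumes p: "\<pi> permutes {..n}" and v: "inj_on v {..n}"
  shows "(\<Sum>i\<le>n. (subdiv_coords n y \<circ> \<pi>) i *\<^sub>R v i) =
    (\<Sum>k\<le>n. y k *\<^sub>R barycenter (v ` {i. i \<le> n \<and> k \<le> \<pi> i}))"
proof -
  have \<pi>n: "\<pi> i \<le> n" if "i \<le> n" for i using permutes_in_image[OF p, of i] that by simp
  have "(\<Sum>i\<le>n. (subdiv_coords n y \<circ> \<pi>) i *\<^sub>R v i) =
      (\<Sum>i\<le>n. \<Sum>k\<in>{k. k \<in> {..n} \<and> k \<le> \<pi> i}. (y k / real (Suc n - k)) *\<^sub>R v i)"
  proof (rule sum.cong[OF refl])
    fix i assume "i \<in> {..n}"
    then have "{k. k \<in> {..n} \<and> k \<le> \<pi> i} = {..\<pi> i}" using \<pi>n[of i] by auto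
    then show "(subdiv_coords n y \<circ> \<pi>) i *\<^sub>R v i = (\<Sum>k\<in>{k. k \<in> {..n} \<and> k \<le> \<pi> i}. (y k / real (Suc n - k)) *\<^sub>R v i)"
      using \<pi>n[of i] \<open>i \<in> {..n}\<close> by (simp add: subdiv_coords_def scaleR_sum_left)
  qed
  also have "\<dots> = (\<Sum>k\<le>n. \<Sum>i\<in>{i. i \<in> {..n} \<and> k \<le> \<pi> i}. (y k / real (Suc n - k)) *\<^sub>R v i)"
    by (rule sum.swap_restrict) auto
  also have "\<dots> = (\<Sum>k\<le>n. y k *\<^sub>R barycenter (v ` {i. i \<le> n \<and> k \<le> \<pi> i}))"
  proof (rule sum.cong[OF refl])
    fix k assume k: "k \<in> {..n}"
    have "inj_on v {i. i \<le> n \<and> k \<le> \<pi> i}" using v by (rule inj_on_subset) auto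
    then show "(\<Sum>i\<in>{i. i \<in> {..n} \<and> k \<le> \<pi> i}. (y k / real (Suc n - k)) *\<^sub>R v i) =
        y k *\<^sub>R barycenter (v ` {i. i \<le> n \<and> k \<le> \<pi> i})"
      using card_superlevel_perm[OF p, of k] k by (simp add: barycenter_image scaleR_sum_right)
  qed
  finally show ?thesis .
qed

text \<open>Through a numbering \<open>v\<close>, flags with \<open>n + 1\<close> members correspond
  to permutations, and \<open>subdiv_param_sum\<close> recognises the integrand of
  \<open>\<pi>\<close> as the parametrisation of the corresponding piece. The identity then is
  \<open>integral_bary_subdiv\<close>.\<close>

lemma simplex_integral_subdiv:
  assumes F: "simplex_measurable F" and K: "bary_complex K" and s: "s \<in> K" "card s = Suc n"
  shows "(\<Sum>C | C \<in> full_flags s \<and> card C = Suc n. simplex_integral F n (barycenter ` C)) =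
    fact (Suc n) * simplex_integral F n s"
proof -
  have fs: "finite s" using bary_complexD(1)[OF K s(1)] .
  obtain v where v: "bij_betw v {..n} s" using simplex_numbering_exists[OF fs s(2)] by blast
  obtain B where B: "\<And>x. \<bar>F x\<bar> \<le> B" using simplex_measurableD[OF F] by blast
  have injv: "inj_on v {..n}" and imv: "v ` {..n} = s" using v by (auto simp: bij_betw_def)
  define sup where "sup \<pi> k = {i. i \<le> n \<and> k \<le> \<pi> i}" for \<pi> :: "nat \<Rightarrow> nat" and k
  let ?V = "(`) ((`) v)"
  let ?A = "{C. C \<in> full_flags s \<and> card C = Suc n}"
  let ?A' = "{C \<in> full_flags {..n}. card C = Suc n}"
  have bijV: "bij_betw ?V ?A' ?A" by (rule full_flags_card_bij_betw[OF v])
  have one: "(\<integral>y. F (\<Sum>i\<le>n. (subdiv_coords n y \<circ> \<pi>) i *\<^sub>R v i) \<partial>bary_measure n) =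
      simplex_integral F n (barycenter ` ?V (perm_flag n \<pi>))" if p: "\<pi> permutes {..n}" for \<pi>
  proof -
    let ?u = "\<lambda>k. barycenter (v ` sup \<pi> k)"
    have flag: "perm_flag n \<pi> = sup \<pi> ` {..n}" by (simp add: perm_flag_def sup_def)
    have "?V (perm_flag n \<pi>) \<in> full_flags s"
      using perm_flag_bij_betw[of n] p full_flags_bij_betw[OF v] by (auto simp: bij_betw_def)
    then have sub: "?V (perm_flag n \<pi>) \<in> flags K" using full_flags_subset_flags[OF K s(1)] by blast
    have "?u ` {..n} = barycenter ` ?V (perm_flag n \<pi>)" unfolding flag by (simp add: image_image)
    \<comment> \<open>Injectivity by counting: the flag has \<open>n + 1\<close> members, and
      barycenters of distinct simplices are distinct.\<close>
    moreover have "inj_on ?u {..n}"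
    proof -
      have "card (barycenter ` ?V (perm_flag n \<pi>)) = card (?V (perm_flag n \<pi>))"
        by (rule card_barycenter_image[OF K sub])
      also have "\<dots> = Suc n"
        using bijV perm_flag_bij_betw[of n] p by (auto simp: bij_betw_def)
      finally have "card (?u ` {..n}) = card {..n}" using \<open>?u ` {..n} = _\<close> by simp
      then show ?thesis by (intro eq_card_imp_inj_on) auto
    qed
    ultimately have "bij_betw ?u {..n} (barycenter ` ?V (perm_flag n \<pi>))" by (simp add: bij_betw_def)
    from simplex_integral_eq[OF F this] show ?thesis
      unfolding param_integral_def subdiv_param_sum[OF p injv] sup_def by simp
  qed
  have "fact (Suc n) * simplex_integral F n s =
      (\<Sum>\<pi> | \<pi> permutes {..n}. \<integral>y. F (\<Sum>i\<le>n. (subdiv_coords n y \<circ> \<pi>) i *\<^sub>R v i) \<partial>bary_measure n)"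
    unfolding simplex_integral_eq[OF F v] param_integral_def
    by (rule integral_bary_subdiv[OF simplex_measurableD(1)[OF F] B, symmetric])
  also have "\<dots> = (\<Sum>\<pi> | \<pi> permutes {..n}. simplex_integral F n (barycenter ` ?V (perm_flag n \<pi>)))"
    using one by (intro sum.cong) auto
  also have "\<dots> = (\<Sum>C\<in>?A'. simplex_integral F n (barycenter ` ?V C))"
    by (rule sum.reindex_bij_betw[OF perm_flag_bij_betw])
  also have "\<dots> = (\<Sum>C\<in>?A. simplex_integral F n (barycenter ` C))"
    by (rule sum.reindex_bij_betw[OF bijV])
  finally show ?thesis by simp
qed

text \<open>The one-step identity is iterated. Pieces with fewer than \<open>n + 1\<close> vertices
  have no flag with \<open>n + 1\<close> members, so they never feed the top dimension
  again.\<close>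

lemma simplex_integral_pieces:
  assumes F: "simplex_measurable F" and K: "bary_complex K" and s: "s \<in> K" "card s = Suc n"
  shows "(\<Sum>\<tau> | \<tau> \<in> pieces d K s \<and> card \<tau> = Suc n. simplex_integral F n \<tau>) =
    fact (Suc n) ^ d * simplex_integral F n s"
proof (induction d)
  case 0
  have "{\<tau>. \<tau> = s \<and> card \<tau> = Suc n} = {s}" using s by auto
  then show ?case by simp
next
  case (Suc d)
  let ?K = "(sd ^^ d) K"
  \<comment> \<open>Extension by zero to all pieces, so that \<open>sum_pieces_Suc\<close> applies
    to the sum.\<close>
  let ?h = "\<lambda>\<tau>. if card \<tau> = Suc n then simplex_integral F n \<tau> else 0"
  have Kd: "bary_complex ?K" using K by (rule funpow_sd_bary_complex)
  have fin: "finite (pieces d K s)" "finite (pieces (Suc d) K s)" by (intro finite_pieces K s)+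
  have "(\<Sum>\<tau> | \<tau> \<in> pieces (Suc d) K s \<and> card \<tau> = Suc n. simplex_integral F n \<tau>) = (\<Sum>\<tau>\<in>pieces (Suc d) K s. ?h \<tau>)"
    using fin(2) by (rule sum.inter_filter)
  also have "\<dots> = (\<Sum>\<tau>\<in>pieces d K s. \<Sum>C\<in>full_flags \<tau>. ?h (barycenter ` C))"
    by (rule sum_pieces_Suc(2)[OF K s(1) fin(1)])
  also have "\<dots> = (\<Sum>\<tau>\<in>pieces d K s. fact (Suc n) * ?h \<tau>)"
  proof (rule sum.cong[OF refl])
    fix \<tau> assume \<tau>: "\<tau> \<in> pieces d K s"
    then have \<tau>K: "\<tau> \<in> ?K" using pieces_subset[OF s(1)] by blast
    have fint: "finite \<tau>" using bary_complexD(1)[OF Kd \<tau>K] .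
    have cC: "card (barycenter ` C) = card C" if "C \<in> full_flags \<tau>" for C
      using card_barycenter_image[OF Kd] full_flags_subset_flags[OF Kd \<tau>K] that by blast
    have "(\<Sum>C\<in>full_flags \<tau>. ?h (barycenter ` C)) = (\<Sum>C\<in>full_flags \<tau>. if card C = Suc n then simplex_integral F n (barycenter ` C) else 0)"
      using cC by (intro sum.cong) auto
    also have "\<dots> = (\<Sum>C | C \<in> full_flags \<tau> \<and> card C = Suc n. simplex_integral F n (barycenter ` C))"
      using finite_full_flags[OF fint] by (rule sum.inter_filter[symmetric])
    also have "\<dots> = fact (Suc n) * ?h \<tau>"
    proof (cases "card \<tau> = Suc n")
      case True
      then show ?thesis using simplex_integral_subdiv[OF F Kd \<tau>K True] by simp
    next
      case False
      then have "card \<tau> < Suc n" using pieces_card_le[OF K s(1) \<tau>] s(2) by simp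
      then have "{C. C \<in> full_flags \<tau> \<and> card C = Suc n} = {}" using full_flags_card_le[OF fint] by fastforce
      then show ?thesis using False by (simp only: sum.empty) simp
    qed
    finally show "(\<Sum>C\<in>full_flags \<tau>. ?h (barycenter ` C)) = fact (Suc n) * ?h \<tau>" .
  qed
  also have "\<dots> = fact (Suc n) * (\<Sum>\<tau>\<in>pieces d K s. ?h \<tau>)" by (simp only: sum_distrib_left)
  also have "(\<Sum>\<tau>\<in>pieces d K s. ?h \<tau>) = (\<Sum>\<tau> | \<tau> \<in> pieces d K s \<and> card \<tau> = Suc n. simplex_integral F n \<tau>)"
    using fin(1) by (rule sum.inter_filter[symmetric])
  finally show ?case unfolding Suc.IH by (simp only: power_Suc mult.assoc)
qed

text \<open>The difference is an average of the \<open>x - v\<close>, in which the term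
  \<open>v = x\<close> vanishes; this leaves the factor (c - 1)/c with \<open>c = card s\<close>,
  which increases with \<open>c\<close>.\<close>

lemma barycenter_dist_le:
  assumes s: "finite s" "x \<in> s" and D: "\<And>v w. v \<in> s \<Longrightarrow> w \<in> s \<Longrightarrow> norm (v - w) \<le> D"
    and n: "card s \<le> Suc n"
  shows "norm (x - barycenter s) \<le> real n / real (Suc n) * D"
proof -
  have c: "0 < card s" using s by (auto simp: card_gt_0_iff)
  have D0: "0 \<le> D" using D[OF s(2,2)] by simp
  have "x = (\<Sum>v\<in>s. (1 / real (card s)) *\<^sub>R x)" using c by (simp add: scaleR_sum_left[symmetric])
  then have "x - barycenter s = (\<Sum>v\<in>s. (1 / real (card s)) *\<^sub>R (x - v))"
    unfolding barycenter_eq_sum by (simp add: scaleR_diff_right sum_subtractf)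
  also have "\<dots> = (\<Sum>v\<in>s - {x}. (1 / real (card s)) *\<^sub>R (x - v))"
    using s by (intro sum.mono_neutral_right) auto
  finally have "norm (x - barycenter s) \<le> (\<Sum>v\<in>s - {x}. norm ((1 / real (card s)) *\<^sub>R (x - v)))"
    using norm_sum by metis
  also have "\<dots> \<le> (\<Sum>v\<in>s - {x}. D / real (card s))"
    using D s by (intro sum_mono) (auto simp: divide_right_mono)
  also have "\<dots> = real (card s - 1) / real (card s) * D" using s by simp
  also have "\<dots> \<le> real n / real (Suc n) * D"
  proof (rule mult_right_mono[OF _ D0])
    have "real (card s - 1) = real (card s) - 1" using c by (simp add: of_nat_diff)
    then show "real (card s - 1) / real (card s) \<le> real n / real (Suc n)"
      using n c by (simp add: divide_simps) (simp add: algebra_simps)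
  qed
  finally show ?thesis .
qed

text \<open>Two vertices of a subdivided simplex are barycenters of nested faces
  \<open>a \<subseteq> b\<close>. All vertices of \<open>a\<close> lie in a ball around the
  barycenter of \<open>b\<close> that is smaller by the factor n/(n+1), and convexity of the ball
  puts the barycenter of \<open>a\<close> there too.\<close>

lemma pieces_mesh:
  assumes K: "bary_complex K" and s: "s \<in> K" "card s \<le> Suc n"
    and D: "\<And>v w. v \<in> s \<Longrightarrow> w \<in> s \<Longrightarrow> norm (v - w) \<le> D"
    and "\<sigma> \<in> pieces d K s" "x \<in> \<sigma>" "y \<in> \<sigma>"
  shows "norm (x - y) \<le> (real n / real (Suc n)) ^ d * D"
  using assms(5-)
proof (induction d arbitrary: \<sigma> x y)
  case (Suc d)
  let ?K = "(sd ^^ d) K"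
  let ?\<tau> = "carrier ?K \<sigma>"
  let ?E = "(real n / real (Suc n)) ^ d * D"
  have Kd: "bary_complex ?K" using K by (rule funpow_sd_bary_complex)
  have \<tau>: "?\<tau> \<in> pieces d K s" "\<sigma> \<in> sd ?K" using Suc.prems by auto
  then have \<tau>K: "?\<tau> \<in> ?K" using pieces_subset[OF s(1)] by blast
  obtain C where C: "C \<in> full_flags ?\<tau>" "\<sigma> = barycenter ` C"
    using sd_carrier_bij_betw[OF Kd \<tau>K] \<tau> unfolding bij_betw_def by blast
  have le: "norm (barycenter a - barycenter b) \<le> real n / real (Suc n) * ?E"
    if ab: "a \<in> C" "b \<in> C" "a \<subseteq> b" for a b
  proof -
    have b: "b \<subseteq> ?\<tau>" "finite b" "a \<noteq> {}" "finite a"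
      using ab full_flagsD(3,4)[OF C(1)] bary_complexD(1)[OF Kd \<tau>K] by (auto intro: finite_subset)
    have "card b \<le> Suc n"
      using card_mono[OF bary_complexD(1)[OF Kd \<tau>K] b(1)] pieces_card_le[OF K s(1) \<tau>(1)] s(2) by simp
    then have "norm (v - barycenter b) \<le> real n / real (Suc n) * ?E" if "v \<in> a" for v
      using that ab(3) b by (intro barycenter_dist_le Suc.IH[OF \<tau>(1)]) auto
    then have "a \<subseteq> cball (barycenter b) (real n / real (Suc n) * ?E)"
      by (auto simp: dist_norm norm_minus_commute)
    then have "convex hull a \<subseteq> cball (barycenter b) (real n / real (Suc n) * ?E)"
      by (intro hull_minimal) auto
    then show ?thesis using barycenter_in_hull[OF b(4,3)] by (auto simp: dist_norm norm_minus_commute)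
  qed
  obtain a b where ab: "a \<in> C" "b \<in> C" "x = barycenter a" "y = barycenter b" using Suc.prems C by auto
  have "norm (x - y) \<le> real n / real (Suc n) * ?E"
    using full_flagsD(5)[OF C(1)] ab le[of a b] le[of b a] unfolding chain_subset_def
    by (auto simp: norm_minus_commute)
  then show ?case by (simp only: power_Suc mult.assoc)
qed (use D in auto)

text \<open>Convexity of balls is used twice, first for a ball around a vertex and then for one
  around \<open>x\<close>.\<close>

lemma hull_dist_le:
  fixes s :: "'a::real_normed_vector set"
  assumes D: "\<And>v w. v \<in> s \<Longrightarrow> w \<in> s \<Longrightarrow> norm (v - w) \<le> D" and "x \<in> convex hull s" "y \<in> convex hull s"
  shows "dist x y \<le> D"
proof -
  have "convex hull s \<subseteq> cball v D" if "v \<in> s" for v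
    using D[OF that] by (intro hull_minimal) (auto simp: dist_norm)
  then have "s \<subseteq> cball x D" using assms(2) by (force simp: dist_commute)
  then have "convex hull s \<subseteq> cball x D" by (intro hull_minimal) auto
  then show ?thesis using assms(3) by auto
qed

subsection \<open>The coherent topology and its measures\<close>

text \<open>The defining predicate respects binary intersections and arbitrary unions since both
  commute with cutting by a hull; this is what allows \<open>topology\<close> to be
  inverted.\<close>

lemma openin_complex_topology:
  "openin (complex_topology K) U \<longleftrightarrow>
     U \<subseteq> realization K \<and> (\<forall>s\<in>K. openin (top_of_set (convex hull s)) (U \<inter> convex hull s))"
proof -
  have "istopology (\<lambda>U. U \<subseteq> realization K \<and> (\<forall>s\<in>K. openin (top_of_set (convex hull s)) (U \<inter> convex hull s)))"
    unfolding istopology_def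
  proof (intro conjI allI impI)
    fix S T assume S: "S \<subseteq> realization K \<and> (\<forall>s\<in>K. openin (top_of_set (convex hull s)) (S \<inter> convex hull s))"
      and T: "T \<subseteq> realization K \<and> (\<forall>s\<in>K. openin (top_of_set (convex hull s)) (T \<inter> convex hull s))"
    show "S \<inter> T \<subseteq> realization K" using S by blast
    show "\<forall>s\<in>K. openin (top_of_set (convex hull s)) (S \<inter> T \<inter> convex hull s)"
    proof
      fix s assume "s \<in> K"
      then have "openin (top_of_set (convex hull s)) ((S \<inter> convex hull s) \<inter> (T \<inter> convex hull s))"
        using openin_Int[OF S[THEN conjunct2, rule_format] T[THEN conjunct2, rule_format]] by blast
      moreover have "(S \<inter> convex hull s) \<inter> (T \<inter> convex hull s) = S \<inter> T \<inter> convex hull s" by blast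
      ultimately show "openin (top_of_set (convex hull s)) (S \<inter> T \<inter> convex hull s)" by simp
    qed
  next
    fix \<U> assume \<U>: "\<forall>U\<in>\<U>. U \<subseteq> realization K \<and> (\<forall>s\<in>K. openin (top_of_set (convex hull s)) (U \<inter> convex hull s))"
    show "\<Union>\<U> \<subseteq> realization K" using \<U> by blast
    show "\<forall>s\<in>K. openin (top_of_set (convex hull s)) (\<Union>\<U> \<inter> convex hull s)"
    proof
      fix s assume "s \<in> K"
      then have "openin (top_of_set (convex hull s)) (\<Union>U\<in>\<U>. U \<inter> convex hull s)"
        using \<U> by (intro openin_Union) auto
      moreover have "(\<Union>U\<in>\<U>. U \<inter> convex hull s) = \<Union>\<U> \<inter> convex hull s" by blast
      ultimately show "openin (top_of_set (convex hull s)) (\<Union>\<U> \<inter> convex hull s)" by (simp only:)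
    qed
  qed
  then show ?thesis by (simp add: complex_topology_def topology_inverse')
qed

lemma hull_subset_realization: "s \<in> K \<Longrightarrow> convex hull s \<subseteq> realization K"
  by (auto simp: realization_def)

lemma topspace_complex_topology [simp]: "topspace (complex_topology K) = realization K"
proof
  show "topspace (complex_topology K) \<subseteq> realization K"
    using openin_topspace[of "complex_topology K"] unfolding openin_complex_topology by simp
  have "openin (complex_topology K) (realization K)"
    unfolding openin_complex_topology using hull_subset_realization[of _ K] by (auto simp: Int_absorb1)
  then show "realization K \<subseteq> topspace (complex_topology K)" by (rule openin_subset)
qed

lemma continuous_map_complex_topology_on_hull:
  assumes f: "continuous_map (complex_topology K) euclideanreal f" and s: "s \<in> K"
  shows "continuous_on (convex hull s) f"
  unfolding continuous_on_open_gen[of f "convex hull s" UNIV, simplified]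
proof (intro allI impI)
  fix U :: "real set" assume "open U"
  then have "openin (complex_topology K) {x \<in> realization K. f x \<in> U}"
    using f by (auto simp: continuous_map_def)
  then have "openin (top_of_set (convex hull s)) ({x \<in> realization K. f x \<in> U} \<inter> convex hull s)"
    using s by (simp add: openin_complex_topology)
  moreover have "{x \<in> realization K. f x \<in> U} \<inter> convex hull s = convex hull s \<inter> f -` U"
    using hull_subset_realization[OF s] by blast
  ultimately show "openin (top_of_set (convex hull s)) (convex hull s \<inter> f -` U)" by simp
qed

text \<open>Defined by removing closed simplices instead of collecting open ones: a point of the
  star then forces \<open>v\<close> to be a vertex of every simplex whose hull contains the
  point.\<close>

definition open_star :: "'a::real_normed_vector set set \<Rightarrow> 'a \<Rightarrow> 'a set" where
  "open_star K v = realization K - (\<Union>t\<in>{t \<in> K. v \<notin> t}. convex hull t)"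

text \<open>Within a single simplex \<open>s\<close>, every simplex avoiding \<open>v\<close> meets
  \<open>s\<close> inside the face opposite to \<open>v\<close>, so only this compact face is
  removed.\<close>

lemma openin_open_star:
  assumes K: "geometric_complex K" shows "openin (complex_topology K) (open_star K v)"
  unfolding openin_complex_topology
proof (intro conjI ballI)
  show "open_star K v \<subseteq> realization K" by (auto simp: open_star_def)
  fix s assume s: "s \<in> K"
  have fin: "finite s" using bary_complexD(1)[OF geometric_bary_complex[OF K] s] .
  have faces: "t \<in> K" if "t \<subseteq> s" "t \<noteq> {}" for t
    using K s that unfolding geometric_complex_def by (elim conjE) (drule bspec[OF _ s], simp)+
  have inter: "convex hull s \<inter> convex hull t = convex hull (s \<inter> t)" if "t \<in> K" for t
    using K s that unfolding geometric_complex_def by (elim conjE) (drule bspec[OF _ s], simp)+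
  have "open_star K v \<inter> convex hull s = convex hull s \<inter> - (convex hull (s - {v}))"
  proof (intro equalityI subsetI)
    fix x assume x: "x \<in> open_star K v \<inter> convex hull s"
    have "x \<notin> convex hull (s - {v})"
    proof
      assume xv: "x \<in> convex hull (s - {v})"
      then have "s - {v} \<noteq> {}" by (metis convex_hull_empty empty_iff)
      then have "s - {v} \<in> K" by (intro faces) auto
      then show False using x xv by (auto simp: open_star_def)
    qed
    then show "x \<in> convex hull s \<inter> - (convex hull (s - {v}))" using x by simp
  next
    fix x assume x: "x \<in> convex hull s \<inter> - (convex hull (s - {v}))"
    have "x \<notin> convex hull t" if t: "t \<in> K" "v \<notin> t" for t
    proof
      assume "x \<in> convex hull t"
      then have "x \<in> convex hull (s \<inter> t)" using x inter[OF t(1)] by auto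
      moreover have "convex hull (s \<inter> t) \<subseteq> convex hull (s - {v})" using t by (intro hull_mono) auto
      ultimately show False using x by auto
    qed
    then show "x \<in> open_star K v \<inter> convex hull s" using x hull_subset_realization[OF s] by (auto simp: open_star_def)
  qed
  moreover have "open (- (convex hull (s - {v})))"
    using fin by (intro open_Compl compact_imp_closed finite_imp_compact_convex_hull) simp
  ultimately show "openin (top_of_set (convex hull s)) (open_star K v \<inter> convex hull s)"
    by (simp add: openin_open_Int)
qed

text \<open>Any vertex with positive coordinate at \<open>x\<close> works: a simplex containing
  \<open>x\<close> contains the whole support of \<open>x\<close>.\<close>

lemma open_star_cover:
  assumes K: "bary_complex K" and x: "x \<in> realization K" obtains v where "x \<in> open_star K v"
proof -
  obtain s where s: "s \<in> K" "x \<in> convex hull s" using x by (auto simp: realization_def)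
  obtain t a where t: "t \<subseteq> s" "t \<noteq> {}" "\<And>v. v \<in> t \<Longrightarrow> 0 < a v" "sum a t = 1" "(\<Sum>v\<in>t. a v *\<^sub>R v) = x"
    using hull_support[OF bary_complexD(1)[OF K s(1)] s(2)] by metis
  have tK: "t \<in> K" using bary_complexD(3)[OF K s(1) t(1,2)] .
  obtain v where v: "v \<in> t" using t(2) by blast
  have "x \<notin> convex hull r" if "r \<in> K" "v \<notin> r" for r
    using bary_complex_hull_support[OF K tK t(3,4) that(1)] t(5) that v by auto
  then show ?thesis using that x by (auto simp: open_star_def)
qed

text \<open>The support is covered by finitely many open stars. A simplex meeting the star of
  \<open>v\<close> has \<open>v\<close> as a vertex, and local finiteness bounds the number of
  those.\<close>

lemma finite_simplices_meeting_support:
  assumes K: "geometric_complex K" and lf: "locally_finite_complex K"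
    and f: "compactin (complex_topology K) (complex_topology K closure_of {x \<in> topspace (complex_topology K). f x \<noteq> 0})"
  shows "finite {s \<in> K. \<exists>x\<in>convex hull s. f x \<noteq> 0}"
proof -
  let ?X = "complex_topology K" and ?S = "{x \<in> realization K. f x \<noteq> 0}"
  have "?X closure_of ?S \<subseteq> \<Union>(range (open_star K))"
  proof
    fix x assume "x \<in> ?X closure_of ?S"
    then have "x \<in> realization K" using closure_of_subset_topspace[of ?X ?S] by auto
    then obtain v where "x \<in> open_star K v" using open_star_cover[OF geometric_bary_complex[OF K]] by blast
    then show "x \<in> \<Union>(range (open_star K))" by blast
  qed
  then obtain \<F> where \<F>: "finite \<F>" "\<F> \<subseteq> range (open_star K)" "?X closure_of ?S \<subseteq> \<Union>\<F>"
    using compactinD[OF f, of "range (open_star K)"] openin_open_star[OF K] by auto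
  then obtain V where V: "finite V" "\<F> = open_star K ` V" by (meson finite_subset_image)
  have "{s \<in> K. \<exists>x\<in>convex hull s. f x \<noteq> 0} \<subseteq> (\<Union>v\<in>V. {s \<in> K. v \<in> s})"
  proof
    fix s assume "s \<in> {s \<in> K. \<exists>x\<in>convex hull s. f x \<noteq> 0}"
    then obtain x where s: "s \<in> K" and x: "x \<in> convex hull s" "f x \<noteq> 0" by blast
    then have "x \<in> ?X closure_of ?S"
      using hull_subset_realization[OF s] closure_of_subset[of ?S ?X] by auto
    then obtain v where "v \<in> V" "x \<in> open_star K v" using \<F> V by blast
    then show "s \<in> (\<Union>v\<in>V. {s \<in> K. v \<in> s})" using s x by (auto simp: open_star_def)
  qed
  moreover have "finite (\<Union>v\<in>V. {s \<in> K. v \<in> s})" using V lf by (auto simp: locally_finite_complex_def)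
  ultimately show ?thesis by (rule finite_subset)
qed

section \<open>Borel sets of the realization and integrals against its measures\<close>

lemma openin_subset_Pow: "{U. openin X U} \<subseteq> Pow (topspace X)"
  by (auto dest: openin_subset)

lemma space_borel_of [simp]: "space (borel_of X) = topspace X"
  by (simp add: borel_of_def space_measure_of_conv)

lemma sets_borel_of: "sets (borel_of X) = sigma_sets (topspace X) {U. openin X U}"
  unfolding borel_of_def by (rule sets_measure_of[OF openin_subset_Pow])

lemma continuous_map_borel_of_measurable:
  assumes "continuous_map X euclideanreal f" shows "f \<in> borel_measurable (borel_of X)"
proof (rule borel_measurableI)
  fix U :: "real set" assume "open U"
  then have "openin X {x \<in> topspace X. f x \<in> U}" using assms by (auto simp: continuous_map_def)
  moreover have "f -` U \<inter> space (borel_of X) = {x \<in> topspace X. f x \<in> U}" by auto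
  ultimately show "f -` U \<inter> space (borel_of X) \<in> sets (borel_of X)" by (simp add: sets_borel_of sigma_sets.Basic)
qed

lemma integral_scale_measure:
  fixes f :: "'a \<Rightarrow> real"
  assumes f: "f \<in> borel_measurable M" and c: "0 \<le> c"
  shows "(\<integral>x. f x \<partial>scale_measure (ennreal c) M) = c * (\<integral>x. f x \<partial>M)"
proof -
  have "scale_measure (ennreal c) M = density M (\<lambda>_. ennreal c)"
    by (rule measure_eqI) (auto simp: emeasure_density_const)
  then show ?thesis using integral_density[OF f, of "\<lambda>_. c"] c by simp
qed

text \<open>Push-forward, density and scaling are unwound to an integral over
  \<open>count_space\<close>, which is a finite sum because \<open>f\<close> vanishes at all but
  finitely many of the barycenters.\<close>

lemma integral_weighted_gamma:
  fixes f :: "'a::real_normed_vector \<Rightarrow> real"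
  assumes K: "bary_complex K" and f: "f \<in> borel_measurable (borel_of (complex_topology K))"
    and w: "\<And>\<sigma>. 0 \<le> w \<sigma>" and fin: "finite {\<sigma> \<in> simplices p ((sd ^^ d) K). f (barycenter \<sigma>) \<noteq> 0}"
  shows "(\<integral>x. f x \<partial>weighted_gamma n d p K w) =
    (\<Sum>\<sigma> | \<sigma> \<in> simplices p ((sd ^^ d) K) \<and> f (barycenter \<sigma>) \<noteq> 0. w \<sigma> * f (barycenter \<sigma>)) / fact (n + 1) ^ d"
proof -
  let ?A = "simplices p ((sd ^^ d) K)" and ?X = "complex_topology K"
  let ?c = "1 / fact (n + 1) ^ d :: real"
  let ?M = "density (scale_measure (ennreal ?c) (count_space ?A)) (\<lambda>\<sigma>. ennreal (w \<sigma>))"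
  have "barycenter \<sigma> \<in> realization K" if "\<sigma> \<in> ?A" for \<sigma>
  proof -
    have \<sigma>: "\<sigma> \<in> (sd ^^ d) K" using that by (simp add: simplices_def)
    then obtain s where s: "s \<in> K" "\<sigma> \<in> pieces d K s" using pieces_cover[OF K, of d] by auto
    have "barycenter \<sigma> \<in> convex hull \<sigma>"
      using bary_complexD(1,2)[OF funpow_sd_bary_complex[OF K] \<sigma>] by (rule barycenter_in_hull)
    then show ?thesis using pieces_hull[OF K s(2)] hull_subset_realization[OF s(1)] by blast
  qed
  then have g: "barycenter \<in> measurable ?M (borel_of ?X)"
    by (auto simp: measurable_def space_scale_measure)
  have "(\<integral>x. f x \<partial>weighted_gamma n d p K w) = (\<integral>\<sigma>. f (barycenter \<sigma>) \<partial>?M)"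
    unfolding weighted_gamma_def by (rule integral_distr[OF g f])
  also have "\<dots> = (\<integral>\<sigma>. w \<sigma> *\<^sub>R f (barycenter \<sigma>) \<partial>scale_measure (ennreal ?c) (count_space ?A))"
    by (rule integral_density) (auto simp: w measurable_def space_scale_measure)
  also have "\<dots> = ?c * (\<integral>\<sigma>. w \<sigma> *\<^sub>R f (barycenter \<sigma>) \<partial>count_space ?A)"
    by (rule integral_scale_measure) auto
  also have "(\<integral>\<sigma>. w \<sigma> *\<^sub>R f (barycenter \<sigma>) \<partial>count_space ?A) =
      (\<Sum>\<sigma> | \<sigma> \<in> ?A \<and> w \<sigma> *\<^sub>R f (barycenter \<sigma>) \<noteq> 0. w \<sigma> *\<^sub>R f (barycenter \<sigma>))"
    by (rule lebesgue_integral_count_space_finite_support) (rule finite_subset[OF _ fin], auto)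
  also have "\<dots> = (\<Sum>\<sigma> | \<sigma> \<in> ?A \<and> f (barycenter \<sigma>) \<noteq> 0. w \<sigma> * f (barycenter \<sigma>))"
    using fin by (intro sum.mono_neutral_cong_left) auto
  finally show ?thesis by simp
qed

text \<open>The distance is a finite sum of coordinate distances and so bounds each of them.
  Continuity of \<open>simplex_iso\<close> rests on this.\<close>

lemma continuous_lookup: "continuous_on UNIV (\<lambda>x :: nat \<Rightarrow>\<^sub>0 real. Poly_Mapping.lookup x i)"
proof (rule continuous_onI)
  fix x :: "nat \<Rightarrow>\<^sub>0 real" and e :: real assume e: "0 < e"
  have "dist (Poly_Mapping.lookup y i) (Poly_Mapping.lookup x i) \<le> dist y x" for y :: "nat \<Rightarrow>\<^sub>0 real"
  proof (cases "i \<in> Poly_Mapping.keys y \<union> Poly_Mapping.keys x")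
    case True
    then show ?thesis unfolding dist_poly_mapping_def
      by (intro member_le_sum[where f = "\<lambda>n. dist (Poly_Mapping.lookup y n) (Poly_Mapping.lookup x n)"]) auto
  next
    case False
    then show ?thesis by (simp add: in_keys_iff)
  qed
  then show "\<exists>d>0. \<forall>y\<in>UNIV. dist y x < d \<longrightarrow> dist (Poly_Mapping.lookup y i) (Poly_Mapping.lookup x i) \<le> e"
    using e by (intro exI[of _ e]) (meson le_less_trans less_imp_le)
qed

lemma corner_chart_eq:
  "corner_chart n x = (\<Sum>i\<le>n. Poly_Mapping.single i (simplex_coords n x i))"
proof -
  have "(\<Sum>i\<le>n. Poly_Mapping.single i (simplex_coords n x i)) =
     (\<Sum>i<n. Poly_Mapping.single i (simplex_coords n x i)) + Poly_Mapping.single n (simplex_coords n x n)"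
    by (metis lessThan_Suc_atMost sum.lessThan_Suc)
  then show ?thesis by (simp add: corner_chart_def simplex_coords_def)
qed

lemma single_eq_scaleR: "Poly_Mapping.single i r = r *\<^sub>R Poly_Mapping.single i (1::real)"
  by (rule poly_mapping_eqI) (simp add: lookup_single when_def)

lemma lookup_corner_chart: "i \<le> n \<Longrightarrow> Poly_Mapping.lookup (corner_chart n x) i = simplex_coords n x i"
  by (simp add: corner_chart_eq lookup_sum lookup_single when_def)

lemma corner_chart_measurable: "corner_chart n \<in> borel_measurable (cube_measure n)"
proof -
  have "(\<lambda>y. \<Sum>i\<le>n. (y i :: real) *\<^sub>R Poly_Mapping.single i (1::real)) \<in> borel_measurable borel"
    by (intro borel_measurable_continuous_onI continuous_on_sum continuous_on_scaleR
        continuous_on_product_coordinates continuous_on_const)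
  then have "(\<lambda>x. \<Sum>i\<le>n. simplex_coords n x i *\<^sub>R Poly_Mapping.single i (1::real)) \<in> borel_measurable (cube_measure n)"
    using measurable_compose[OF measurable_simplex_coords] by fast
  moreover have "corner_chart n = (\<lambda>x. \<Sum>i\<le>n. simplex_coords n x i *\<^sub>R Poly_Mapping.single i (1::real))"
    unfolding corner_chart_eq[abs_def] single_eq_scaleR[of _ "simplex_coords _ _ _"] ..
  ultimately show ?thesis by simp
qed

lemma corner_chart_in_hull:
  assumes "x \<in> corner n" shows "corner_chart n x \<in> convex hull (std_vertices n)"
proof -
  have "simplex_coords n x \<in> nonneg_coords n" using assms by (simp add: corner_eq_coords)
  then show ?thesis unfolding corner_chart_eq single_eq_scaleR[of _ "simplex_coords _ _ _"]
    by (intro convex_sum) (auto simp: sum_simplex_coords nonneg_coords_def std_vertices_def intro: hull_inc)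
qed

lemma corner_chart_restrict_measurable:
  "corner_chart n \<in> measurable (restrict_space (uniform_measure (cube_measure n) (corner n)) (corner n))
     (restrict_space borel (convex hull (std_vertices n)))"
proof (rule measurable_restrict_space2)
  let ?U = "uniform_measure (cube_measure n) (corner n)"
  show "corner_chart n \<in> space (restrict_space ?U (corner n)) \<rightarrow> convex hull (std_vertices n)"
    using corner_chart_in_hull by (auto simp: space_restrict_space)
  have "corner_chart n \<in> borel_measurable ?U" using corner_chart_measurable by simp
  then show "corner_chart n \<in> borel_measurable (restrict_space ?U (corner n))" by (rule measurable_restrict_space1)
qed

lemma emeasure_std_volume: "emeasure (std_volume n) (space (std_volume n)) = 1"
proof -
  let ?U = "uniform_measure (cube_measure n) (corner n)"
  let ?R = "restrict_space ?U (corner n)"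
  have sp: "space ?R = corner n"
    using sets.sets_into_space[OF corner_measurable[of n]] by (auto simp: space_restrict_space)
  have "emeasure (std_volume n) (space (std_volume n)) = emeasure ?R (space ?R)"
    unfolding std_volume_def
    using measurable_space[OF corner_chart_restrict_measurable[of n]]
    by (subst emeasure_distr[OF corner_chart_restrict_measurable])
      (auto intro!: arg_cong[where f = "emeasure ?R"])
  also have "\<dots> = emeasure ?U (corner n)"
    unfolding sp by (subst emeasure_restrict_space) (auto simp: Int_absorb2 sets.Int sets.sets_into_space)
  also have "\<dots> = 1" by (simp add: emeasure_corner divide_ennreal)
  finally show ?thesis .
qed

lemma space_std_volume [simp]: "space (std_volume n) = convex hull (std_vertices n)"
  by (simp add: std_volume_def space_restrict_space)

lemma lookup_hull_std_vertices:
  assumes "x \<in> convex hull (std_vertices n)"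
  shows "\<And>i. i \<le> n \<Longrightarrow> 0 \<le> Poly_Mapping.lookup x i" "(\<Sum>i\<le>n. Poly_Mapping.lookup x i) = 1"
proof -
  obtain U where U: "\<forall>v\<in>std_vertices n. 0 \<le> U v" "sum U (std_vertices n) = 1" "(\<Sum>v\<in>std_vertices n. U v *\<^sub>R v) = x"
    using assms by (auto simp: convex_hull_finite)
  have l: "Poly_Mapping.lookup x i = U (Poly_Mapping.single i 1)" if "i \<le> n" for i
    using lookup_std_sum[OF that, of U] U(3) by simp
  show "0 \<le> Poly_Mapping.lookup x i" if "i \<le> n" for i
    using l[OF that] U(1) that by (auto simp: std_vertices_def)
  have "sum U (std_vertices n) = (\<Sum>i\<le>n. U (Poly_Mapping.single i 1))"
    unfolding std_vertices_def using inj_on_subset[OF inj_single_one] by (subst sum.reindex) auto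
  then show "(\<Sum>i\<le>n. Poly_Mapping.lookup x i) = 1" using l U(2) by simp
qed

definition numbering :: "nat \<Rightarrow> 'a set \<Rightarrow> nat \<Rightarrow> 'a" where
  "numbering n s = (SOME v. bij_betw v {..n} s)"

lemma numbering_bij: "finite s \<Longrightarrow> card s = Suc n \<Longrightarrow> bij_betw (numbering n s) {..n} s"
  unfolding numbering_def by (rule someI_ex[OF simplex_numbering_exists])

lemma simplex_iso_eq: "simplex_iso n s x = (\<Sum>i\<le>n. Poly_Mapping.lookup x i *\<^sub>R numbering n s i)"
  by (simp add: simplex_iso_def numbering_def Let_def)

lemma simplex_iso_in_hull:
  assumes "finite s" "card s = Suc n" "x \<in> convex hull (std_vertices n)"
  shows "simplex_iso n s x \<in> convex hull s"
proof -
  have "numbering n s i \<in> s" if "i \<le> n" for i using bij_betw_apply[OF numbering_bij[OF assms(1,2)]] that by auto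
  then show ?thesis unfolding simplex_iso_eq
    using lookup_hull_std_vertices[OF assms(3)] by (intro convex_sum) (auto intro: hull_inc)
qed

text \<open>The image lies in the hull of \<open>s\<close>, where a coherently open set is the trace
  of an ambient open set; its preimage is open by continuity.\<close>

lemma simplex_iso_measurable:
  fixes K :: "'a::real_normed_vector set set"
  assumes s: "s \<in> K" "finite s" "card s = Suc n"
  shows "simplex_iso n s \<in> measurable (restrict_space borel (convex hull (std_vertices n))) (borel_of (complex_topology K))"
proof (rule measurable_sigma_sets[OF sets_borel_of openin_subset_Pow])
  let ?H = "convex hull (std_vertices n)"
  show "simplex_iso n s \<in> space (restrict_space borel ?H) \<rightarrow> topspace (complex_topology K)"
    using simplex_iso_in_hull[OF s(2,3)] hull_subset_realization[OF s(1)] by (auto simp: space_restrict_space)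
  fix U assume "U \<in> {U. openin (complex_topology K) U}"
  then have "openin (top_of_set (convex hull s)) (U \<inter> convex hull s)" using s by (simp add: openin_complex_topology)
  then obtain W where W: "open W" "U \<inter> convex hull s = convex hull s \<inter> W" by (auto simp: openin_open)
  have "continuous_on UNIV (simplex_iso n s)" unfolding simplex_iso_eq[abs_def]
    by (intro continuous_on_sum continuous_on_scaleR continuous_lookup continuous_on_const)
  then have "open (simplex_iso n s -` W)" using W(1) by (intro open_vimage)
  moreover have "simplex_iso n s -` U \<inter> ?H = ?H \<inter> simplex_iso n s -` W"
    using simplex_iso_in_hull[OF s(2,3)] W(2) by blast
  ultimately show "simplex_iso n s -` U \<inter> space (restrict_space borel ?H) \<in> sets (restrict_space borel ?H)"
    by (auto simp: space_restrict_space sets_restrict_space)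
qed

text \<open>Truncating to the hull makes \<open>f\<close> measurable along affine parametrisations that leave it.\<close>

definition truncate_to :: "'a::real_normed_vector set \<Rightarrow> ('a \<Rightarrow> real) \<Rightarrow> 'a \<Rightarrow> real" where
  "truncate_to s f x = (if x \<in> convex hull s then f x else 0)"

text \<open>The hull is compact, so its preimage under an affine parametrisation is closed and the
  composite is continuous there; compactness also gives the bound.\<close>

lemma truncate_simplex_measurable:
  assumes s: "finite s" and f: "continuous_on (convex hull s) f"
  shows "simplex_measurable (truncate_to s f)"
  unfolding simplex_measurable_def
proof (intro conjI allI)
  have comp: "compact (convex hull s)" using s by (rule finite_imp_compact_convex_hull)
  then have "bounded (f ` (convex hull s))" using f by (intro compact_imp_bounded compact_continuous_image)
  then obtain B where "\<forall>x\<in>convex hull s. \<bar>f x\<bar> \<le> B" by (auto simp: bounded_iff)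
  then have "\<bar>truncate_to s f x\<bar> \<le> max B 0" for x by (simp add: truncate_to_def le_max_iff_disj)
  then show "\<exists>B. \<forall>x. \<bar>truncate_to s f x\<bar> \<le> B" by blast
  fix n :: nat and v :: "nat \<Rightarrow> 'a"
  let ?P = "\<lambda>y :: nat \<Rightarrow> real. \<Sum>i\<le>n. y i *\<^sub>R v i"
  have P: "continuous_on UNIV ?P"
    by (intro continuous_on_sum continuous_on_scaleR continuous_on_product_coordinates continuous_on_const)
  have "closed (?P -` (convex hull s))" using compact_imp_closed[OF comp] P by (rule closed_vimage)
  moreover have "continuous_on (?P -` (convex hull s)) (\<lambda>y. f (?P y))"
    by (rule continuous_on_compose2[OF f continuous_on_subset[OF P]]) auto
  ultimately have "(\<lambda>y. indicator (?P -` (convex hull s)) y *\<^sub>R f (?P y)) \<in> borel_measurable borel"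
    by (intro borel_measurable_continuous_on_indicator borel_closed)
  moreover have "(\<lambda>y. indicator (?P -` (convex hull s)) y *\<^sub>R f (?P y)) = (\<lambda>y. truncate_to s f (?P y))"
    by (auto simp: truncate_to_def indicator_def)
  ultimately show "(\<lambda>y. truncate_to s f (?P y)) \<in> borel_measurable borel" by simp
qed

text \<open>Following the corner chart by \<open>simplex_iso\<close> gives the affine
  parametrisation evaluated at \<open>simplex_coords\<close>; truncation changes nothing since
  almost all of the measure lies over the corner.\<close>

lemma integral_simplex_volume:
  fixes K :: "'a::real_normed_vector set set"
  assumes s: "s \<in> K" "finite s" "card s = Suc n" and f: "continuous_map (complex_topology K) euclideanreal f"
  shows "(\<integral>x. f x \<partial>distr (std_volume n) (borel_of (complex_topology K)) (simplex_iso n s)) =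
    simplex_integral (truncate_to s f) n s"
proof -
  let ?X = "borel_of (complex_topology K)" and ?H = "convex hull (std_vertices n)"
  let ?U = "uniform_measure (cube_measure n) (corner n)"
  let ?P = "\<lambda>y :: nat \<Rightarrow> real. \<Sum>i\<le>n. y i *\<^sub>R numbering n s i"
  let ?F = "truncate_to s f"
  have fm: "f \<in> borel_measurable ?X" using f by (rule continuous_map_borel_of_measurable)
  have bij: "bij_betw (numbering n s) {..n} s" using numbering_bij s by blast
  have F: "simplex_measurable ?F"
    using continuous_map_complex_topology_on_hull[OF f s(1)] by (rule truncate_simplex_measurable[OF s(2)])
  have iso: "simplex_iso n s \<in> measurable (restrict_space borel ?H) ?X" by (rule simplex_iso_measurable[OF s])
  then have isov: "simplex_iso n s \<in> measurable (std_volume n) ?X"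
    unfolding std_volume_def by simp
  note cc = corner_chart_restrict_measurable[of n]
  have "(\<integral>x. f x \<partial>distr (std_volume n) ?X (simplex_iso n s)) = (\<integral>z. f (simplex_iso n s z) \<partial>std_volume n)"
    by (rule integral_distr[OF isov fm])
  also have "\<dots> = (\<integral>x. f (simplex_iso n s (corner_chart n x)) \<partial>restrict_space ?U (corner n))"
    unfolding std_volume_def by (rule integral_distr[OF cc measurable_compose[OF iso fm]])
  also have "\<dots> = (\<integral>x. indicator (corner n) x *\<^sub>R f (simplex_iso n s (corner_chart n x)) \<partial>?U)"
    by (rule integral_restrict_space) (simp add: sets.Int)
  also have "\<dots> = (\<integral>x. indicator (corner n) x *\<^sub>R ?F (?P (simplex_coords n x)) \<partial>?U)"
  proof (rule Bochner_Integration.integral_cong[OF refl])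
    fix x
    have "simplex_iso n s (corner_chart n x) = ?P (simplex_coords n x)"
      by (simp add: simplex_iso_eq lookup_corner_chart)
    then show "indicator (corner n) x *\<^sub>R f (simplex_iso n s (corner_chart n x)) =
        indicator (corner n) x *\<^sub>R ?F (?P (simplex_coords n x))"
      using simplex_iso_in_hull[OF s(2,3) corner_chart_in_hull[of x n]] by (simp add: truncate_to_def indicator_def)
  qed
  also have "\<dots> = (\<integral>x. ?F (?P (simplex_coords n x)) \<partial>?U)"
  proof (rule integral_cong_AE)
    have m: "(\<lambda>x. ?F (?P (simplex_coords n x))) \<in> borel_measurable ?U"
      using measurable_compose[OF measurable_simplex_coords simplex_measurableD(1)[OF F]] by simp
    then show "(\<lambda>x. ?F (?P (simplex_coords n x))) \<in> borel_measurable ?U" .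
    show "(\<lambda>x. indicator (corner n) x *\<^sub>R ?F (?P (simplex_coords n x))) \<in> borel_measurable ?U"
      using m by (intro borel_measurable_scaleR borel_measurable_indicator) auto
    have "AE x in ?U. x \<in> corner n" by (rule AE_uniform_measureI) auto
    then show "AE x in ?U. indicator (corner n) x *\<^sub>R ?F (?P (simplex_coords n x)) = ?F (?P (simplex_coords n x))"
      by eventually_elim simp
  qed
  also have "\<dots> = (\<integral>y. ?F (?P y) \<partial>bary_measure n)"
    unfolding bary_measure_def
    by (rule integral_distr[symmetric, OF _ simplex_measurableD(1)[OF F]]) simp
  finally show ?thesis unfolding simplex_integral_eq[OF F bij] param_integral_def .
qed

text \<open>The set function passed to \<open>measure_of\<close> has to be checked to be a measure;
  countable additivity comes from exchanging the series with the \<open>count_space\<close>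
  integral.\<close>

lemma emeasure_complex_volume:
  assumes "A \<in> sets (borel_of (complex_topology K))"
  shows "emeasure (complex_volume n K) A =
    (\<integral>\<^sup>+s. emeasure (distr (std_volume n) (borel_of (complex_topology K)) (simplex_iso n s)) A \<partial>count_space (simplices n K))"
  unfolding complex_volume_def
proof (rule emeasure_measure_of_sigma)
  let ?X = "borel_of (complex_topology K)"
  show "sigma_algebra (realization K) (sets ?X)"
    using sets.sigma_algebra_axioms[of ?X] by simp
  show "A \<in> sets ?X" by (rule assms)
  show "positive (sets ?X) (\<lambda>A. \<integral>\<^sup>+s. emeasure (distr (std_volume n) ?X (simplex_iso n s)) A \<partial>count_space (simplices n K))"
    by (simp add: positive_def)
  show "countably_additive (sets ?X) (\<lambda>A. \<integral>\<^sup>+s. emeasure (distr (std_volume n) ?X (simplex_iso n s)) A \<partial>count_space (simplices n K))"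
  proof (rule countably_additiveI)
    fix A :: "nat \<Rightarrow> 'a set" assume A: "range A \<subseteq> sets ?X" "disjoint_family A"
    have "suminf (\<lambda>i. \<integral>\<^sup>+s. emeasure (distr (std_volume n) ?X (simplex_iso n s)) (A i) \<partial>count_space (simplices n K)) =
        (\<integral>\<^sup>+s. suminf (\<lambda>i. emeasure (distr (std_volume n) ?X (simplex_iso n s)) (A i)) \<partial>count_space (simplices n K))"
      by (rule nn_integral_suminf[symmetric]) simp
    then show "suminf (\<lambda>i. \<integral>\<^sup>+s. emeasure (distr (std_volume n) ?X (simplex_iso n s)) (A i) \<partial>count_space (simplices n K)) =
        (\<integral>\<^sup>+s. emeasure (distr (std_volume n) ?X (simplex_iso n s)) (\<Union>(range A)) \<partial>count_space (simplices n K))"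
      using A by (simp add: suminf_emeasure)
  qed
qed

lemma sets_complex_volume [simp]: "sets (complex_volume n K) = sets (borel_of (complex_topology K))"
proof -
  have "sets (borel_of (complex_topology K)) \<subseteq> Pow (realization K)"
    using sets.space_closed[of "borel_of (complex_topology K)"] by simp
  moreover have "sigma_sets (realization K) (sets (borel_of (complex_topology K))) = sets (borel_of (complex_topology K))"
    using sets.sigma_sets_eq[of "borel_of (complex_topology K)"] by simp
  ultimately show ?thesis unfolding complex_volume_def by (simp add: sets_measure_of)
qed

text \<open>Induction from indicators upwards: each closure step, monotone limits included, commutes
  with the outer \<open>count_space\<close> integral, whatever the size of the index set.\<close>

lemma nn_integral_complex_volume:
  assumes "g \<in> borel_measurable (borel_of (complex_topology K))"
  shows "(\<integral>\<^sup>+x. g x \<partial>complex_volume n K) =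
    (\<integral>\<^sup>+s. (\<integral>\<^sup>+x. g x \<partial>distr (std_volume n) (borel_of (complex_topology K)) (simplex_iso n s)) \<partial>count_space (simplices n K))"
  using assms
proof (induction rule: borel_measurable_induct)
  case (cong f g)
  let ?X = "borel_of (complex_topology K)"
  have sp: "space (complex_volume n K) = space ?X" by (rule sets_eq_imp_space_eq) simp
  have "(\<integral>\<^sup>+x. f x \<partial>complex_volume n K) = (\<integral>\<^sup>+x. g x \<partial>complex_volume n K)"
    using cong(3) by (intro nn_integral_cong) (simp add: sp)
  moreover have "(\<integral>\<^sup>+x. f x \<partial>distr (std_volume n) ?X h) = (\<integral>\<^sup>+x. g x \<partial>distr (std_volume n) ?X h)" for h
    using cong(3) by (intro nn_integral_cong) simp
  ultimately show ?case using cong(4) by simp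
next
  case (set A)
  then show ?case by (simp add: emeasure_complex_volume)
next
  case (mult u c)
  then show ?case by (simp add: nn_integral_cmult cong: measurable_cong_sets)
next
  case (add u v)
  then show ?case by (simp add: nn_integral_add cong: measurable_cong_sets)
next
  case (seq U)
  let ?X = "borel_of (complex_topology K)"
  have sup: "(\<integral>\<^sup>+x. (SUP i. U i) x \<partial>M) = (SUP i. \<integral>\<^sup>+x. U i x \<partial>M)" if "sets M = sets ?X" for M
    unfolding SUP_apply using seq(1) \<open>incseq U\<close> that
    by (intro nn_integral_monotone_convergence_SUP) (auto cong: measurable_cong_sets)
  have inc: "incseq (\<lambda>i s. \<integral>\<^sup>+x. U i x \<partial>distr (std_volume n) ?X (simplex_iso n s))"
    using \<open>incseq U\<close> by (auto simp: incseq_def le_fun_def intro!: nn_integral_mono)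
  show ?case
    unfolding sup[OF sets_complex_volume] sup[OF sets_distr] seq.IH
    using nn_integral_monotone_convergence_SUP[OF inc, of "count_space (simplices n K)"] by simp
qed

text \<open>Only finitely many simplices meet the support, so the positive and negative parts are
  finite sums of finite integrals and may be subtracted term by term.\<close>

lemma integral_complex_volume:
  fixes K :: "'a::real_normed_vector set set"
  assumes K: "geometric_complex K" and f: "continuous_map (complex_topology K) euclideanreal f"
    and fin: "finite {s \<in> K. \<exists>x\<in>convex hull s. f x \<noteq> 0}"
  shows "(\<integral>x. f x \<partial>complex_volume n K) =
    (\<Sum>s | s \<in> simplices n K \<and> (\<exists>x\<in>convex hull s. f x \<noteq> 0). simplex_integral (truncate_to s f) n s)"
proof -
  let ?X = "borel_of (complex_topology K)"
  let ?\<mu> = "\<lambda>s. distr (std_volume n) ?X (simplex_iso n s)"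
  let ?S = "{s \<in> simplices n K. \<exists>x\<in>convex hull s. f x \<noteq> 0}"
  have fm [measurable]: "f \<in> borel_measurable ?X" using f by (rule continuous_map_borel_of_measurable)
  have finS: "finite ?S" using fin by (rule finite_subset[rotated]) (auto simp: simplices_def)
  have sK: "s \<in> K" "finite s" "card s = Suc n" if "s \<in> simplices n K" for s
    using that bary_complexD(1)[OF geometric_bary_complex[OF K]] by (auto simp: simplices_def)
  have "\<forall>s\<in>?S. \<exists>B. \<forall>x\<in>convex hull s. \<bar>f x\<bar> \<le> B"
  proof
    fix s assume "s \<in> ?S"
    then have s: "s \<in> simplices n K" by simp
    have "compact (f ` (convex hull s))"
      using continuous_map_complex_topology_on_hull[OF f sK(1)[OF s]] finite_imp_compact_convex_hull[OF sK(2)[OF s]]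
      by (rule compact_continuous_image)
    then have "bounded (f ` (convex hull s))" by (rule compact_imp_bounded)
    then show "\<exists>B. \<forall>x\<in>convex hull s. \<bar>f x\<bar> \<le> B" by (auto simp: bounded_iff)
  qed
  from bchoice[OF this] obtain B where B0: "\<forall>s\<in>?S. \<forall>x\<in>convex hull s. \<bar>f x\<bar> \<le> B s" by (elim exE)
  have B: "\<bar>f x\<bar> \<le> B s" if "s \<in> ?S" "x \<in> convex hull s" for s x
    using B0[THEN bspec, OF that(1), THEN bspec, OF that(2)] .
  have isov: "simplex_iso n s \<in> measurable (std_volume n) ?X" if "s \<in> simplices n K" for s
    using simplex_iso_measurable[OF sK[OF that]] unfolding std_volume_def by simp
  have iso_hull: "simplex_iso n s z \<in> convex hull s" if "s \<in> simplices n K" "z \<in> space (std_volume n)" for s z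
    using simplex_iso_in_hull[OF sK(2,3)[OF that(1)]] that(2) by simp
  have zero: "(\<integral>\<^sup>+x. ennreal (g (f x)) \<partial>?\<mu> s) = 0"
    if "s \<in> simplices n K" "s \<notin> ?S" "g 0 = 0" "g \<in> borel_measurable borel" for s and g :: "real \<Rightarrow> real"
  proof -
    have "(\<lambda>x. ennreal (g (f x))) \<in> borel_measurable ?X" using measurable_compose[OF fm that(4)] by simp
    then have "(\<integral>\<^sup>+x. ennreal (g (f x)) \<partial>?\<mu> s) = (\<integral>\<^sup>+z. ennreal (g (f (simplex_iso n s z))) \<partial>std_volume n)"
      by (intro nn_integral_distr isov that) simp
    also have "\<dots> = (\<integral>\<^sup>+z. 0 \<partial>std_volume n)"
      using iso_hull[OF that(1)] that(1,2,3) by (intro nn_integral_cong) auto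
    finally show ?thesis by simp
  qed
  \<comment> \<open>Applied below to the identity, to negation and to the absolute value;
    \<open>g 0 = 0\<close> removes the simplices on which \<open>f\<close> vanishes.\<close>
  have sum: "(\<integral>\<^sup>+x. ennreal (g (f x)) \<partial>complex_volume n K) = (\<Sum>s\<in>?S. \<integral>\<^sup>+x. ennreal (g (f x)) \<partial>?\<mu> s)"
    if "g 0 = 0" "g \<in> borel_measurable borel" for g :: "real \<Rightarrow> real"
  proof -
    have "(\<lambda>x. ennreal (g (f x))) \<in> borel_measurable ?X" using measurable_compose[OF fm that(2)] by simp
    then have "(\<integral>\<^sup>+x. ennreal (g (f x)) \<partial>complex_volume n K) =
        (\<integral>\<^sup>+s. (\<integral>\<^sup>+x. ennreal (g (f x)) \<partial>?\<mu> s) \<partial>count_space (simplices n K))"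
      by (rule nn_integral_complex_volume)
    also have "\<dots> = (\<Sum>s\<in>?S. \<integral>\<^sup>+x. ennreal (g (f x)) \<partial>?\<mu> s)"
      by (rule nn_integral_count_space'[OF finS]) (auto intro: zero that)
    finally show ?thesis .
  qed
  have int: "integrable (?\<mu> s) f" if s: "s \<in> ?S" for s
  proof -
    have sn: "s \<in> simplices n K" using s by simp
    interpret finite_measure "std_volume n" by (rule finite_measureI) (simp add: emeasure_std_volume del: space_std_volume)
    have "integrable (std_volume n) (\<lambda>z. f (simplex_iso n s z))"
      using B[OF s iso_hull[OF sn]] by (intro integrable_const_bound[where B = "B s"] AE_I2 measurable_compose[OF isov[OF sn] fm]) auto
    then show ?thesis by (simp add: integrable_distr_eq[OF isov[OF sn] fm])
  qed
  have fin_pos: "(\<integral>\<^sup>+x. ennreal (f x) \<partial>?\<mu> s) < \<infinity>" "(\<integral>\<^sup>+x. ennreal (- f x) \<partial>?\<mu> s) < \<infinity>"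
      "(\<integral>\<^sup>+x. ennreal \<bar>f x\<bar> \<partial>?\<mu> s) < \<infinity>" if "s \<in> ?S" for s
  proof -
    have "(\<integral>\<^sup>+x. ennreal (norm (f x)) \<partial>?\<mu> s) < \<infinity>" using int[OF that] unfolding integrable_iff_bounded by simp
    then show a: "(\<integral>\<^sup>+x. ennreal \<bar>f x\<bar> \<partial>?\<mu> s) < \<infinity>" by simp
    show "(\<integral>\<^sup>+x. ennreal (f x) \<partial>?\<mu> s) < \<infinity>" "(\<integral>\<^sup>+x. ennreal (- f x) \<partial>?\<mu> s) < \<infinity>"
      by (rule le_less_trans[OF _ a], intro nn_integral_mono ennreal_leI, simp)+
  qed
  have fV: "f \<in> borel_measurable (complex_volume n K)"
    using fm by (simp cong: measurable_cong_sets)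
  have intV: "integrable (complex_volume n K) f"
  proof (rule integrableI_bounded[OF fV])
    have "(\<integral>\<^sup>+x. ennreal \<bar>f x\<bar> \<partial>complex_volume n K) < \<infinity>"
      using sum[of abs] fin_pos(3) finS by (simp add: ennreal_sum_less_top)
    then show "(\<integral>\<^sup>+x. ennreal (norm (f x)) \<partial>complex_volume n K) < \<infinity>" by simp
  qed
  have e2r: "enn2real (\<Sum>s\<in>?S. h s) = (\<Sum>s\<in>?S. enn2real (h s))" if "\<And>s. s \<in> ?S \<Longrightarrow> h s < \<infinity>" for h :: "'a set \<Rightarrow> ennreal"
    using enn2real_sum[of ?S h] that by (simp add: comp_def)
  have "(\<integral>x. f x \<partial>complex_volume n K) =
      enn2real (\<Sum>s\<in>?S. \<integral>\<^sup>+x. ennreal (f x) \<partial>?\<mu> s) - enn2real (\<Sum>s\<in>?S. \<integral>\<^sup>+x. ennreal (- f x) \<partial>?\<mu> s)"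
    unfolding real_lebesgue_integral_def[OF intV] using sum[of "\<lambda>x. x"] sum[of uminus] by simp
  also have "\<dots> = (\<Sum>s\<in>?S. enn2real (\<integral>\<^sup>+x. ennreal (f x) \<partial>?\<mu> s) - enn2real (\<integral>\<^sup>+x. ennreal (- f x) \<partial>?\<mu> s))"
    using e2r[of "\<lambda>s. \<integral>\<^sup>+x. ennreal (f x) \<partial>?\<mu> s", OF fin_pos(1)]
      e2r[of "\<lambda>s. \<integral>\<^sup>+x. ennreal (- f x) \<partial>?\<mu> s", OF fin_pos(2)] by (simp only: sum_subtractf)
  also have "\<dots> = (\<Sum>s\<in>?S. \<integral>x. f x \<partial>?\<mu> s)"
    by (intro sum.cong refl real_lebesgue_integral_def[symmetric] int)
  also have "\<dots> = (\<Sum>s\<in>?S. simplex_integral (truncate_to s f) n s)"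
    using sK by (intro sum.cong refl integral_simplex_volume[OF _ _ _ f]) auto
  finally show ?thesis .
qed

subsection \<open>Dual blocks and convergence\<close>

lemma flags_card_le:
  assumes K: "bary_complex K" and C: "C \<in> flags K" shows "card C \<le> card (\<Union>C)"
proof -
  have UK: "\<Union>C \<in> K" using flags_Union_mem[OF C] C by (auto simp: flags_def)
  have "C \<in> full_flags (\<Union>C)" using flags_Union_eq[OF K UK] C by blast
  then show ?thesis using full_flags_card_le bary_complexD(1)[OF K UK] by blast
qed

lemma card_funpow_sd_le:
  assumes K: "bary_complex K" and dim: "\<And>s. s \<in> K \<Longrightarrow> card s \<le> Suc n" and "\<sigma> \<in> (sd ^^ d) K"
  shows "card \<sigma> \<le> Suc n"
proof -
  obtain s where "s \<in> K" "\<sigma> \<in> pieces d K s" using assms(3) pieces_cover[OF K, of d] by auto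
  then show ?thesis using pieces_card_le[OF K] dim le_trans by blast
qed

lemma face_number_dual_block:
  assumes K: "bary_complex K"
  shows "face_number l (dual_block K \<sigma>) = card {C \<in> flags K. \<Inter>C = \<sigma> \<and> card C = Suc l}"
proof -
  have "simplices l (dual_block K \<sigma>) = (`) barycenter ` {C \<in> flags K. \<Inter>C = \<sigma> \<and> card C = Suc l}"
    unfolding simplices_def dual_block_eq_flags using card_barycenter_image[OF K] by auto
  moreover have "inj_on ((`) barycenter) {C \<in> flags K. \<Inter>C = \<sigma> \<and> card C = Suc l}"
    using flags_image_inj_on[OF K] by (rule inj_on_subset) auto
  ultimately show ?thesis unfolding face_number_def by (simp only: card_image)
qed

text \<open>Flags have at most \<open>n + 1\<close> members, so the family under
  \<open>Sum_any\<close> has finite support and a finite sum may replace it.\<close>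

lemma coeff_block_poly:
  assumes K: "bary_complex K" and dim: "\<And>s. s \<in> K \<Longrightarrow> card s \<le> Suc n"
  shows "coeff (block_poly K \<sigma>) l = real (card {C \<in> flags K. \<Inter>C = \<sigma> \<and> card C = Suc l})"
proof -
  let ?g = "\<lambda>l. monom (real (face_number l (dual_block K \<sigma>))) l"
  have zero: "face_number l (dual_block K \<sigma>) = 0" if "n < l" for l
  proof -
    have "card C \<le> Suc n" if "C \<in> flags K" for C
      using flags_card_le[OF K that] dim[of "\<Union>C"] flags_Union_mem[OF that] that by (force simp: flags_def)
    then have "{C \<in> flags K. \<Inter>C = \<sigma> \<and> card C = Suc l} = {}" using that by fastforce
    then show ?thesis unfolding face_number_dual_block[OF K] by (simp only: card.empty)
  qed
  \<comment> \<open>Taking the maximum with \<open>l\<close> keeps the requested index in the range,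
    also beyond the degree.\<close>
  then have "{l. ?g l \<noteq> 0} \<subseteq> {..max n l}" by (auto simp: monom_eq_0_iff not_less[symmetric] intro: ccontr)
  then have "block_poly K \<sigma> = (\<Sum>k\<le>max n l. ?g k)"
    unfolding block_poly_def by (rule Sum_any.expand_superset[OF finite_atMost])
  then have "coeff (block_poly K \<sigma>) l = (\<Sum>k\<le>max n l. coeff (?g k) l)" by (simp add: coeff_sum)
  also have "\<dots> = real (face_number l (dual_block K \<sigma>))" by (simp add: coeff_monom)
  finally show ?thesis by (simp only: face_number_dual_block[OF K])
qed

section \<open>Flags weighted by their bottoms\<close>

definition bottom_flags :: "nat \<Rightarrow> nat \<Rightarrow> 'a set \<Rightarrow> 'a set set set" where
  "bottom_flags p l \<tau> = {C \<in> full_flags \<tau>. card C = Suc l \<and> card (\<Inter>C) = Suc p}"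

text \<open>The unnormalised contribution of the top \<open>\<tau>\<close> to the coefficient of
  T^l, the evaluation still taking place at the bottoms.\<close>

definition flag_sum :: "('a::real_normed_vector \<Rightarrow> real) \<Rightarrow> nat \<Rightarrow> nat \<Rightarrow> 'a set \<Rightarrow> real" where
  "flag_sum f p l \<tau> = (\<Sum>C\<in>bottom_flags p l \<tau>. f (barycenter (\<Inter>C)))"

text \<open>For a top with \<open>k\<close> vertices this is f_p of a simplex of dimension k-1 times
  lambda_{h,l} with h = k-1-p. Where the subtraction is truncated, the binomial coefficient is
  zero.\<close>

definition flag_count :: "nat \<Rightarrow> nat \<Rightarrow> nat \<Rightarrow> nat" where
  "flag_count p l k = (k choose Suc p) * interior_number (k - Suc p) l"

lemma card_bottom_flags: "finite \<tau> \<Longrightarrow> card (bottom_flags p l \<tau>) = flag_count p l (card \<tau>)"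
  unfolding bottom_flags_def flag_count_def by (rule card_full_flags_bottom)

lemma barycenter_Inter_in_hull:
  assumes K: "bary_complex K" and C: "C \<in> flags K"
  shows "barycenter (\<Inter>C) \<in> convex hull (\<Union>C)"
proof -
  have I: "\<Inter>C \<in> C" using flags_Inter_mem[OF C] .
  then have IK: "\<Inter>C \<in> K" using C by (auto simp: flags_def)
  have "barycenter (\<Inter>C) \<in> convex hull (\<Inter>C)" using bary_complexD(1,2)[OF K IK] by (rule barycenter_in_hull)
  moreover have "convex hull (\<Inter>C) \<subseteq> convex hull (\<Union>C)" using I by (intro hull_mono) blast
  ultimately show ?thesis by blast
qed

text \<open>The barycenter of the bottom of a flag lies in the hull of its top, so every evaluation
  point stays within the region of approximation.\<close>

lemma flag_sum_approx:
  assumes K: "bary_complex K" and \<tau>: "\<tau> \<in> K" and approx: "\<And>x. x \<in> convex hull \<tau> \<Longrightarrow> \<bar>f x - c\<bar> \<le> e"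
  shows "\<bar>flag_sum f p l \<tau> - c * real (flag_count p l (card \<tau>))\<bar> \<le> e * real (flag_count p l (card \<tau>))"
proof -
  let ?T = "bottom_flags p l \<tau>"
  have fin: "finite \<tau>" using bary_complexD(1)[OF K \<tau>] .
  have "barycenter (\<Inter>C) \<in> convex hull \<tau>" if "C \<in> ?T" for C
  proof -
    have C: "C \<in> full_flags \<tau>" using that by (simp add: bottom_flags_def)
    then have "C \<in> flags K" using full_flags_subset_flags[OF K \<tau>] by blast
    from barycenter_Inter_in_hull[OF K this] show ?thesis using full_flagsD(6)[OF C] by simp
  qed
  then have "\<bar>\<Sum>C\<in>?T. f (barycenter (\<Inter>C)) - c\<bar> \<le> (\<Sum>C\<in>?T. e)"
    using approx by (intro order_trans[OF sum_abs] sum_mono) auto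
  then show ?thesis unfolding flag_sum_def card_bottom_flags[OF fin, symmetric]
    by (simp add: sum_subtractf mult.commute)
qed

text \<open>The number of flags whose top is a piece of level \<open>e\<close>. It depends on the
  subdivided simplex only through its number \<open>k\<close> of vertices; this is the
  equidistribution among pieces of equal dimension.\<close>

definition piece_flag_count :: "nat \<Rightarrow> nat \<Rightarrow> nat \<Rightarrow> nat \<Rightarrow> nat" where
  "piece_flag_count p l e k = (\<Sum>i\<le>k. piece_number e k i * flag_count p l i)"

lemma sum_pieces_flag_count:
  assumes K: "bary_complex K" and s: "s \<in> K"
  shows "(\<Sum>\<rho>\<in>pieces e K s. flag_count p l (card \<rho>)) = piece_flag_count p l e (card s)"
  using sum_by_card[OF finite_pieces[OF K s], of e card "card s" "flag_count p l"] pieces_card_le[OF K s]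
  by (simp add: card_pieces[OF K s] piece_flag_count_def)

lemma sum_pieces_flag_sum_approx:
  assumes K: "bary_complex K" and \<tau>: "\<tau> \<in> K" and approx: "\<And>x. x \<in> convex hull \<tau> \<Longrightarrow> \<bar>f x - c\<bar> \<le> b"
  shows "\<bar>(\<Sum>\<rho>\<in>pieces e K \<tau>. flag_sum f p l \<rho>) - c * real (piece_flag_count p l e (card \<tau>))\<bar>
    \<le> b * real (piece_flag_count p l e (card \<tau>))"
proof -
  have "\<bar>flag_sum f p l \<rho> - c * real (flag_count p l (card \<rho>))\<bar> \<le> b * real (flag_count p l (card \<rho>))"
    if \<rho>: "\<rho> \<in> pieces e K \<tau>" for \<rho>
  proof (rule flag_sum_approx)
    show "bary_complex ((sd ^^ e) K)" using K by (rule funpow_sd_bary_complex)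
    show "\<rho> \<in> (sd ^^ e) K" using \<rho> pieces_subset[OF \<tau>] by blast
    show "\<And>x. x \<in> convex hull \<rho> \<Longrightarrow> \<bar>f x - c\<bar> \<le> b" using approx pieces_hull[OF K \<rho>] by blast
  qed
  then have "\<bar>\<Sum>\<rho>\<in>pieces e K \<tau>. flag_sum f p l \<rho> - c * real (flag_count p l (card \<rho>))\<bar>
      \<le> (\<Sum>\<rho>\<in>pieces e K \<tau>. b * real (flag_count p l (card \<rho>)))"
    by (intro order_trans[OF sum_abs] sum_mono)
  then show ?thesis unfolding sum_pieces_flag_count[OF K \<tau>, symmetric]
    by (simp add: sum_subtractf sum_distrib_left)
qed

text \<open>Starting at \<open>h = 0\<close> instead of \<open>h = l\<close> adds only zero terms
  and gives the same index set for every \<open>l\<close>.\<close>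

definition limit_coeff :: "nat \<Rightarrow> nat \<Rightarrow> nat \<Rightarrow> real" where
  "limit_coeff n p l = (\<Sum>h\<le>n - p. limit_face_density (p + h) n * real (face_number p (std_simplex (p + h))) * real (interior_number h l))"

lemma interior_number_eq_0: "h < l \<Longrightarrow> interior_number h l = 0"
  using interior_number_eq_flag_number[of h l] flag_number_eq_0[of h l]
  by (cases "h = 0") (auto simp: interior_number_def)

lemma limit_coeff_eq:
  "limit_coeff n p l = coeff (\<Sum>l=0..n - p. monom (\<Sum>h=l..n - p. limit_face_density (p + h) n
      * real (face_number p (std_simplex (p + h))) * real (interior_number h l)) l) l"
proof -
  let ?g = "\<lambda>l h. limit_face_density (p + h) n * real (face_number p (std_simplex (p + h))) * real (interior_number h l)"
  have "limit_coeff n p l = (\<Sum>h=l..n - p. ?g l h)"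
    unfolding limit_coeff_def by (rule sum.mono_neutral_right) (auto simp: interior_number_eq_0)
  moreover have "coeff (\<Sum>l=0..n - p. monom (\<Sum>h=l..n - p. ?g l h) l) l = (\<Sum>h=l..n - p. ?g l h)"
    by (cases "l \<le> n - p") (auto simp: coeff_sum coeff_monom)
  ultimately show ?thesis by simp
qed

lemma limit_face_density_nonneg: "p \<le> n \<Longrightarrow> 0 \<le> limit_face_density p n"
  using limit_piece_density[of p n "Suc n"] by (intro LIMSEQ_le_const[of _ _ 0]) auto

text \<open>Keeps \<open>ennreal\<close> in \<open>poly_times_measure\<close> from cutting the
  coefficient off at zero.\<close>

lemma limit_coeff_nonneg: "p \<le> n \<Longrightarrow> 0 \<le> limit_coeff n p l"
  unfolding limit_coeff_def by (intro sum_nonneg mult_nonneg_nonneg limit_face_density_nonneg) auto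

text \<open>Tops with fewer than \<open>p + 1\<close> vertices carry no such flag. Each remaining
  number of vertices contributes the density of such tops times a constant flag count, which
  produces the coefficient of the theorem.\<close>

lemma piece_flag_count_limit:
  assumes p: "p \<le> n" and k: "k \<le> Suc n"
  shows "(\<lambda>e. real (piece_flag_count p l e k) / fact (Suc n) ^ e) \<longlonglongrightarrow> (if k = Suc n then limit_coeff n p l else 0)"
proof -
  let ?N = "fact (Suc n) :: real"
  have fc0: "flag_count p l i = 0" if "i < Suc p" for i using that by (simp add: flag_count_def)
  have eq: "piece_flag_count p l e k = (\<Sum>h\<le>n - p. piece_number e k (Suc (p + h)) * flag_count p l (Suc (p + h)))" for e
  proof -
    have "piece_flag_count p l e k = (\<Sum>i\<le>Suc n. piece_number e k i * flag_count p l i)"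
      unfolding piece_flag_count_def using k piece_number_eq_0 by (intro sum.mono_neutral_left) auto
    also have "\<dots> = (\<Sum>i\<in>{Suc p..Suc n}. piece_number e k i * flag_count p l i)"
      using fc0 by (intro sum.mono_neutral_right) auto
    also have "\<dots> = (\<Sum>h\<le>n - p. piece_number e k (Suc (p + h)) * flag_count p l (Suc (p + h)))"
      by (rule sum.reindex_bij_witness[of _ "\<lambda>h. Suc (p + h)" "\<lambda>i. i - Suc p"]) (use p in auto)
    finally show ?thesis .
  qed
  have fc: "real (flag_count p l (Suc (p + h))) = real (face_number p (std_simplex (p + h))) * real (interior_number h l)" for h
    by (simp add: flag_count_def face_number_std_simplex)
  have "(\<lambda>e. \<Sum>h\<le>n - p. real (piece_number e k (Suc (p + h))) / ?N ^ e * real (flag_count p l (Suc (p + h))))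
      \<longlonglongrightarrow> (\<Sum>h\<le>n - p. (if k = Suc n then limit_face_density (p + h) n else 0) * real (flag_count p l (Suc (p + h))))"
    using p k by (intro tendsto_sum tendsto_mult tendsto_const limit_piece_density) auto
  moreover have "(\<Sum>h\<le>n - p. (if k = Suc n then limit_face_density (p + h) n else 0) * real (flag_count p l (Suc (p + h))))
      = (if k = Suc n then limit_coeff n p l else 0)"
    unfolding limit_coeff_def fc by (simp add: mult.assoc)
  moreover have "real (piece_flag_count p l e k) / ?N ^ e =
      (\<Sum>h\<le>n - p. real (piece_number e k (Suc (p + h))) / ?N ^ e * real (flag_count p l (Suc (p + h))))" for e
    unfolding eq by (simp add: sum_divide_distrib del: fact_Suc)
  ultimately show ?thesis by simp
qed

text \<open>Uniform continuity on the compact hull together with the geometric decay of the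
  mesh.\<close>

lemma eventually_small_oscillation:
  assumes K: "bary_complex K" and s: "s \<in> K" "card s \<le> Suc n" and f: "continuous_on (convex hull s) f" and e: "0 < e"
  shows "\<forall>\<^sub>F m in sequentially. \<forall>\<tau>\<in>pieces m K s. \<forall>x\<in>convex hull \<tau>. \<forall>y\<in>convex hull \<tau>. \<bar>f x - f y\<bar> \<le> (e::real)"
proof -
  have fin: "finite s" using bary_complexD(1)[OF K s(1)] .
  have comp: "compact (convex hull s)" using fin by (rule finite_imp_compact_convex_hull)
  obtain \<delta> where \<delta>: "0 < \<delta>" "\<And>x y. x \<in> convex hull s \<Longrightarrow> y \<in> convex hull s \<Longrightarrow> dist x y < \<delta> \<Longrightarrow> dist (f x) (f y) < e"
    using compact_uniformly_continuous[OF f comp] e unfolding uniformly_continuous_on_def by metis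
  define D where "D = diameter s"
  have D: "norm (v - w) \<le> D" if "v \<in> s" "w \<in> s" for v w
    using diameter_bounded_bound[OF finite_imp_bounded[OF fin] that] by (simp add: D_def dist_norm)
  have "(\<lambda>m. (real n / real (Suc n)) ^ m * D) \<longlonglongrightarrow> 0 * D"
    by (intro tendsto_mult LIMSEQ_power_zero tendsto_const) auto
  then have "\<forall>\<^sub>F m in sequentially. (real n / real (Suc n)) ^ m * D < \<delta>"
    using \<delta>(1) by (intro order_tendstoD) auto
  then show ?thesis
  proof eventually_elim
    case (elim m)
    show ?case
    proof (intro ballI)
      fix \<tau> x y assume \<tau>: "\<tau> \<in> pieces m K s" and xy: "x \<in> convex hull \<tau>" "y \<in> convex hull \<tau>"
      have "dist x y \<le> (real n / real (Suc n)) ^ m * D"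
        using pieces_mesh[OF K s D \<tau>] xy by (intro hull_dist_le) auto
      then have "dist (f x) (f y) < e" using elim xy pieces_hull[OF K \<tau>] by (intro \<delta>(2)) auto
      then show "\<bar>f x - f y\<bar> \<le> e" by (simp add: dist_real_def)
    qed
  qed
qed

text \<open>Here the bottom index is exchanged for the top index. The coefficients of the block
  polynomials expand the integral into a sum over flags, which is then regrouped by tops and by the
  simplices of \<open>K\<close> carrying those tops.\<close>

lemma integral_dual_block_measure:
  fixes K :: "'a::real_normed_vector set set"
  assumes K: "bary_complex K" and dim: "\<And>s. s \<in> K \<Longrightarrow> card s \<le> Suc n"
    and f: "f \<in> borel_measurable (borel_of (complex_topology K))"
    and fin: "finite {s \<in> K. \<exists>x\<in>convex hull s. f x \<noteq> 0}"
  shows "(\<integral>x. f x \<partial>dual_block_measure n d p K l) =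
    (\<Sum>s | s \<in> K \<and> (\<exists>x\<in>convex hull s. f x \<noteq> 0). \<Sum>\<tau>\<in>pieces d K s. flag_sum f p l \<tau>) / fact (Suc n) ^ d"
proof -
  let ?L = "(sd ^^ d) K"
  let ?S = "{s \<in> K. \<exists>x\<in>convex hull s. f x \<noteq> 0}"
  let ?Q = "{\<sigma> \<in> simplices p ?L. f (barycenter \<sigma>) \<noteq> 0}"
  let ?w = "\<lambda>\<sigma>. coeff (block_poly ?L \<sigma>) l"
  have L: "bary_complex ?L" using K by (rule funpow_sd_bary_complex)
  have w: "?w \<sigma> = real (card {C \<in> flags ?L. \<Inter>C = \<sigma> \<and> card C = Suc l})" for \<sigma>
    by (rule coeff_block_poly[OF L card_funpow_sd_le[OF K dim]])
  define R where "R = (\<Union>s\<in>?S. pieces d K s)"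
  have finR: "finite R" unfolding R_def using fin finite_pieces[OF K] by blast
  have RL: "R \<subseteq> ?L" unfolding R_def using pieces_subset by blast
  have in_R: "\<tau> \<in> R" if \<tau>: "\<tau> \<in> ?L" "x \<in> convex hull \<tau>" "f x \<noteq> 0" for \<tau> x
  proof -
    obtain s where s: "s \<in> K" "\<tau> \<in> pieces d K s" using \<tau>(1) pieces_cover[OF K, of d] by auto
    then show ?thesis using pieces_hull[OF K s(2)] \<tau>(2,3) by (auto simp: R_def)
  qed
  have finQ: "finite ?Q"
  proof (rule finite_subset[OF _ finR])
    show "?Q \<subseteq> R"
    proof
      fix \<sigma> assume \<sigma>: "\<sigma> \<in> ?Q"
      then have \<sigma>L: "\<sigma> \<in> ?L" by (simp add: simplices_def)
      show "\<sigma> \<in> R" using barycenter_in_hull[OF bary_complexD(1,2)[OF L \<sigma>L]] \<sigma> by (intro in_R[OF \<sigma>L]) auto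
    qed
  qed
  \<comment> \<open>Nonvanishing at the bottom is part of the condition in order to keep the set of
    flags finite in an infinite complex.\<close>
  define P where "P C \<longleftrightarrow> card C = Suc l \<and> card (\<Inter>C) = Suc p \<and> f (barycenter (\<Inter>C)) \<noteq> 0" for C
  let ?F = "{C \<in> flags ?L. P C}"
  \<comment> \<open>The evaluation point lies in the hull of the top, so the top meets the set where
    \<open>f\<close> is nonzero and belongs to \<open>R\<close>.\<close>
  have Feq: "?F = (\<Union>\<tau>\<in>R. {C \<in> full_flags \<tau>. P C})"
  proof (intro equalityI subsetI)
    fix C assume C: "C \<in> ?F"
    then have CF: "C \<in> flags ?L" by simp
    have U: "\<Union>C \<in> ?L" using flags_Union_mem[OF CF] CF by (auto simp: flags_def)
    have "\<Union>C \<in> R" using barycenter_Inter_in_hull[OF L CF] C by (intro in_R[OF U]) (auto simp: P_def)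
    moreover have "C \<in> full_flags (\<Union>C)" using flags_Union_eq[OF L U] CF by blast
    ultimately show "C \<in> (\<Union>\<tau>\<in>R. {C \<in> full_flags \<tau>. P C})" using C by blast
  next
    fix C assume "C \<in> (\<Union>\<tau>\<in>R. {C \<in> full_flags \<tau>. P C})"
    then obtain \<tau> where \<tau>: "\<tau> \<in> R" "C \<in> full_flags \<tau>" "P C" by blast
    then have "\<tau> \<in> ?L" using RL by blast
    then have "C \<in> flags ?L" using full_flags_subset_flags[OF L] \<tau>(2) by blast
    then show "C \<in> ?F" using \<tau>(3) by simp
  qed
  have finT: "finite (full_flags \<tau>)" if "\<tau> \<in> R" for \<tau>
    using that RL bary_complexD(1)[OF L] by (intro finite_full_flags) blast
  have finF: "finite ?F" unfolding Feq using finR finT by auto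
  have "(\<Sum>\<sigma>\<in>?Q. ?w \<sigma> * f (barycenter \<sigma>)) = (\<Sum>\<sigma>\<in>?Q. \<Sum>C\<in>{C \<in> ?F. \<Inter>C = \<sigma>}. f (barycenter (\<Inter>C)))"
  proof (rule sum.cong[OF refl])
    fix \<sigma> assume \<sigma>: "\<sigma> \<in> ?Q"
    have "{C \<in> flags ?L. \<Inter>C = \<sigma> \<and> card C = Suc l} = {C \<in> ?F. \<Inter>C = \<sigma>}"
      using \<sigma> by (auto simp: P_def simplices_def)
    then show "?w \<sigma> * f (barycenter \<sigma>) = (\<Sum>C\<in>{C \<in> ?F. \<Inter>C = \<sigma>}. f (barycenter (\<Inter>C)))"
      unfolding w by (simp only:) simp
  qed
  also have "\<dots> = (\<Sum>C\<in>?F. f (barycenter (\<Inter>C)))"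
  proof (rule sum.group[OF finF finQ])
    show "(\<lambda>C. \<Inter>C) ` ?F \<subseteq> ?Q"
    proof (rule image_subsetI)
      fix C assume C: "C \<in> ?F"
      then have "C \<in> flags ?L" by simp
      then have "\<Inter>C \<in> ?L" using flags_Inter_mem by (auto simp: flags_def)
      then show "\<Inter>C \<in> ?Q" using C by (simp add: P_def simplices_def)
    qed
  qed
  also have "\<dots> = (\<Sum>\<tau>\<in>R. \<Sum>C\<in>{C \<in> full_flags \<tau>. P C}. f (barycenter (\<Inter>C)))"
    unfolding Feq
  proof (rule sum.UNION_disjoint[OF finR])
    show "\<forall>\<tau>\<in>R. finite {C \<in> full_flags \<tau>. P C}" using finT by simp
    show "\<forall>\<tau>\<in>R. \<forall>\<tau>'\<in>R. \<tau> \<noteq> \<tau>' \<longrightarrow> {C \<in> full_flags \<tau>. P C} \<inter> {C \<in> full_flags \<tau>'. P C} = {}"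
      using full_flagsD(6) by blast
  qed
  \<comment> \<open>Over each single top the flags with vanishing value can be put back, since there
    are finitely many.\<close>
  also have "\<dots> = (\<Sum>\<tau>\<in>R. flag_sum f p l \<tau>)"
    unfolding flag_sum_def bottom_flags_def
    by (intro sum.cong refl sum.mono_neutral_left) (auto simp: P_def finT)
  also have "\<dots> = (\<Sum>s\<in>?S. \<Sum>\<tau>\<in>pieces d K s. flag_sum f p l \<tau>)"
    unfolding R_def
  proof (rule sum.UNION_disjoint[OF fin])
    show "\<forall>s\<in>?S. finite (pieces d K s)" using finite_pieces[OF K] by blast
    show "\<forall>s\<in>?S. \<forall>t\<in>?S. s \<noteq> t \<longrightarrow> pieces d K s \<inter> pieces d K t = {}" using pieces_disjoint by blast
  qed
  finally show ?thesis
    unfolding dual_block_measure_def using integral_weighted_gamma[OF K f _ finQ, of ?w n] w by simp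
qed

text \<open>At scale \<open>m\<close>, every flag below a top-dimensional piece \<open>\<tau>\<close> may be weighted by the mean value of \<open>f\<close>
  over \<open>\<tau>\<close>, with error \<open>\<epsilon>\<close> per flag; the pieces of lower dimension contribute the \<open>B\<close> term.\<close>

lemma flag_sum_estimate:
  fixes K :: "'a::real_normed_vector set set" and p l :: nat
  assumes K: "bary_complex K" and s: "s \<in> K" "card s \<le> Suc n" and f: "continuous_on (convex hull s) f"
    and osc: "\<And>\<tau> x y. \<tau> \<in> pieces m K s \<Longrightarrow> x \<in> convex hull \<tau> \<Longrightarrow> y \<in> convex hull \<tau> \<Longrightarrow> \<bar>f x - f y\<bar> \<le> \<epsilon>"
    and \<epsilon>: "0 \<le> \<epsilon>" and B: "\<And>x. x \<in> convex hull s \<Longrightarrow> \<bar>f x\<bar> \<le> B"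
  defines "Z \<equiv> \<lambda>e k. real (piece_flag_count p l e k)"
  shows "\<bar>(\<Sum>\<rho>\<in>pieces (e + m) K s. flag_sum f p l \<rho>)
      - (if card s = Suc n then Z e (Suc n) * fact (Suc n) ^ m * simplex_integral (truncate_to s f) n s else 0)\<bar>
    \<le> \<epsilon> * fact (Suc n) ^ m * Z e (Suc n) + B * (\<Sum>\<tau> | \<tau> \<in> pieces m K s \<and> card \<tau> \<le> n. Z e (card \<tau>))"
proof -
  let ?P = "pieces m K s" and ?L = "(sd ^^ m) K"
  let ?F = "truncate_to s f"
  let ?top = "{\<tau> \<in> ?P. card \<tau> = Suc n}" and ?low = "{\<tau> \<in> ?P. card \<tau> \<le> n}"
  let ?G = "\<lambda>\<tau>. \<Sum>\<rho>\<in>pieces e ?L \<tau>. flag_sum f p l \<rho>"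
  let ?\<Phi> = "\<lambda>\<tau>. simplex_integral ?F n \<tau>"
  have L: "bary_complex ?L" using K by (rule funpow_sd_bary_complex)
  have fins: "finite s" "s \<noteq> {}" using bary_complexD(1,2)[OF K s(1)] .
  have F: "simplex_measurable ?F" by (rule truncate_simplex_measurable[OF fins(1) f])
  have fin: "finite ?P" by (rule finite_pieces[OF K s(1)])
  have PL: "\<tau> \<in> ?L" "finite \<tau>" "\<tau> \<noteq> {}" if "\<tau> \<in> ?P" for \<tau>
    using that pieces_subset[OF s(1)] bary_complexD(1,2)[OF L] by blast+
  have le: "card \<tau> \<le> card s" if "\<tau> \<in> ?P" for \<tau> by (rule pieces_card_le[OF K s(1) that])
  have split: "?P = ?top \<union> ?low" "?top \<inter> ?low = {}" using le s(2) by force+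
  have sum_split: "sum h ?P = sum h ?top + sum h ?low" for h :: "'a set \<Rightarrow> real"
    using split fin by (subst split(1)) (rule sum.union_disjoint, auto)
  have top: "\<bar>?G \<tau> - Z e (Suc n) * ?\<Phi> \<tau>\<bar> \<le> \<epsilon> * Z e (Suc n)" if \<tau>: "\<tau> \<in> ?top" for \<tau>
  proof -
    have \<tau>P: "\<tau> \<in> ?P" "card \<tau> = Suc n" using \<tau> by auto
    have "\<bar>f x - ?\<Phi> \<tau>\<bar> \<le> \<epsilon>" if x: "x \<in> convex hull \<tau>" for x
    proof -
      have "\<bar>?\<Phi> \<tau> - f x\<bar> \<le> \<epsilon>"
        using osc[OF \<tau>P(1) _ x] pieces_hull[OF K \<tau>P(1)]
        by (intro simplex_integral_approx[OF F PL(2)[OF \<tau>P(1)] \<tau>P(2)]) (auto simp: truncate_to_def)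
      then show ?thesis by (simp add: abs_minus_commute)
    qed
    from sum_pieces_flag_sum_approx[OF L PL(1)[OF \<tau>P(1)] this, where p = p and l = l and e = e] show ?thesis
      unfolding Z_def \<tau>P(2) by (simp add: mult.commute)
  qed
  have low: "\<bar>?G \<tau>\<bar> \<le> B * Z e (card \<tau>)" if \<tau>: "\<tau> \<in> ?low" for \<tau>
  proof -
    have \<tau>P: "\<tau> \<in> ?P" using \<tau> by auto
    have "\<bar>f x - 0\<bar> \<le> B" if "x \<in> convex hull \<tau>" for x using B pieces_hull[OF K \<tau>P] that by auto
    from sum_pieces_flag_sum_approx[OF L PL(1)[OF \<tau>P] this, where p = p and l = l and e = e] show ?thesis by (simp add: Z_def)
  qed
  \<comment> \<open>An inequality covers both cases: the bound is attained when \<open>s\<close> has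
    dimension \<open>n\<close>, and there are no top pieces otherwise.\<close>
  have card_top: "real (card ?top) \<le> fact (Suc n) ^ m"
  proof (cases "card s = Suc n")
    case True
    then show ?thesis using card_pieces[OF K s(1), of m "Suc n"] piece_number_diag[of "Suc n" m] by (simp del: fact_Suc)
  next
    case False
    then have "card s < Suc n" using s(2) by simp
    then show ?thesis using card_pieces[OF K s(1), of m "Suc n"] piece_number_eq_0[of "card s" "Suc n" m] by (simp del: fact_Suc)
  qed
  \<comment> \<open>By self-similarity the means over the top pieces add up to (n+1)!^m times the
    mean over \<open>s\<close>.\<close>
  have sum\<Phi>: "(\<Sum>\<tau>\<in>?top. Z e (Suc n) * ?\<Phi> \<tau>) = (if card s = Suc n then Z e (Suc n) * fact (Suc n) ^ m * ?\<Phi> s else 0)"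
  proof (cases "card s = Suc n")
    case True
    then show ?thesis using simplex_integral_pieces[OF F K s(1) True, of m] by (simp add: sum_distrib_left[symmetric] del: fact_Suc)
  next
    case False
    then have "?top = {}" using le s(2) by force
    then show ?thesis using False by (simp only: sum.empty if_False)
  qed
  let ?M = "if card s = Suc n then Z e (Suc n) * fact (Suc n) ^ m * ?\<Phi> s else 0"
  have "\<bar>sum ?G ?top - ?M\<bar> \<le> (\<Sum>\<tau>\<in>?top. \<epsilon> * Z e (Suc n))"
    unfolding sum\<Phi>[symmetric] sum_subtractf[symmetric] by (intro order_trans[OF sum_abs] sum_mono top)
  also have "\<dots> = real (card ?top) * (\<epsilon> * Z e (Suc n))" by simp
  also have "\<dots> \<le> fact (Suc n) ^ m * (\<epsilon> * Z e (Suc n))"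
    using \<epsilon> by (intro mult_right_mono card_top) (simp add: Z_def)
  finally have 1: "\<bar>sum ?G ?top - ?M\<bar> \<le> \<epsilon> * fact (Suc n) ^ m * Z e (Suc n)" by (simp only: mult_ac)
  have "\<bar>sum ?G ?low\<bar> \<le> (\<Sum>\<tau>\<in>?low. B * Z e (card \<tau>))"
    by (intro order_trans[OF sum_abs] sum_mono low)
  then have 2: "\<bar>sum ?G ?low\<bar> \<le> B * (\<Sum>\<tau>\<in>?low. Z e (card \<tau>))" by (simp only: sum_distrib_left)
  have "(\<Sum>\<rho>\<in>pieces (e + m) K s. flag_sum f p l \<rho>) = sum ?G ?top + sum ?G ?low"
    unfolding sum_pieces_add[OF K s(1)] by (rule sum_split)
  then show ?thesis using 1 2 by linarith
qed

text \<open>For fixed \<open>m\<close> the normalised error tends to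
  \<open>\<epsilon> * limit_coeff n p l\<close>, because the flag counts of the finitely many pieces
  with at most \<open>n\<close> vertices vanish in the limit. A single \<open>m\<close> chosen from
  the target accuracy therefore suffices.\<close>

lemma flag_sum_limit:
  fixes f :: "'a::real_normed_vector \<Rightarrow> real"
  assumes K: "bary_complex K" and s: "s \<in> K" "card s \<le> Suc n" and f: "continuous_on (convex hull s) f" and p: "p \<le> n"
  shows "(\<lambda>d. (\<Sum>\<tau>\<in>pieces d K s. flag_sum f p l \<tau>) / fact (Suc n) ^ d)
    \<longlonglongrightarrow> (if card s = Suc n then limit_coeff n p l * simplex_integral (truncate_to s f) n s else 0)"
proof (rule LIMSEQ_I)
  fix r :: real assume r: "0 < r"
  let ?N = "fact (Suc n) :: real"
  let ?c = "limit_coeff n p l" and ?\<Phi> = "simplex_integral (truncate_to s f) n s"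
  let ?Z = "\<lambda>e k. real (piece_flag_count p l e k)"
  let ?S = "\<lambda>d. \<Sum>\<tau>\<in>pieces d K s. flag_sum f p l \<tau>"
  define R where "R = (if card s = Suc n then ?c * ?\<Phi> else 0)"
  have N: "0 < ?N" by simp
  have fins: "finite s" using bary_complexD(1)[OF K s(1)] .
  have c0: "0 \<le> ?c" using p by (rule limit_coeff_nonneg)
  \<comment> \<open>The summand 1 covers a vanishing coefficient, and the factor 2 makes the final
    inequality strict.\<close>
  define \<epsilon> where "\<epsilon> = r / (2 * (?c + 1))"
  have \<epsilon>: "0 < \<epsilon>" "\<epsilon> * ?c < r"
  proof -
    show "0 < \<epsilon>" using r c0 by (simp add: \<epsilon>_def)
    have "\<epsilon> * ?c \<le> \<epsilon> * (?c + 1)" using \<open>0 < \<epsilon>\<close> by (intro mult_left_mono) auto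
    also have "\<dots> = r / 2" using c0 by (simp add: \<epsilon>_def field_simps)
    finally show "\<epsilon> * ?c < r" using r by simp
  qed
  have "bounded (f ` (convex hull s))"
    by (intro compact_imp_bounded compact_continuous_image f finite_imp_compact_convex_hull fins)
  then obtain B where B: "\<And>x. x \<in> convex hull s \<Longrightarrow> \<bar>f x\<bar> \<le> B" by (auto simp: bounded_iff)
  obtain m where m: "\<forall>\<tau>\<in>pieces m K s. \<forall>x\<in>convex hull \<tau>. \<forall>y\<in>convex hull \<tau>. \<bar>f x - f y\<bar> \<le> \<epsilon>"
    using eventually_small_oscillation[OF K s f \<epsilon>(1)] by (auto simp: eventually_sequentially)
  let ?low = "{\<tau> \<in> pieces m K s. card \<tau> \<le> n}"
  define M where "M e = (if card s = Suc n then ?Z e (Suc n) / ?N ^ e * ?\<Phi> else 0)" for e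
  \<comment> \<open>\<open>M\<close> and \<open>E\<close> are the two sides of
    \<open>flag_sum_estimate\<close> divided by \<open>fact (Suc n) ^ (e + m)\<close>. The power
    with exponent \<open>m\<close> cancels except under the lower-dimensional pieces.\<close>
  define E where "E e = \<epsilon> * (?Z e (Suc n) / ?N ^ e) + B * (\<Sum>\<tau>\<in>?low. ?Z e (card \<tau>) / ?N ^ e) / ?N ^ m" for e
  have est: "\<bar>?S (e + m) / ?N ^ (e + m) - M e\<bar> \<le> E e" for e
  proof -
    let ?A = "\<epsilon> * ?N ^ m * ?Z e (Suc n) + B * (\<Sum>\<tau>\<in>?low. ?Z e (card \<tau>))"
    have "\<bar>?S (e + m) - (if card s = Suc n then ?Z e (Suc n) * ?N ^ m * ?\<Phi> else 0)\<bar> \<le> ?A"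
      using m \<epsilon>(1) by (intro flag_sum_estimate[OF K s f _ _ B]) auto
    then have "\<bar>?S (e + m) - (if card s = Suc n then ?Z e (Suc n) * ?N ^ m * ?\<Phi> else 0)\<bar> / ?N ^ (e + m) \<le> ?A / ?N ^ (e + m)"
      by (intro divide_right_mono) auto
    moreover have "\<bar>?S (e + m) - (if card s = Suc n then ?Z e (Suc n) * ?N ^ m * ?\<Phi> else 0)\<bar> / ?N ^ (e + m)
       = \<bar>?S (e + m) / ?N ^ (e + m) - M e\<bar>"
    proof -
      have M: "M e = (if card s = Suc n then ?Z e (Suc n) * ?N ^ m * ?\<Phi> else 0) / ?N ^ (e + m)"
        by (simp add: M_def power_add del: fact_Suc)
      have "\<bar>x - y\<bar> / c = \<bar>x / c - y / c\<bar>" if "0 < c" for x y c :: real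
        using that by (simp add: diff_divide_distrib[symmetric] abs_divide)
      then show ?thesis unfolding M by (simp only: zero_less_power N)
    qed
    moreover have "?A / ?N ^ (e + m) = E e"
      by (simp add: E_def power_add add_divide_distrib sum_divide_distrib[symmetric] del: fact_Suc)
    ultimately show ?thesis by simp
  qed
  have "M \<longlonglongrightarrow> R"
  proof (cases "card s = Suc n")
    case True
    have "(\<lambda>e. ?Z e (Suc n) / ?N ^ e) \<longlonglongrightarrow> ?c" using piece_flag_count_limit[OF p, of "Suc n" l] by (simp del: fact_Suc)
    from tendsto_mult_right[OF this, of ?\<Phi>] show ?thesis using True by (simp only: M_def[abs_def] R_def if_True simp_thms)
  next
    case False
    then show ?thesis by (simp add: M_def[abs_def] R_def)
  qed
  moreover have "E \<longlonglongrightarrow> \<epsilon> * ?c + B * (\<Sum>\<tau>\<in>?low. 0) / ?N ^ m"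
    unfolding E_def
  proof (intro tendsto_intros)
    show "(\<lambda>e. ?Z e (Suc n) / ?N ^ e) \<longlonglongrightarrow> ?c" using piece_flag_count_limit[OF p, of "Suc n" l] by (simp del: fact_Suc)
    show "(\<lambda>e. ?Z e (card \<tau>) / ?N ^ e) \<longlonglongrightarrow> 0" if "\<tau> \<in> ?low" for \<tau>
      using piece_flag_count_limit[OF p, of "card \<tau>" l] that by (simp del: fact_Suc)
  qed simp
  ultimately have "(\<lambda>e. E e + \<bar>M e - R\<bar>) \<longlonglongrightarrow> (\<epsilon> * ?c + B * (\<Sum>\<tau>\<in>?low. 0) / ?N ^ m) + \<bar>R - R\<bar>"
    by (intro tendsto_intros)
  then have "\<forall>\<^sub>F e in sequentially. E e + \<bar>M e - R\<bar> < r"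
    using \<epsilon>(2) by (intro order_tendstoD(2)) auto
  then obtain e0 where e0: "\<And>e. e0 \<le> e \<Longrightarrow> E e + \<bar>M e - R\<bar> < r" by (auto simp: eventually_sequentially)
  show "\<exists>no. \<forall>d\<ge>no. norm (?S d / ?N ^ d - (if card s = Suc n then ?c * ?\<Phi> else 0)) < r"
  proof (intro exI allI impI)
    fix d assume d: "e0 + m \<le> d"
    then have "\<bar>?S d / ?N ^ d - M (d - m)\<bar> \<le> E (d - m)" using est[of "d - m"] by simp
    moreover have "E (d - m) + \<bar>M (d - m) - R\<bar> < r" using d by (intro e0) simp
    ultimately show "norm (?S d / ?N ^ d - (if card s = Suc n then ?c * ?\<Phi> else 0)) < r"
      unfolding R_def[symmetric] real_norm_def by linarith
  qed
qed

theorem theorem6: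
  fixes K :: "'a::real_normed_vector set set" and n p :: nat
  assumes "geometric_complex K"
    and "locally_finite_complex K"
    and "has_dimension K n"
    and "p \<le> n"
  shows "weakly_converges (complex_topology K)
           (\<lambda>d. dual_block_measure n d p K)
           (poly_times_measure
              (\<Sum>l=0..n - p. monom
                 (\<Sum>h=l..n - p. limit_face_density (p + h) n
                     * real (face_number p (std_simplex (p + h)))
                     * real (interior_number h l)) l)
              (complex_volume n K))"
  unfolding weakly_converges_def
proof (intro allI impI, elim conjE)
  fix f l
  assume f: "continuous_map (complex_topology K) euclideanreal f"
    and supp: "compactin (complex_topology K) (complex_topology K closure_of {x \<in> topspace (complex_topology K). f x \<noteq> 0})"
  let ?S = "{s \<in> K. \<exists>x\<in>convex hull s. f x \<noteq> 0}"
  let ?P = "\<Sum>l=0..n - p. monom (\<Sum>h=l..n - p. limit_face_density (p + h) n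
      * real (face_number p (std_simplex (p + h))) * real (interior_number h l)) l"
  let ?\<Phi> = "\<lambda>s. simplex_integral (truncate_to s f) n s"
  have K: "bary_complex K" using assms(1) by (rule geometric_bary_complex)
  have dim: "card s \<le> Suc n" if "s \<in> K" for s using assms(3) that by (auto simp: has_dimension_def)
  have fm: "f \<in> borel_measurable (borel_of (complex_topology K))" using f by (rule continuous_map_borel_of_measurable)
  \<comment> \<open>This finite family does not depend on \<open>d\<close>, so the limit can be
    taken simplex by simplex.\<close>
  have fin: "finite ?S" by (rule finite_simplices_meeting_support[OF assms(1,2) supp])
  have "(\<integral>x. f x \<partial>poly_times_measure ?P (complex_volume n K) l) = limit_coeff n p l * (\<integral>x. f x \<partial>complex_volume n K)"
    unfolding poly_times_measure_def limit_coeff_eq[symmetric]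
    using fm limit_coeff_nonneg[OF assms(4)] by (intro integral_scale_measure) (auto cong: measurable_cong_sets)
  also have "\<dots> = limit_coeff n p l * (\<Sum>s | s \<in> simplices n K \<and> (\<exists>x\<in>convex hull s. f x \<noteq> 0). ?\<Phi> s)"
    by (simp only: integral_complex_volume[OF assms(1) f fin])
  \<comment> \<open>Simplices of lower dimension are kept with value 0, so that both sides are sums
    over the same index set.\<close>
  also have "\<dots> = (\<Sum>s\<in>?S. if card s = Suc n then limit_coeff n p l * ?\<Phi> s else 0)"
    unfolding sum_distrib_left using fin by (intro sum.mono_neutral_cong_left) (auto simp: simplices_def)
  finally have rhs: "(\<integral>x. f x \<partial>poly_times_measure ?P (complex_volume n K) l) =
      (\<Sum>s\<in>?S. if card s = Suc n then limit_coeff n p l * ?\<Phi> s else 0)" .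
  have lhs: "(\<integral>x. f x \<partial>dual_block_measure n d p K l) =
      (\<Sum>s\<in>?S. (\<Sum>\<tau>\<in>pieces d K s. flag_sum f p l \<tau>) / fact (Suc n) ^ d)" for d
    unfolding sum_divide_distrib[of _ ?S, symmetric] by (rule integral_dual_block_measure[OF K dim fm fin])
  have "(\<lambda>d. \<Sum>s\<in>?S. (\<Sum>\<tau>\<in>pieces d K s. flag_sum f p l \<tau>) / fact (Suc n) ^ d)
      \<longlonglongrightarrow> (\<Sum>s\<in>?S. if card s = Suc n then limit_coeff n p l * ?\<Phi> s else 0)"
    using continuous_map_complex_topology_on_hull[OF f] assms(4)
    by (intro tendsto_sum flag_sum_limit[OF K _ dim]) auto
  then show "(\<lambda>d. \<integral>x. f x \<partial>dual_block_measure n d p K l) \<longlonglongrightarrow> (\<integral>x. f x \<partial>poly_times_measure ?P (complex_volume n K) l)"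
    unfolding rhs lhs .
qed

end
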